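(* Let $n\ge 1$ and let $u_0\in H^1(\mathbf{R}^n)\cap L^1(\mathbf{R}^n)$, $u_1\in L^2(\mathbf{R}^n)\cap L^1(\mathbf{R}^n)$. Let $u$ be the solution to the Cauchy problem $$u_{tt}-\Delta u+\Delta^2 u_t=0\quad (t>0,\ x\in\mathbf{R}^n),\qquad u(0,x)=u_0(x),\quad u_t(0,x)=u_1(x)\quad (x\in\mathbf{R}^n).$$ Define the total energy $E(t):=\|u_t(t,\cdot)\|_{L^2(\mathbf{R}^n)}^2+\|\nabla u(t,\cdot)\|_{L^2(\mathbf{R}^n)}^2$. Then $$\lim_{t\to\infty}E(t)=0.$$
   Context: The Fourier transform is $\hat f(\xi)=(2\pi)^{-n/2}\int_{\mathbf{R}^n}e^{-ix\cdot\xi}f(x)\,dx$ (extended to $L^2$ as usual), taken in the $x$ variable only. For $[u_0,u_1]\in H^1(\mathbf{R}^n)\times L^2(\mathbf{R}^n)$, "the solution" $u$ is the unique mild solution $u\in C([0,\infty);H^1(\mathbf{R}^n))\cap C^1([0,\infty);L^2(\mathbf{R}^n))$. In Fourier space it is given by $$\hat u(t,\xi)=E_0(t,\xi)\widehat{u_0}(\xi)+E_1(t,\xi)\Big(\tfrac{|\xi|^4}{2}\widehat{u_0}(\xi)+\widehat{u_1}(\xi)\Big),$$ where, for $|\xi|\le\sqrt[3]{2}$, with $\omega=\tfrac12\sqrt{4|\xi|^2-|\xi|^8}$, $E_0=e^{-\frac12 t|\xi|^4}\cos(t\omega)$ and $E_1=e^{-\frac12 t|\xi|^4}\sin(t\omega)/\omega$;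 and for $|\xi|\ge\sqrt[3]{2}$, with $\kappa=\tfrac12\sqrt{|\xi|^8-4|\xi|^2}$, $E_0=e^{-\frac12 t|\xi|^4}\cosh(t\kappa)$ and $E_1=e^{-\frac12 t|\xi|^4}\sinh(t\kappa)/\kappa$ (the quotients being extended by continuity where $\omega=0$ or $\kappa=0$). Equivalently, for a.e. $\xi$, $\hat u(\cdot,\xi)$ solves $\hat u_{tt}+|\xi|^4\hat u_t+|\xi|^2\hat u=0$ with $\hat u(0,\xi)=\widehat{u_0}(\xi)$, $\hat u_t(0,\xi)=\widehat{u_1}(\xi)$. By Plancherel, $E(t)=\|\hat u_t(t,\cdot)\|_{L^2}^2+\||\xi|\hat u(t,\cdot)\|_{L^2}^2$. *)

theory Defs
  imports "HOL-Analysis.Analysis"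
begin

text \<open>
  Elements of the Lebesgue and Sobolev spaces are represented by complex-valued Borel functions on
  \<open>real ^ 'n\<close> (so the dimension is \<open>CARD('n) \<ge> 1\<close>); every almost-everywhere class has
  such a representative. All notions below depend only on the class.
\<close>

definition L2_space :: "(real ^ 'n \<Rightarrow> complex) set" where
  "L2_space = {f. f \<in> borel_measurable lborel \<and> integrable lborel (\<lambda>x. (cmod (f x))\<^sup>2)}"

definition L2_norm :: "(real ^ 'n \<Rightarrow> complex) \<Rightarrow> real" where
  "L2_norm f = sqrt (LINT x|lborel. (cmod (f x))\<^sup>2)"

definition partial_deriv :: "'n \<Rightarrow> (real ^ 'n \<Rightarrow> complex) \<Rightarrow> real ^ 'n \<Rightarrow> complex" where
  "partial_deriv i f x = frechet_derivative f (at x) (axis i 1)"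

definition laplacian :: "(real ^ 'n \<Rightarrow> complex) \<Rightarrow> real ^ 'n \<Rightarrow> complex" where
  "laplacian f x = (\<Sum>i\<in>UNIV. partial_deriv i (partial_deriv i f) x)"

text \<open>\<open>C\<^sub>c\<^sup>\<infinity>(R\<^sup>n)\<close>: each iterated partial derivative is (Frechet) differentiable everywhere,
  so all of them are continuous.\<close>

definition test_functions :: "(real ^ 'n \<Rightarrow> complex) set" where
  "test_functions = {\<phi>. (\<forall>is x. foldr partial_deriv is \<phi> differentiable (at x))
                      \<and> compact (closure {x. \<phi> x \<noteq> 0})}"

definition has_weak_partial ::
    "(real ^ 'n \<Rightarrow> complex) \<Rightarrow> 'n \<Rightarrow> (real ^ 'n \<Rightarrow> complex) \<Rightarrow> bool" where
  "has_weak_partial f i g \<longleftrightarrow>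
     (\<forall>\<phi>\<in>test_functions.
        (LINT x|lborel. f x * partial_deriv i \<phi> x) = - (LINT x|lborel. g x * \<phi> x))"

definition H1_space :: "(real ^ 'n \<Rightarrow> complex) set" where
  "H1_space = {f \<in> L2_space. \<forall>i. \<exists>g\<in>L2_space. has_weak_partial f i g}"

text \<open>Only meaningful for \<open>f \<in> H1_space\<close>, where it is unique up to null sets.\<close>

definition weak_partial :: "'n \<Rightarrow> (real ^ 'n \<Rightarrow> complex) \<Rightarrow> real ^ 'n \<Rightarrow> complex" where
  "weak_partial i f = (SOME g. g \<in> L2_space \<and> has_weak_partial f i g)"

definition grad_L2_norm :: "(real ^ 'n \<Rightarrow> complex) \<Rightarrow> real" where
  "grad_L2_norm f = sqrt (LINT x|lborel. (\<Sum>i\<in>UNIV. (cmod (weak_partial i f x))\<^sup>2))"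

definition H1_norm :: "(real ^ 'n \<Rightarrow> complex) \<Rightarrow> real" where
  "H1_norm f = sqrt ((L2_norm f)\<^sup>2 + (grad_L2_norm f)\<^sup>2)"

definition continuous_into_H1 :: "(real \<Rightarrow> real ^ 'n \<Rightarrow> complex) \<Rightarrow> bool" where
  "continuous_into_H1 u \<longleftrightarrow>
     (\<forall>t\<ge>0. u t \<in> H1_space \<and>
        ((\<lambda>s. H1_norm (\<lambda>x. u s x - u t x)) \<longlongrightarrow> 0) (at t within {0..}))"

definition continuous_into_L2 :: "(real \<Rightarrow> real ^ 'n \<Rightarrow> complex) \<Rightarrow> bool" where
  "continuous_into_L2 u \<longleftrightarrow>
     (\<forall>t\<ge>0. u t \<in> L2_space \<and>
        ((\<lambda>s. L2_norm (\<lambda>x. u s x - u t x)) \<longlongrightarrow> 0) (at t within {0..}))"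

text \<open>Derivative in time of \<open>u : [0,\<infinity>) \<rightarrow> L\<^sup>2\<close> in the norm of \<open>L\<^sup>2\<close> (one-sided at \<open>t = 0\<close>).\<close>

definition has_L2_time_deriv ::
    "(real \<Rightarrow> real ^ 'n \<Rightarrow> complex) \<Rightarrow> (real ^ 'n \<Rightarrow> complex) \<Rightarrow> real \<Rightarrow> bool" where
  "has_L2_time_deriv u v t \<longleftrightarrow> v \<in> L2_space \<and>
     ((\<lambda>s. L2_norm (\<lambda>x. (u s x - u t x) / of_real (s - t) - v x)) \<longlongrightarrow> 0) (at t within {0..})"

definition time_deriv :: "(real \<Rightarrow> real ^ 'n \<Rightarrow> complex) \<Rightarrow> real \<Rightarrow> real ^ 'n \<Rightarrow> complex" where
  "time_deriv u t = (SOME v. has_L2_time_deriv u v t)"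

definition C1_into_L2 :: "(real \<Rightarrow> real ^ 'n \<Rightarrow> complex) \<Rightarrow> bool" where
  "C1_into_L2 u \<longleftrightarrow> continuous_into_L2 u \<and> (\<forall>t\<ge>0. \<exists>v. has_L2_time_deriv u v t) \<and>
     continuous_into_L2 (time_deriv u)"

text \<open>
  Mild solution \<open>u \<in> C([0,\<infinity>); H\<^sup>1) \<inter> C\<^sup>1([0,\<infinity>); L\<^sup>2)\<close> of
  \<open>u\<^sub>t\<^sub>t - \<Delta>u + \<Delta>\<^sup>2u\<^sub>t = 0\<close>, \<open>u(0) = u\<^sub>0\<close>, \<open>u\<^sub>t(0) = u\<^sub>1\<close>. For the first-order system
  \<open>U' = A U\<close> with \<open>U = (u, u\<^sub>t)\<close> and \<open>A (u, v) = (v, \<Delta>u - \<Delta>\<^sup>2v)\<close> in \<open>H\<^sup>1 \<times> L\<^sup>2\<close>, a mild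
  solution satisfies \<open>U(t) = U(0) + A (\<integral>\<^sub>0\<^sup>t U(s) ds)\<close>. The first component says that \<open>u\<^sub>t\<close> is the
  time derivative of \<open>u\<close>; the second one is the integrated equation below, where \<open>\<Delta>\<close> and
  \<open>\<Delta>\<^sup>2\<close> act in the sense of distributions.
\<close>

definition mild_solution ::
    "(real ^ 'n \<Rightarrow> complex) \<Rightarrow> (real ^ 'n \<Rightarrow> complex) \<Rightarrow> (real \<Rightarrow> real ^ 'n \<Rightarrow> complex) \<Rightarrow> bool" where
  "mild_solution u0 u1 u \<longleftrightarrow>
     continuous_into_H1 u \<and> C1_into_L2 u \<and>
     (AE x in lborel. u 0 x = u0 x) \<and>
     (AE x in lborel. time_deriv u 0 x = u1 x) \<and>
     (\<forall>\<phi>\<in>test_functions. \<forall>t\<ge>0.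
        (LINT x|lborel. (time_deriv u t x - u1 x) * \<phi> x) =
        integral {0..t} (\<lambda>s. (LINT x|lborel. u s x * laplacian \<phi> x)
                             - (LINT x|lborel. time_deriv u s x * laplacian (laplacian \<phi>) x)))"

definition energy :: "(real \<Rightarrow> real ^ 'n \<Rightarrow> complex) \<Rightarrow> real \<Rightarrow> real" where
  "energy u t = (L2_norm (time_deriv u t))\<^sup>2 + (grad_L2_norm (u t))\<^sup>2"

end

theory Submission imports Defs begin

text \<open>
  The proof avoids the Fourier transform. Convolving a solution \<open>u\<close> with a test function \<open>z\<close> gives
  a solution that is smooth in \<open>x\<close>; write \<open>En z\<close> for its energy. It satisfies
  \<open>(En z)' = -2 \<parallel>\<Delta> (z * u\<^sub>t)\<parallel>\<^sup>2\<close>, and equipartition of energy yields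
  \<open>En (\<Delta>z) = - (En z + Pf (\<Delta>z))'\<close> with \<open>Pf z = \<langle>z * u, z * u\<^sub>t\<rangle> + \<parallel>\<Delta> (z * u)\<parallel>\<^sup>2 / 2\<close>.
  As \<open>En (\<Delta>z)\<close> is nonincreasing, \<open>t En (\<Delta>z) t\<close> is bounded, and by interpolation the energy of
  each \<open>\<partial>\<^sub>i z * u\<close> tends to 0. Hence so does that of \<open>z * u\<close> minus a mean of finitely many of its
  translates, and the energy of this mean is small at time 0 by a mean ergodic argument, so it stays small.
  Finally, the energy of \<open>u - z * u\<close> does not increase and is small at time 0 for a mollifier \<open>z\<close>.
\<close>

text \<open>The energy controls the time derivative and the gradient of u, never u itself, so the
  equipartition functional cannot be bounded for a general kernel z. For the kernel
  \<open>laplacian z\<close> it can: one of the two derivatives falls on u and the other stays on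
  the kernel. The same Laplacian occurs in the dissipation, so the derivative of \<open>En z\<close>
  cancels exactly the kinetic term produced by \<open>Pf (laplacian z)\<close>, and no constant has
  to be absorbed. The price is a factor that vanishes at frequency zero. Interpolation reduces it to
  a first derivative, and means of translates deal with that one: a difference of translates is
  bounded by a derivative, while the mean of many translates retains only frequencies near a null
  set, where a square integrable function has little mass. Neither end of the spectrum decays at a
  uniform rate: the slow root of the characteristic equation behaves like -1/|\<xi>|^2 for large
  \<xi>, and the damping fades for small \<xi>. Hence both remainders, the means and the
  mollification error, are made small at time 0 and kept small by monotonicity.\<close>

section \<open>The Hilbert space of square integrable functions\<close>

lemma integrable_prod_L2:
  assumes "f \<in> L2_space" and "g \<in> L2_space"
  shows "integrable lborel (\<lambda>x. f x * g x)"
proof -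
  have [measurable]: "f \<in> borel_measurable lborel" "g \<in> borel_measurable lborel"
    using assms by (auto simp: L2_space_def)
  have "integrable lborel (\<lambda>x. (cmod (f x))\<^sup>2 + (cmod (g x))\<^sup>2)"
    using assms by (auto simp: L2_space_def)
  then show ?thesis
  proof (rule Bochner_Integration.integrable_bound)
    show "AE x in lborel. norm (f x * g x) \<le> norm ((cmod (f x))\<^sup>2 + (cmod (g x))\<^sup>2)"
    proof (rule AE_I2)
      fix x
      have "2 * (cmod (f x) * cmod (g x)) \<le> (cmod (f x))\<^sup>2 + (cmod (g x))\<^sup>2"
        using sum_squares_bound[of "cmod (f x)" "cmod (g x)"] by (simp add: mult.assoc)
      moreover have "0 \<le> cmod (f x) * cmod (g x)" by simp
      ultimately show "norm (f x * g x) \<le> norm ((cmod (f x))\<^sup>2 + (cmod (g x))\<^sup>2)"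
        unfolding norm_mult real_norm_def by linarith
    qed
  qed simp
qed

lemma L2_space_zero [simp]: "(\<lambda>x. 0) \<in> L2_space"
  by (simp add: L2_space_def)

lemma borel_measurable_cnj [measurable]: "cnj \<in> borel_measurable borel"
  by (intro borel_measurable_continuous_onI continuous_intros)

lemma L2_space_cnj:
  assumes "f \<in> L2_space" shows "(\<lambda>x. cnj (f x)) \<in> L2_space"
proof -
  have [measurable]: "f \<in> borel_measurable borel" using assms by (simp add: L2_space_def)
  show ?thesis using assms by (simp add: L2_space_def)
qed

lemma L2_space_cmult: "f \<in> L2_space \<Longrightarrow> (\<lambda>x. c * f x) \<in> L2_space"
  by (auto simp: L2_space_def norm_mult power_mult_distrib)

lemma L2_space_add:
  assumes "f \<in> L2_space" and "g \<in> L2_space"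
  shows "(\<lambda>x. f x + g x) \<in> L2_space"
proof -
  have [measurable]: "f \<in> borel_measurable lborel" "g \<in> borel_measurable lborel"
    using assms by (auto simp: L2_space_def)
  have "integrable lborel (\<lambda>x. 2 * (cmod (f x))\<^sup>2 + 2 * (cmod (g x))\<^sup>2)"
    using assms by (auto simp: L2_space_def)
  then have "integrable lborel (\<lambda>x. (cmod (f x + g x))\<^sup>2)"
  proof (rule Bochner_Integration.integrable_bound)
    show "AE x in lborel. norm ((cmod (f x + g x))\<^sup>2) \<le> norm (2 * (cmod (f x))\<^sup>2 + 2 * (cmod (g x))\<^sup>2)"
    proof (rule AE_I2)
      fix x
      have "(cmod (f x + g x))\<^sup>2 \<le> (cmod (f x) + cmod (g x))\<^sup>2"
        by (intro power_mono norm_triangle_ineq) auto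
      also have "\<dots> \<le> 2 * (cmod (f x))\<^sup>2 + 2 * (cmod (g x))\<^sup>2"
        using sum_squares_bound[of "cmod (f x)" "cmod (g x)"] by (simp add: power2_sum)
      finally show "norm ((cmod (f x + g x))\<^sup>2) \<le> norm (2 * (cmod (f x))\<^sup>2 + 2 * (cmod (g x))\<^sup>2)"
        by simp
    qed
  qed simp
  then show ?thesis by (simp add: L2_space_def)
qed

lemma L2_space_uminus: "f \<in> L2_space \<Longrightarrow> (\<lambda>x. - f x) \<in> L2_space"
  using L2_space_cmult[of f "-1"] by simp

lemma L2_space_diff: "f \<in> L2_space \<Longrightarrow> g \<in> L2_space \<Longrightarrow> (\<lambda>x. f x - g x) \<in> L2_space"
  using L2_space_add[of f "\<lambda>x. - g x"] L2_space_uminus[of g] by simp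

lemma L2_space_scaleR: "f \<in> L2_space \<Longrightarrow> (\<lambda>x. c *\<^sub>R f x) \<in> L2_space"
  using L2_space_cmult[of f "of_real c"] by (simp add: scaleR_conv_of_real)

lemma L2_space_measurable: "f \<in> L2_space \<Longrightarrow> f \<in> borel_measurable borel"
  by (simp add: L2_space_def)

text \<open>Membership in \<open>L2_space\<close> is built into the relation, which makes the
  quotient partial: functions outside the space represent no element of \<open>l2\<close>.\<close>

definition l2rel :: "(real ^ 'n \<Rightarrow> complex) \<Rightarrow> (real ^ 'n \<Rightarrow> complex) \<Rightarrow> bool" where
  "l2rel f g \<longleftrightarrow> f \<in> L2_space \<and> g \<in> L2_space \<and> (AE x in lborel. f x = g x)"

lemma part_equivp_l2rel: "part_equivp l2rel"
proof (rule part_equivpI)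
  show "\<exists>x. l2rel x x" by (rule exI[of _ "\<lambda>x. 0"]) (simp add: l2rel_def)
  show "symp l2rel" by (rule sympI) (auto simp: l2rel_def)
  show "transp l2rel" by (rule transpI) (auto simp: l2rel_def)
qed

quotient_type (overloaded) 'n l2 = "real ^ ('n::finite) \<Rightarrow> complex" / partial: l2rel
  by (rule part_equivp_l2rel)

lemma abs_l2_eq_iff:
  "f \<in> L2_space \<Longrightarrow> g \<in> L2_space \<Longrightarrow> abs_l2 f = abs_l2 g \<longleftrightarrow> (AE x in lborel. f x = g x)"
  using Quotient3_rel[OF Quotient3_l2, of f g] by (simp add: l2rel_def)

lemma rep_l2_L2: "rep_l2 F \<in> L2_space"
  using Quotient3_rep_reflp[OF Quotient3_l2, of F] by (simp add: l2rel_def)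

lemma abs_rep_l2: "abs_l2 (rep_l2 F) = F"
  by (rule Quotient3_abs_rep[OF Quotient3_l2])

lemma l2_cases:
  obtains f where "f \<in> L2_space" "F = abs_l2 f"
  using rep_l2_L2 abs_rep_l2 by metis

lemma rep_abs_l2: "f \<in> L2_space \<Longrightarrow> AE x in lborel. rep_l2 (abs_l2 f) x = f x"
  using abs_l2_eq_iff[of "rep_l2 (abs_l2 f)" f] by (simp add: rep_l2_L2 abs_rep_l2)

instantiation l2 :: (finite) real_inner
begin

lift_definition zero_l2 :: "'a l2" is "\<lambda>x. 0" by (simp add: l2rel_def)

lift_definition plus_l2 :: "'a l2 \<Rightarrow> 'a l2 \<Rightarrow> 'a l2" is "\<lambda>f g x. f x + g x"
  by (auto simp: l2rel_def intro: L2_space_add)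

lift_definition minus_l2 :: "'a l2 \<Rightarrow> 'a l2 \<Rightarrow> 'a l2" is "\<lambda>f g x. f x - g x"
  by (auto simp: l2rel_def intro: L2_space_diff)

lift_definition uminus_l2 :: "'a l2 \<Rightarrow> 'a l2" is "\<lambda>f x. - f x"
  by (auto simp: l2rel_def intro: L2_space_uminus)

lift_definition scaleR_l2 :: "real \<Rightarrow> 'a l2 \<Rightarrow> 'a l2" is "\<lambda>c f x. c *\<^sub>R f x"
  by (auto simp: l2rel_def intro: L2_space_scaleR)

text \<open>Taking the real part turns complex L2 into a real inner product space with the same
  norm, so that the calculus of \<open>real_inner\<close> applies.\<close>

lift_definition inner_l2 :: "'a l2 \<Rightarrow> 'a l2 \<Rightarrow> real" is "\<lambda>f g. Re (LINT x|lborel. f x * cnj (g x))"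
  by (rule arg_cong[of _ _ Re], rule integral_cong_AE)
    (auto simp: l2rel_def L2_space_def)

definition norm_l2 :: "'a l2 \<Rightarrow> real" where "norm_l2 F = sqrt (inner F F)"
definition dist_l2 :: "'a l2 \<Rightarrow> 'a l2 \<Rightarrow> real" where "dist_l2 F G = norm (F - G)"
definition sgn_l2 :: "'a l2 \<Rightarrow> 'a l2" where "sgn_l2 F = scaleR (inverse (norm F)) F"
definition uniformity_l2 :: "('a l2 \<times> 'a l2) filter" where
  "uniformity_l2 = (INF e\<in>{0 <..}. principal {(x, y). dist x y < e})"
definition open_l2 :: "'a l2 set \<Rightarrow> bool" where
  "open_l2 U = (\<forall>x\<in>U. eventually (\<lambda>(x', y). x' = x \<longrightarrow> y \<in> U) uniformity)"

instance
proof
  fix F G K :: "'a l2" and a b :: real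
  show "dist F G = norm (F - G)" by (simp add: dist_l2_def)
  show "sgn F = inverse (norm F) *\<^sub>R F" by (simp add: sgn_l2_def)
  show "(uniformity :: ('a l2 \<times> 'a l2) filter) = (INF e\<in>{0 <..}. principal {(x, y). dist x y < e})"
    by (simp add: uniformity_l2_def)
  show "open U = (\<forall>x\<in>U. eventually (\<lambda>(x', y). x' = x \<longrightarrow> y \<in> U) uniformity)" for U :: "'a l2 set"
    by (simp add: open_l2_def)
  show "F + G + K = F + (G + K)"
    by transfer (auto simp: l2rel_def algebra_simps intro!: L2_space_add)
  show "F + G = G + F"
    by transfer (auto simp: l2rel_def algebra_simps intro!: L2_space_add)
  show "0 + F = F" by transfer (auto simp: l2rel_def)
  show "- F + F = 0" by transfer (auto simp: l2rel_def)
  show "F - G = F + - G"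
    by transfer (auto simp: l2rel_def intro!: L2_space_diff)
  show "a *\<^sub>R (F + G) = a *\<^sub>R F + a *\<^sub>R G"
    by transfer (auto simp: l2rel_def scaleR_add_right intro!: L2_space_add L2_space_scaleR)
  show "(a + b) *\<^sub>R F = a *\<^sub>R F + b *\<^sub>R F"
    by transfer (auto simp: l2rel_def scaleR_add_left intro!: L2_space_add L2_space_scaleR)
  show "a *\<^sub>R b *\<^sub>R F = (a * b) *\<^sub>R F"
    by transfer (auto simp: l2rel_def intro!: L2_space_add L2_space_scaleR)
  show "1 *\<^sub>R F = F" by transfer (auto simp: l2rel_def)
  show "inner F G = inner G F"
  proof transfer
    fix f g :: "real ^ 'a \<Rightarrow> complex"
    have "(LINT x|lborel. f x * cnj (g x)) = cnj (LINT x|lborel. g x * cnj (f x))"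
      by (simp flip: Bochner_Integration.integral_cnj) (simp add: mult.commute)
    then show "Re (LINT x|lborel. f x * cnj (g x)) = Re (LINT x|lborel. g x * cnj (f x))" by simp
  qed
  show "inner (F + G) K = inner F K + inner G K"
    by transfer (simp add: l2rel_def distrib_right integrable_prod_L2 L2_space_cnj)
  show "inner (a *\<^sub>R F) G = a * inner F G"
    by transfer (simp add: l2rel_def)
  have sq: "Re (LINT x|lborel. f x * cnj (f x)) = (LINT x|lborel. (cmod (f x))\<^sup>2)"
    for f :: "real ^ 'a \<Rightarrow> complex"
    by (simp add: complex_norm_square[symmetric] del: of_real_power)
  show "0 \<le> inner F F"
    by transfer (simp add: sq)
  show "(inner F F = 0) = (F = 0)"
  proof transfer
    fix f :: "real ^ 'a \<Rightarrow> complex" assume "l2rel f f"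
    then have f: "f \<in> L2_space" by (simp add: l2rel_def)
    then have "integrable lborel (\<lambda>x. (cmod (f x))\<^sup>2)" by (simp add: L2_space_def)
    then have "(LINT x|lborel. (cmod (f x))\<^sup>2) = 0 \<longleftrightarrow> (AE x in lborel. (cmod (f x))\<^sup>2 = 0)"
      by (intro integral_nonneg_eq_0_iff_AE) auto
    then show "(Re (LINT x|lborel. f x * cnj (f x)) = 0) = l2rel f (\<lambda>x. 0)"
      using f by (simp add: sq l2rel_def)
  qed
  show "norm F = sqrt (inner F F)" by (simp add: norm_l2_def)
qed

end

lemma inner_abs_l2:
  "f \<in> L2_space \<Longrightarrow> g \<in> L2_space \<Longrightarrow>
    inner (abs_l2 f) (abs_l2 g) = Re (LINT x|lborel. f x * cnj (g x))"
  by (rule inner_l2.abs_eq) (auto simp: l2rel_def)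

lemma norm_abs_l2: "f \<in> L2_space \<Longrightarrow> norm (abs_l2 f) = L2_norm f"
  by (simp add: norm_eq_sqrt_inner inner_abs_l2 L2_norm_def
      complex_norm_square[symmetric] del: of_real_power)

lemma abs_l2_add:
  "f \<in> L2_space \<Longrightarrow> g \<in> L2_space \<Longrightarrow> abs_l2 f + abs_l2 g = abs_l2 (\<lambda>x. f x + g x)"
  by (rule plus_l2.abs_eq) (auto simp: l2rel_def)

lemma abs_l2_diff:
  "f \<in> L2_space \<Longrightarrow> g \<in> L2_space \<Longrightarrow> abs_l2 f - abs_l2 g = abs_l2 (\<lambda>x. f x - g x)"
  by (rule minus_l2.abs_eq) (auto simp: l2rel_def)

lemma abs_l2_scaleR: "f \<in> L2_space \<Longrightarrow> c *\<^sub>R abs_l2 f = abs_l2 (\<lambda>x. c *\<^sub>R f x)"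
  by (rule scaleR_l2.abs_eq) (auto simp: l2rel_def)

lemma abs_l2_zero: "0 = abs_l2 (\<lambda>x. 0)"
  by (rule zero_l2.abs_eq)

lemma ennreal_norm_abs_l2_sq:
  assumes "f \<in> L2_space"
  shows "ennreal ((norm (abs_l2 f))\<^sup>2) = (\<integral>\<^sup>+x. ennreal ((cmod (f x))\<^sup>2) \<partial>lborel)"
  using assms by (simp add: norm_abs_l2 L2_norm_def nn_integral_eq_integral L2_space_def)

lemma norm_abs_l2_le:
  assumes "f \<in> L2_space" and "0 \<le> B"
    and "(\<integral>\<^sup>+x. ennreal ((cmod (f x))\<^sup>2) \<partial>lborel) \<le> ennreal (B\<^sup>2)"
  shows "norm (abs_l2 f) \<le> B"
proof -
  have "ennreal ((norm (abs_l2 f))\<^sup>2) \<le> ennreal (B\<^sup>2)"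
    using assms by (simp add: ennreal_norm_abs_l2_sq)
  then show ?thesis using assms(2) by (simp add: power2_le_iff_abs_le)
qed

lemma L2_spaceI_nn:
  assumes "f \<in> borel_measurable borel"
    and "(\<integral>\<^sup>+x. ennreal ((cmod (f x))\<^sup>2) \<partial>lborel) < \<infinity>"
  shows "f \<in> L2_space"
  using assms by (auto simp: L2_space_def integrable_iff_bounded)

text \<open>\<open>inner\<close> sees only real parts, so the phase of the integral is first rotated
  away by a unimodular constant.\<close>

lemma cmod_integral_prod_le:
  assumes "f \<in> L2_space" and "g \<in> L2_space"
  shows "cmod (LINT x|lborel. f x * g x) \<le> norm (abs_l2 f) * norm (abs_l2 g)"
proof -
  define I where "I = (LINT x|lborel. f x * g x)"
  \<comment> \<open>As \<open>sgn 0\<close> is 0, the value 1 is needed in that case to keep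
    \<open>c\<close> unimodular.\<close>
  define c where "c = (if I = 0 then 1 else cnj (sgn I))"
  have c: "cmod c = 1" by (simp add: c_def norm_sgn)
  have "of_real (cmod I) = c * I"
  proof (cases "I = 0")
    case False
    have "cnj I * I = of_real (cmod I) * of_real (cmod I)"
      by (metis complex_norm_square mult.commute of_real_power power2_eq_square)
    then show ?thesis using False by (simp add: c_def sgn_eq)
  qed (simp add: c_def)
  then have "cmod I = Re (c * I)" by (metis Re_complex_of_real)
  also have "c * I = (LINT x|lborel. f x * cnj (cnj c * cnj (g x)))"
    by (simp add: I_def mult.left_commute flip: integral_mult_right_zero)
  also have "Re \<dots> = inner (abs_l2 f) (abs_l2 (\<lambda>x. cnj c * cnj (g x)))"
    by (rule inner_abs_l2[symmetric]) (auto intro!: assms L2_space_cmult L2_space_cnj)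
  also have "\<dots> \<le> norm (abs_l2 f) * norm (abs_l2 (\<lambda>x. cnj c * cnj (g x)))"
    by (rule norm_cauchy_schwarz)
  also have "norm (abs_l2 (\<lambda>x. cnj c * cnj (g x))) = norm (abs_l2 g)"
    using assms c by (simp add: norm_abs_l2 L2_space_cmult L2_space_cnj L2_norm_def norm_mult)
  finally show ?thesis by (simp add: I_def)
qed

section \<open>Translation and convolution\<close>

lemma lborel_distr_reflect: "distr lborel borel (\<lambda>x. c - x) = (lborel :: 'a::euclidean_space measure)"
  by (subst lborel_affine[of "-1" c]) (auto simp: density_1 one_ennreal_def[symmetric])

lemma nn_integral_lborel_reflect:
  fixes f :: "'a::euclidean_space \<Rightarrow> ennreal"
  assumes [measurable]: "f \<in> borel_measurable borel"
  shows "(\<integral>\<^sup>+x. f (c - x) \<partial>lborel) = (\<integral>\<^sup>+x. f x \<partial>lborel)"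
  by (subst (2) lborel_distr_reflect[of c, symmetric], subst nn_integral_distr) auto

lemma integral_lborel_reflect:
  fixes f :: "'a::euclidean_space \<Rightarrow> 'b::{banach, second_countable_topology}"
  assumes [measurable]: "f \<in> borel_measurable borel"
  shows "(LINT x|lborel. f (c - x)) = (LINT x|lborel. f x)"
  by (subst (2) lborel_distr_reflect[of c, symmetric], subst integral_distr) auto

lemma nn_integral_lborel_shift:
  fixes f :: "'a::euclidean_space \<Rightarrow> ennreal"
  assumes [measurable]: "f \<in> borel_measurable borel"
  shows "(\<integral>\<^sup>+x. f (x - a) \<partial>lborel) = (\<integral>\<^sup>+x. f x \<partial>lborel)"
  by (subst (2) lborel_distr_plus[of "- a", symmetric], subst nn_integral_distr) auto

lemma integral_lborel_shift:
  fixes f :: "'a::euclidean_space \<Rightarrow> 'b::{banach, second_countable_topology}"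
  assumes [measurable]: "f \<in> borel_measurable borel"
  shows "(LINT x|lborel. f (x - a)) = (LINT x|lborel. f x)"
  by (subst (2) lborel_distr_plus[of "- a", symmetric], subst integral_distr) auto

lemma AE_lborel_shift:
  fixes a :: "'a::euclidean_space"
  assumes "AE x in lborel. P x"
  shows "AE x in lborel. P (x - a)"
proof -
  obtain N where N: "{x. \<not> P x} \<subseteq> N" "N \<in> sets borel" "emeasure lborel N = 0"
    using AE_E[OF assms] by auto
  have meas: "{x. x - a \<in> N} \<in> sets lborel" using N(2) by measurable
  have "emeasure lborel {x. x - a \<in> N} = (\<integral>\<^sup>+x. indicator {x. x - a \<in> N} x \<partial>lborel)"
    using meas by simp
  also have "\<dots> = (\<integral>\<^sup>+x. indicator N (x - a) \<partial>lborel)"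
    by (simp add: indicator_def)
  also have "\<dots> = 0"
    using N by (subst nn_integral_lborel_shift) auto
  finally have "emeasure lborel {x. x - a \<in> N} = 0" .
  with meas show ?thesis
    using N(1) by (intro AE_I[where N="{x. x - a \<in> N}"]) auto
qed

text \<open>Cauchy-Schwarz for the measure with density |w|, followed by Tonelli. The slices are
  bounded only where \<open>w\<close> does not vanish: for a mollifier these are the small shifts,
  for the indicator of an interval the times in it.\<close>

lemma minkowski_integral_inequality:
  fixes F :: "'a \<times> 'b \<Rightarrow> complex" and w :: "'b \<Rightarrow> complex"
  assumes "sigma_finite_measure M" and "sigma_finite_measure N"
    and F [measurable]: "F \<in> borel_measurable (M \<Otimes>\<^sub>M N)"
    and w [measurable]: "w \<in> borel_measurable N"
    and W: "(\<integral>\<^sup>+y. ennreal (cmod (w y)) \<partial>N) \<le> ennreal W"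
    and B: "\<And>y. y \<in> space N \<Longrightarrow> w y \<noteq> 0 \<Longrightarrow> (\<integral>\<^sup>+x. ennreal ((cmod (F (x, y)))\<^sup>2) \<partial>M) \<le> ennreal (B\<^sup>2)"
  shows "(\<integral>\<^sup>+x. ennreal ((cmod (LINT y|N. w y * F (x, y)))\<^sup>2) \<partial>M) \<le> ennreal ((W * B)\<^sup>2)"
proof (cases "0 \<le> W")
  case False
  \<comment> \<open>\<open>ennreal\<close> sends a negative \<open>W\<close> to 0, so
    \<open>w\<close> vanishes almost everywhere.\<close>
  then have "(\<integral>\<^sup>+y. ennreal (cmod (w y)) \<partial>N) = 0" using W by (simp add: ennreal_neg)
  then have "AE y in N. w y = 0" by (simp add: nn_integral_0_iff_AE)
  then have "(LINT y|N. w y * F (x, y)) = 0" for x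
    by (intro integral_eq_zero_AE) auto
  then show ?thesis by simp
next
  case True
  interpret M: sigma_finite_measure M by fact
  interpret N: sigma_finite_measure N by fact
  interpret pair_sigma_finite M N ..
  have pt: "ennreal ((cmod (LINT y|N. w y * F (x, y)))\<^sup>2)
      \<le> ennreal W * (\<integral>\<^sup>+y. ennreal (cmod (w y)) * ennreal ((cmod (F (x, y)))\<^sup>2) \<partial>N)" if x: "x \<in> space M" for x
  proof -
    have [measurable]: "(\<lambda>y. F (x, y)) \<in> borel_measurable N" using x by measurable
    \<comment> \<open>If the integrand is not integrable, its integral is 0 by default and the bound
      persists.\<close>
    have "ennreal (cmod (LINT y|N. w y * F (x, y))) \<le> (\<integral>\<^sup>+y. ennreal (cmod (w y * F (x, y))) \<partial>N)"
      by (cases "integrable N (\<lambda>y. w y * F (x, y))")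
         (auto intro: integral_norm_bound_ennreal simp: not_integrable_integral_eq)
    then have "(ennreal (cmod (LINT y|N. w y * F (x, y))))\<^sup>2 \<le> (\<integral>\<^sup>+y. ennreal (cmod (w y * F (x, y))) \<partial>N)\<^sup>2"
      by (intro power_mono) auto
    \<comment> \<open>Splitting |w F| into sqrt |w| and sqrt |w| |F| lets Cauchy-Schwarz extract one
      factor \<open>W\<close> and leaves a weight that is linear in |w|.\<close>
    also have "(\<integral>\<^sup>+y. ennreal (cmod (w y * F (x, y))) \<partial>N)
        = (\<integral>\<^sup>+y. ennreal (sqrt (cmod (w y))) * ennreal (sqrt (cmod (w y)) * cmod (F (x, y))) \<partial>N)"
      by (intro nn_integral_cong) (simp add: norm_mult mult.assoc[symmetric] flip: ennreal_mult)
    also have "\<dots>\<^sup>2 \<le> (\<integral>\<^sup>+y. (ennreal (sqrt (cmod (w y))))\<^sup>2 \<partial>N)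
        * (\<integral>\<^sup>+y. (ennreal (sqrt (cmod (w y)) * cmod (F (x, y))))\<^sup>2 \<partial>N)"
      by (rule Cauchy_Schwarz_nn_integral) auto
    also have "\<dots> = (\<integral>\<^sup>+y. ennreal (cmod (w y)) \<partial>N)
        * (\<integral>\<^sup>+y. ennreal (cmod (w y)) * ennreal ((cmod (F (x, y)))\<^sup>2) \<partial>N)"
      by (simp add: ennreal_power power_mult_distrib ennreal_mult)
    also have "\<dots> \<le> ennreal W * (\<integral>\<^sup>+y. ennreal (cmod (w y)) * ennreal ((cmod (F (x, y)))\<^sup>2) \<partial>N)"
      by (intro mult_right_mono W) auto
    finally show ?thesis by (simp add: ennreal_power)
  qed
  have "(\<integral>\<^sup>+x. ennreal ((cmod (LINT y|N. w y * F (x, y)))\<^sup>2) \<partial>M)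
      \<le> (\<integral>\<^sup>+x. ennreal W * (\<integral>\<^sup>+y. ennreal (cmod (w y)) * ennreal ((cmod (F (x, y)))\<^sup>2) \<partial>N) \<partial>M)"
    by (intro nn_integral_mono pt)
  also have "\<dots> = ennreal W * (\<integral>\<^sup>+x. (\<integral>\<^sup>+y. ennreal (cmod (w y)) * ennreal ((cmod (F (x, y)))\<^sup>2) \<partial>N) \<partial>M)"
    by (intro nn_integral_cmult) measurable
  also have "(\<integral>\<^sup>+x. (\<integral>\<^sup>+y. ennreal (cmod (w y)) * ennreal ((cmod (F (x, y)))\<^sup>2) \<partial>N) \<partial>M)
      = (\<integral>\<^sup>+y. (\<integral>\<^sup>+x. ennreal (cmod (w y)) * ennreal ((cmod (F (x, y)))\<^sup>2) \<partial>M) \<partial>N)"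
    by (rule Fubini'[symmetric]) measurable
  also have "\<dots> = (\<integral>\<^sup>+y. ennreal (cmod (w y)) * (\<integral>\<^sup>+x. ennreal ((cmod (F (x, y)))\<^sup>2) \<partial>M) \<partial>N)"
    by (intro nn_integral_cong nn_integral_cmult) measurable
  also have "\<dots> \<le> (\<integral>\<^sup>+y. ennreal (cmod (w y)) * ennreal (B\<^sup>2) \<partial>N)"
  proof (intro nn_integral_mono)
    fix y assume "y \<in> space N"
    then show "ennreal (cmod (w y)) * (\<integral>\<^sup>+x. ennreal ((cmod (F (x, y)))\<^sup>2) \<partial>M) \<le> ennreal (cmod (w y)) * ennreal (B\<^sup>2)"
      using B[of y] by (cases "w y = 0") (auto intro!: mult_left_mono)
  qed
  also have "\<dots> = (\<integral>\<^sup>+y. ennreal (cmod (w y)) \<partial>N) * ennreal (B\<^sup>2)"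
    by (intro nn_integral_multc) measurable
  also have "\<dots> \<le> ennreal W * ennreal (B\<^sup>2)"
    by (intro mult_right_mono W) auto
  finally have "(\<integral>\<^sup>+x. ennreal ((cmod (LINT y|N. w y * F (x, y)))\<^sup>2) \<partial>M) \<le> ennreal W * (ennreal W * ennreal (B\<^sup>2))"
    by (simp add: mult_left_mono)
  also have "\<dots> = ennreal ((W * B)\<^sup>2)"
    using True by (simp add: power_mult_distrib power2_eq_square[of W] mult.assoc flip: ennreal_mult)
  finally show ?thesis .
qed

section \<open>Translations as isometries\<close>

lemma L2_space_shift:
  assumes "f \<in> L2_space"
  shows "(\<lambda>x. f (x - a)) \<in> L2_space"
proof (rule L2_spaceI_nn)
  have [measurable]: "f \<in> borel_measurable borel" using assms by (rule L2_space_measurable)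
  show "(\<lambda>x. f (x - a)) \<in> borel_measurable borel" by measurable
  have "(\<integral>\<^sup>+x. ennreal ((cmod (f (x - a)))\<^sup>2) \<partial>lborel) = (\<integral>\<^sup>+x. ennreal ((cmod (f x))\<^sup>2) \<partial>lborel)"
    by (rule nn_integral_lborel_shift[of "\<lambda>x. ennreal ((cmod (f x))\<^sup>2)"]) measurable
  then show "(\<integral>\<^sup>+x. ennreal ((cmod (f (x - a)))\<^sup>2) \<partial>lborel) < \<infinity>"
    by (simp add: assms flip: ennreal_norm_abs_l2_sq)
qed

lemma L2_space_reflect:
  assumes "f \<in> L2_space"
  shows "(\<lambda>x. f (a - x)) \<in> L2_space"
proof (rule L2_spaceI_nn)
  have [measurable]: "f \<in> borel_measurable borel" using assms by (rule L2_space_measurable)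
  show "(\<lambda>x. f (a - x)) \<in> borel_measurable borel" by measurable
  have "(\<integral>\<^sup>+x. ennreal ((cmod (f (a - x)))\<^sup>2) \<partial>lborel) = (\<integral>\<^sup>+x. ennreal ((cmod (f x))\<^sup>2) \<partial>lborel)"
    by (rule nn_integral_lborel_reflect[of "\<lambda>x. ennreal ((cmod (f x))\<^sup>2)"]) measurable
  then show "(\<integral>\<^sup>+x. ennreal ((cmod (f (a - x)))\<^sup>2) \<partial>lborel) < \<infinity>"
    by (simp add: assms flip: ennreal_norm_abs_l2_sq)
qed

definition translate :: "real ^ 'n \<Rightarrow> 'n l2 \<Rightarrow> 'n l2" where
  "translate a F = abs_l2 (\<lambda>x. rep_l2 F (x - a))"

lemma translate_abs:
  assumes "f \<in> L2_space" shows "translate a (abs_l2 f) = abs_l2 (\<lambda>x. f (x - a))"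
  using assms unfolding translate_def
  by (subst abs_l2_eq_iff) (auto intro: L2_space_shift rep_l2_L2 AE_lborel_shift rep_abs_l2)

lemma inner_translate: "inner (translate a F) (translate a G) = inner F G"
proof -
  obtain f g where fg: "f \<in> L2_space" "g \<in> L2_space" "F = abs_l2 f" "G = abs_l2 g"
    by (metis l2_cases)
  then have [measurable]: "f \<in> borel_measurable borel" "g \<in> borel_measurable borel"
    by (auto intro: L2_space_measurable)
  show ?thesis
    using fg integral_lborel_shift[of "\<lambda>x. f x * cnj (g x)" a]
    by (simp add: translate_abs inner_abs_l2 L2_space_shift)
qed

lemma translate_translate: "translate a (translate b F) = translate (a + b) F"
  by (cases F rule: l2_cases) (simp add: translate_abs L2_space_shift diff_diff_eq)

lemma translate_0 [simp]: "translate 0 F = F"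
  by (cases F rule: l2_cases) (simp add: translate_abs)

lemma translate_add: "translate a (F + G) = translate a F + translate a G"
  by (cases F rule: l2_cases, cases G rule: l2_cases)
    (simp add: translate_abs L2_space_shift abs_l2_add L2_space_add)

lemma translate_scaleR: "translate a (c *\<^sub>R F) = c *\<^sub>R translate a F"
  by (cases F rule: l2_cases)
    (simp add: translate_abs L2_space_shift abs_l2_scaleR L2_space_scaleR)

lemma norm_translate [simp]: "norm (translate a F) = norm F"
  by (simp add: norm_eq_sqrt_inner inner_translate)

lemma bounded_linear_translate: "bounded_linear (translate a)"
  by (rule bounded_linear_intro[of _ 1]) (auto simp: translate_add translate_scaleR)

lemma inner_translate_left: "inner (translate a F) G = inner F (translate (- a) G)"
  using inner_translate[of "- a" "translate a F" G] by (simp add: translate_translate)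

text \<open>Integrability gives the operator bound of Young's inequality. Square integrability makes
  the convolution integral converge at every point, so that identities between convolutions hold
  pointwise and not only almost everywhere.\<close>

definition kernels :: "(real ^ 'n \<Rightarrow> complex) set" where
  "kernels = {z \<in> L2_space. integrable lborel z}"

definition conv :: "(real ^ 'n \<Rightarrow> complex) \<Rightarrow> (real ^ 'n \<Rightarrow> complex) \<Rightarrow> real ^ 'n \<Rightarrow> complex" where
  "conv f z x = (LINT y|lborel. f y * z (x - y))"

lemma conv_commute:
  assumes [measurable]: "f \<in> borel_measurable borel" "z \<in> borel_measurable borel"
  shows "conv f z x = (LINT y|lborel. z y * f (x - y))"
  unfolding conv_def
  by (subst integral_lborel_reflect[where c = x, symmetric]) (auto simp: mult.commute)

lemma conv_measurable [measurable]:
  assumes [measurable]: "f \<in> borel_measurable borel" "z \<in> borel_measurable borel"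
  shows "conv f z \<in> borel_measurable borel"
proof -
  have "(\<lambda>x. LINT y|lborel. f y * z (x - y)) \<in> borel_measurable borel"
    by (rule sigma_finite_measure.borel_measurable_lebesgue_integral[OF sigma_finite_lborel]) measurable
  then show ?thesis by (simp add: conv_def[abs_def])
qed

text \<open>A convolution is a superposition of translates of \<open>f\<close> with weights
  \<open>z\<close>, so Minkowski's inequality applies.\<close>

lemma conv_young:
  assumes f: "f \<in> L2_space" and z: "z \<in> kernels"
  shows "(\<integral>\<^sup>+x. ennreal ((cmod (conv f z x))\<^sup>2) \<partial>lborel)
    \<le> ennreal (((LINT x|lborel. cmod (z x)) * norm (abs_l2 f))\<^sup>2)"
proof -
  have [measurable]: "f \<in> borel_measurable borel" "z \<in> borel_measurable borel"
    using f z by (auto simp: kernels_def intro: L2_space_measurable)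
  have "(\<integral>\<^sup>+x. ennreal ((cmod (LINT y|lborel. z y * (\<lambda>(x, y). f (x - y)) (x, y)))\<^sup>2) \<partial>lborel)
    \<le> ennreal (((LINT x|lborel. cmod (z x)) * norm (abs_l2 f))\<^sup>2)"
  proof (rule minkowski_integral_inequality)
    show "(\<integral>\<^sup>+y. ennreal (cmod (z y)) \<partial>lborel) \<le> ennreal (LINT x|lborel. cmod (z x))"
      using z by (subst nn_integral_eq_integral) (auto simp: kernels_def)
    show "(\<integral>\<^sup>+x. ennreal ((cmod ((\<lambda>(x, y). f (x - y)) (x, y)))\<^sup>2) \<partial>lborel) \<le> ennreal ((norm (abs_l2 f))\<^sup>2)" for y
      using nn_integral_lborel_shift[of "\<lambda>x. ennreal ((cmod (f x))\<^sup>2)" y]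
      by (simp add: ennreal_norm_abs_l2_sq f)
  qed (auto intro: sigma_finite_lborel)
  then show ?thesis by (simp add: conv_commute)
qed

lemma conv_L2:
  assumes f: "f \<in> L2_space" and z: "z \<in> kernels"
  shows "conv f z \<in> L2_space"
proof (rule L2_spaceI_nn)
  show "conv f z \<in> borel_measurable borel"
    using f z by (intro conv_measurable) (auto simp: kernels_def intro: L2_space_measurable)
  show "(\<integral>\<^sup>+x. ennreal ((cmod (conv f z x))\<^sup>2) \<partial>lborel) < \<infinity>"
    using conv_young[OF f z] by (simp add: le_less_trans)
qed

lemma norm_conv_le:
  assumes f: "f \<in> L2_space" and z: "z \<in> kernels"
  shows "norm (abs_l2 (conv f z)) \<le> (LINT x|lborel. cmod (z x)) * norm (abs_l2 f)"
  by (rule norm_abs_l2_le) (use conv_young[OF f z] conv_L2[OF f z] in auto)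

lemma integrable_conv:
  assumes "f \<in> L2_space" and "z \<in> kernels"
  shows "integrable lborel (\<lambda>y. f y * z (x - y))"
  using assms by (intro integrable_prod_L2 L2_space_reflect) (auto simp: kernels_def)

definition Conv :: "(real ^ 'n \<Rightarrow> complex) \<Rightarrow> 'n l2 \<Rightarrow> 'n l2" where
  "Conv z F = abs_l2 (conv (rep_l2 F) z)"

lemma Conv_abs:
  assumes f: "f \<in> L2_space" and z: "z \<in> kernels"
  shows "Conv z (abs_l2 f) = abs_l2 (conv f z)"
proof -
  have "conv (rep_l2 (abs_l2 f)) z = conv f z"
    unfolding conv_def
  proof (rule ext, rule integral_cong_AE)
    fix x
    show "AE y in lborel. rep_l2 (abs_l2 f) y * z (x - y) = f y * z (x - y)"
      using rep_abs_l2[OF f] by eventually_elim simp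
  qed (use integrable_conv[OF f z] integrable_conv[OF rep_l2_L2 z] in auto)
  then show ?thesis by (simp add: Conv_def)
qed

lemma norm_Conv_le:
  assumes "z \<in> kernels"
  shows "norm (Conv z F) \<le> (LINT x|lborel. cmod (z x)) * norm F"
  using norm_conv_le[OF rep_l2_L2 assms, of F] by (simp add: Conv_def abs_rep_l2)

lemma Conv_add:
  assumes z: "z \<in> kernels" shows "Conv z (F + G) = Conv z F + Conv z G"
proof -
  obtain f g where fg: "f \<in> L2_space" "g \<in> L2_space" "F = abs_l2 f" "G = abs_l2 g"
    by (metis l2_cases)
  have "conv (\<lambda>x. f x + g x) z = (\<lambda>x. conv f z x + conv g z x)"
    using integrable_conv[OF fg(1) z] integrable_conv[OF fg(2) z]
    by (auto simp: conv_def distrib_right)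
  then show ?thesis using fg z by (simp add: abs_l2_add L2_space_add Conv_abs conv_L2)
qed

lemma Conv_scaleR:
  assumes z: "z \<in> kernels" shows "Conv z (c *\<^sub>R F) = c *\<^sub>R Conv z F"
proof -
  obtain f where f: "f \<in> L2_space" "F = abs_l2 f" by (rule l2_cases)
  have "conv (\<lambda>x. c *\<^sub>R f x) z = (\<lambda>x. c *\<^sub>R conv f z x)"
    by (auto simp: conv_def)
  then show ?thesis using f z by (simp add: abs_l2_scaleR L2_space_scaleR Conv_abs conv_L2)
qed

lemma bounded_linear_Conv:
  assumes "z \<in> kernels" shows "bounded_linear (Conv z)"
  by (rule bounded_linear_intro[of _ "LINT x|lborel. cmod (z x)"])
    (use norm_Conv_le[OF assms] in \<open>auto simp: Conv_add Conv_scaleR assms mult.commute\<close>)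

lemma kernels_add: "z \<in> kernels \<Longrightarrow> w \<in> kernels \<Longrightarrow> (\<lambda>x. z x + w x) \<in> kernels"
  by (auto simp: kernels_def L2_space_add)

lemma kernels_scaleR: "z \<in> kernels \<Longrightarrow> (\<lambda>x. c *\<^sub>R z x) \<in> kernels"
  by (auto simp: kernels_def L2_space_scaleR)

lemma Conv_kernel_add:
  assumes "z \<in> kernels" and "w \<in> kernels"
  shows "Conv (\<lambda>x. z x + w x) F = Conv z F + Conv w F"
proof -
  obtain f where f: "f \<in> L2_space" "F = abs_l2 f" by (rule l2_cases)
  have "conv f (\<lambda>x. z x + w x) = (\<lambda>x. conv f z x + conv f w x)"
    using integrable_conv[OF f(1) assms(1)] integrable_conv[OF f(1) assms(2)]
    by (auto simp: conv_def distrib_left)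
  then show ?thesis using f assms by (simp add: abs_l2_add Conv_abs conv_L2 kernels_add)
qed

lemma Conv_kernel_scaleR:
  assumes "z \<in> kernels"
  shows "Conv (\<lambda>x. c *\<^sub>R z x) F = c *\<^sub>R Conv z F"
proof -
  obtain f where f: "f \<in> L2_space" "F = abs_l2 f" by (rule l2_cases)
  have "conv f (\<lambda>x. c *\<^sub>R z x) = (\<lambda>x. c *\<^sub>R conv f z x)"
    by (auto simp: conv_def)
  then show ?thesis using f assms by (simp add: abs_l2_scaleR Conv_abs conv_L2 kernels_scaleR)
qed

lemma Conv_kernel_zero: "Conv (\<lambda>x. 0) F = 0"
  by (simp add: Conv_def conv_def[abs_def] abs_l2_zero)

lemma kernels_shift:
  assumes "z \<in> kernels" shows "(\<lambda>x. z (x - a)) \<in> kernels"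
proof -
  have [measurable]: "z \<in> borel_measurable borel"
    using assms by (auto simp: kernels_def intro: L2_space_measurable)
  have "(\<integral>\<^sup>+x. ennreal (cmod (z (x - a))) \<partial>lborel) = (\<integral>\<^sup>+x. ennreal (cmod (z x)) \<partial>lborel)"
    by (rule nn_integral_lborel_shift[of "\<lambda>x. ennreal (cmod (z x))"]) measurable
  then show ?thesis
    using assms by (auto simp: kernels_def L2_space_shift integrable_iff_bounded)
qed

lemma Conv_kernel_shift:
  assumes "z \<in> kernels"
  shows "Conv (\<lambda>x. z (x - a)) F = translate a (Conv z F)"
proof -
  obtain f where f: "f \<in> L2_space" "F = abs_l2 f" by (rule l2_cases)
  have "conv f (\<lambda>x. z (x - a)) = (\<lambda>x. conv f z (x - a))"
    by (auto simp: conv_def algebra_simps)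
  then show ?thesis using f assms by (simp add: translate_abs Conv_abs conv_L2 kernels_shift)
qed

section \<open>Test functions\<close>

definition smooth :: "(real ^ 'n \<Rightarrow> complex) \<Rightarrow> bool" where
  "smooth f \<longleftrightarrow> (\<forall>is x. foldr partial_deriv is f differentiable (at x))"

text \<open>Replaces repeated inductions over lists of derivatives: in each application
  \<open>S\<close> consists of all functions of the shape in question.\<close>

lemma smooth_coinduct:
  assumes "f \<in> S"
    and diff: "\<And>f x. f \<in> S \<Longrightarrow> f differentiable (at x)"
    and closed: "\<And>f i. f \<in> S \<Longrightarrow> partial_deriv i f \<in> S"
  shows "smooth f"
proof -
  have "foldr partial_deriv is f \<in> S" for "is"
    by (induction "is") (auto intro: assms)
  then show ?thesis using diff by (auto simp: smooth_def)
qed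

lemma smooth_differentiable: "smooth f \<Longrightarrow> f differentiable (at x)"
  unfolding smooth_def by (metis foldr.simps(1) id_apply)

lemma smooth_partial_deriv: "smooth f \<Longrightarrow> smooth (partial_deriv i f)"
  unfolding smooth_def
proof (intro allI)
  fix "is" x assume "\<forall>is x. foldr partial_deriv is f differentiable at x"
  then have "foldr partial_deriv (is @ [i]) f differentiable at x" by blast
  then show "foldr partial_deriv is (partial_deriv i f) differentiable at x" by simp
qed

lemma partial_derivI: "(f has_derivative f') (at x) \<Longrightarrow> partial_deriv i f x = f' (axis i 1)"
  by (simp add: partial_deriv_def frechet_derivative_at[symmetric])

lemma smooth_has_derivative: "smooth f \<Longrightarrow> (f has_derivative frechet_derivative f (at x)) (at x)"
  using smooth_differentiable frechet_derivative_works by blast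

lemma partial_deriv_add:
  assumes "smooth f" and "smooth g"
  shows "partial_deriv i (\<lambda>x. f x + g x) = (\<lambda>x. partial_deriv i f x + partial_deriv i g x)"
proof
  fix x show "partial_deriv i (\<lambda>x. f x + g x) x = partial_deriv i f x + partial_deriv i g x"
    by (subst partial_derivI[OF has_derivative_add[OF smooth_has_derivative smooth_has_derivative]])
      (auto simp: assms partial_deriv_def)
qed

lemma partial_deriv_scaleR:
  assumes "smooth f"
  shows "partial_deriv i (\<lambda>x. c *\<^sub>R f x) = (\<lambda>x. c *\<^sub>R partial_deriv i f x)"
proof
  fix x show "partial_deriv i (\<lambda>x. c *\<^sub>R f x) x = c *\<^sub>R partial_deriv i f x"
    by (subst partial_derivI[OF has_derivative_scaleR_right[OF smooth_has_derivative]])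
      (auto simp: assms partial_deriv_def)
qed

lemma partial_deriv_reflect:
  assumes "smooth f"
  shows "partial_deriv i (\<lambda>x. f (a - x)) = (\<lambda>x. - partial_deriv i f (a - x))"
proof
  fix x
  have lin: "linear (frechet_derivative f (at (a - x)))"
    using smooth_has_derivative[OF assms] has_derivative_linear by blast
  have "((\<lambda>x. f (a - x)) has_derivative (\<lambda>h. frechet_derivative f (at (a - x)) (- h))) (at x)"
    by (rule has_derivative_compose[where g = f and f = "\<lambda>x. a - x", OF _ smooth_has_derivative[OF assms]])
       (auto intro!: derivative_eq_intros)
  then show "partial_deriv i (\<lambda>x. f (a - x)) x = - partial_deriv i f (a - x)"
    using linear_neg[OF lin] by (simp add: partial_derivI) (simp add: partial_deriv_def)
qed

lemma smooth_add:
  fixes f g :: "real ^ 'a \<Rightarrow> complex"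
  assumes "smooth f" "smooth g" shows "smooth (\<lambda>x. f x + g x)"
proof (rule smooth_coinduct[where S = "(\<lambda>(f, g) x. f x + g x) ` (Collect smooth \<times> Collect smooth)"])
  show "(\<lambda>x. f x + g x) \<in> (\<lambda>(f, g) x. f x + g x) ` (Collect smooth \<times> Collect smooth)"
    by (rule rev_image_eqI[of "(f, g)"]) (use assms in auto)
  fix h :: "real ^ 'a \<Rightarrow> complex" assume "h \<in> (\<lambda>(f, g) x. f x + g x) ` (Collect smooth \<times> Collect smooth)"
  then obtain f g :: "real ^ 'a \<Rightarrow> complex" where h: "h = (\<lambda>x. f x + g x)" "smooth f" "smooth g" by auto
  show "h differentiable at x" for x
    unfolding h by (rule differentiable_add; rule smooth_differentiable; fact)
  show "partial_deriv i h \<in> (\<lambda>(f, g) x. f x + g x) ` (Collect smooth \<times> Collect smooth)" for i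
    by (rule rev_image_eqI[of "(partial_deriv i f, partial_deriv i g)"])
      (use h in \<open>auto simp: partial_deriv_add intro: smooth_partial_deriv\<close>)
qed

lemma smooth_scaleR:
  fixes f :: "real ^ 'a \<Rightarrow> complex"
  assumes "smooth f" shows "smooth (\<lambda>x. c *\<^sub>R f x)"
proof (rule smooth_coinduct[where S = "(\<lambda>f x. c *\<^sub>R f x) ` Collect smooth"])
  show "(\<lambda>x. c *\<^sub>R f x) \<in> (\<lambda>f x. c *\<^sub>R f x) ` Collect smooth"
    by (rule rev_image_eqI[of f]) (use assms in auto)
  fix h :: "real ^ 'a \<Rightarrow> complex" assume "h \<in> (\<lambda>f x. c *\<^sub>R f x) ` Collect smooth"
  then obtain f :: "real ^ 'a \<Rightarrow> complex" where h: "h = (\<lambda>x. c *\<^sub>R f x)" "smooth f" by auto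
  show "h differentiable at x" for x
    unfolding h by (rule differentiable_scaleR[OF differentiable_const]; rule smooth_differentiable; fact)
  show "partial_deriv i h \<in> (\<lambda>f x. c *\<^sub>R f x) ` Collect smooth" for i
    by (rule rev_image_eqI[of "partial_deriv i f"])
      (use h in \<open>auto simp: partial_deriv_scaleR intro: smooth_partial_deriv\<close>)
qed

lemma smooth_uminus: "smooth f \<Longrightarrow> smooth (\<lambda>x. - f x)"
  using smooth_scaleR[of f "-1"] by simp

lemma smooth_reflect:
  fixes f :: "real ^ 'a \<Rightarrow> complex"
  assumes "smooth f" shows "smooth (\<lambda>x. f (a - x))"
proof (rule smooth_coinduct[where S = "(\<lambda>f x. f (a - x)) ` Collect smooth"])
  show "(\<lambda>x. f (a - x)) \<in> (\<lambda>f x. f (a - x)) ` Collect smooth"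
    by (rule rev_image_eqI[of f]) (use assms in auto)
  fix h :: "real ^ 'a \<Rightarrow> complex" assume "h \<in> (\<lambda>f x. f (a - x)) ` Collect smooth"
  then obtain f :: "real ^ 'a \<Rightarrow> complex" where h: "h = (\<lambda>x. f (a - x))" "smooth f" by auto
  show "h differentiable at x" for x
    unfolding h
    by (rule differentiable_compose[where f = f]) (use h smooth_differentiable in auto)
  show "partial_deriv i h \<in> (\<lambda>f x. f (a - x)) ` Collect smooth" for i
    by (rule rev_image_eqI[of "\<lambda>x. - partial_deriv i f x"])
      (use h in \<open>auto simp: partial_deriv_reflect smooth_uminus smooth_partial_deriv\<close>)
qed

lemma test_functions_iff: "f \<in> test_functions \<longleftrightarrow> smooth f \<and> bounded {x. f x \<noteq> 0}"
  by (simp add: test_functions_def smooth_def)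

lemma test_functions_smooth: "f \<in> test_functions \<Longrightarrow> smooth f"
  by (simp add: test_functions_iff)

text \<open>Off the closed support the function vanishes on an open set, so its derivative is 0
  there and the support cannot grow.\<close>

lemma test_functions_partial_deriv:
  assumes "f \<in> test_functions" shows "partial_deriv i f \<in> test_functions"
proof -
  have "{x. partial_deriv i f x \<noteq> 0} \<subseteq> closure {x. f x \<noteq> 0}"
  proof (rule ccontr)
    assume "\<not> ?thesis"
    then obtain x where x: "partial_deriv i f x \<noteq> 0" "x \<notin> closure {x. f x \<noteq> 0}" by blast
    have "(f has_derivative (\<lambda>h. 0)) (at x)"
    proof (rule has_derivative_transform_within_open[where f = "\<lambda>x. 0" and s = "- closure {x. f x \<noteq> 0}"])
      show "0 = f y" if "y \<in> - closure {x. f x \<noteq> 0}" for y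
        using that closure_subset[of "{x. f x \<noteq> 0}"] by auto
    qed (use x in auto)
    then show False using x by (simp add: partial_derivI)
  qed
  moreover have "bounded (closure {x. f x \<noteq> 0})"
    using assms by (auto simp: test_functions_iff)
  ultimately have "bounded {x. partial_deriv i f x \<noteq> 0}" by (rule bounded_subset[rotated])
  then show ?thesis
    using assms by (simp add: test_functions_iff smooth_partial_deriv)
qed

lemma test_functions_add:
  assumes "f \<in> test_functions" and "g \<in> test_functions"
  shows "(\<lambda>x. f x + g x) \<in> test_functions"
proof -
  have "{x. f x + g x \<noteq> 0} \<subseteq> {x. f x \<noteq> 0} \<union> {x. g x \<noteq> 0}" by auto
  moreover have "bounded ({x. f x \<noteq> 0} \<union> {x. g x \<noteq> 0})"
    using assms by (simp add: test_functions_iff)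
  ultimately have "bounded {x. f x + g x \<noteq> 0}" by (rule bounded_subset[rotated])
  then show ?thesis
    using assms by (simp add: test_functions_iff smooth_add)
qed

lemma test_functions_scaleR:
  assumes "f \<in> test_functions" shows "(\<lambda>x. c *\<^sub>R f x) \<in> test_functions"
proof -
  have "bounded {x. c *\<^sub>R f x \<noteq> 0}"
    by (rule bounded_subset[of "{x. f x \<noteq> 0}"]) (use assms in \<open>auto simp: test_functions_iff\<close>)
  then show ?thesis using assms by (simp add: test_functions_iff smooth_scaleR)
qed

lemma test_functions_diff:
  assumes "f \<in> test_functions" and "g \<in> test_functions"
  shows "(\<lambda>x. f x - g x) \<in> test_functions"
  using test_functions_add[OF assms(1) test_functions_scaleR[OF assms(2), of "-1"]] by simp

lemma test_functions_zero: "(\<lambda>x. 0) \<in> test_functions"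
proof -
  have "smooth (\<lambda>x. 0)"
  proof (rule smooth_coinduct[of _ "{\<lambda>x. 0}"])
    show "partial_deriv i f \<in> {\<lambda>x. 0}" if "f \<in> {\<lambda>x. 0}" for f i
      using that by (simp add: partial_deriv_def[abs_def])
  qed auto
  then show ?thesis by (simp add: test_functions_iff)
qed

lemma test_functions_sum:
  assumes "\<And>k. k \<in> A \<Longrightarrow> f k \<in> test_functions"
  shows "(\<lambda>x. \<Sum>k\<in>A. f k x) \<in> test_functions"
proof (cases "finite A")
  case True
  then show ?thesis using assms
    by (induction A) (auto intro: test_functions_add test_functions_zero)
qed (auto intro: test_functions_zero)

lemma test_functions_reflect:
  assumes "f \<in> test_functions" shows "(\<lambda>x. f (a - x)) \<in> test_functions"
proof -
  have "{x. f (a - x) \<noteq> 0} \<subseteq> (\<lambda>x. a - x) ` {x. f x \<noteq> 0}" by (force simp: image_iff)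
  moreover have "bounded ((\<lambda>x. a - x) ` {x. f x \<noteq> 0})"
    using assms bounded_translation[of "uminus ` {x. f x \<noteq> 0}" a]
    by (simp add: test_functions_iff image_image bounded_uminus)
  ultimately have "bounded {x. f (a - x) \<noteq> 0}" by (rule bounded_subset[rotated])
  then show ?thesis
    using assms by (simp add: test_functions_iff smooth_reflect)
qed

lemma test_functions_shift:
  assumes "f \<in> test_functions" shows "(\<lambda>x. f (x - a)) \<in> test_functions"
  using test_functions_reflect[OF test_functions_reflect[OF assms, of 0], of a]
  by simp

lemma test_functions_laplacian:
  "f \<in> test_functions \<Longrightarrow> laplacian f \<in> test_functions"
  unfolding laplacian_def[abs_def]
  by (intro test_functions_sum test_functions_partial_deriv)

text \<open>The two changes of sign cancel. Testing the equation with \<open>z (x - y)\<close> as a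
  function of y therefore yields convolutions with \<open>laplacian z\<close>.\<close>

lemma laplacian_reflect:
  assumes "smooth f"
  shows "laplacian (\<lambda>x. f (a - x)) = (\<lambda>x. laplacian f (a - x))"
proof -
  have "partial_deriv i (partial_deriv i (\<lambda>x. f (a - x))) = (\<lambda>x. partial_deriv i (partial_deriv i f) (a - x))" for i
    using partial_deriv_reflect[OF smooth_uminus[OF smooth_partial_deriv[OF assms]], of i i a]
      partial_deriv_scaleR[OF smooth_partial_deriv[OF assms], of i "-1" i]
    by (simp add: partial_deriv_reflect[OF assms])
  then show ?thesis by (simp add: laplacian_def[abs_def])
qed

lemma test_functions_continuous: "f \<in> test_functions \<Longrightarrow> continuous_on S f"
  by (meson continuous_at_imp_continuous_on differentiable_imp_continuous_within smooth_differentiable test_functions_smooth)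

lemma test_functions_supportE:
  assumes "f \<in> test_functions"
  obtains R where "0 < R" "\<And>x. R < norm x \<Longrightarrow> f x = 0"
proof -
  obtain R where R: "0 < R" "\<And>x. x \<in> {x. f x \<noteq> 0} \<Longrightarrow> norm x \<le> R"
    using assms by (auto simp: test_functions_iff bounded_pos)
  then have "f x = 0" if "R < norm x" for x using that by force
  then show ?thesis using R that by blast
qed

lemma test_functions_boundE:
  assumes "f \<in> test_functions"
  obtains B where "0 < B" "\<And>x. cmod (f x) \<le> B"
proof -
  obtain R where R: "0 < R" "\<And>x. R < norm x \<Longrightarrow> f x = 0"
    using test_functions_supportE[OF assms] by metis
  have "compact (f ` cball 0 R)"
    by (intro compact_continuous_image test_functions_continuous assms) auto
  then obtain B where B: "0 < B" "\<And>x. norm x \<le> R \<Longrightarrow> cmod (f x) \<le> B"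
    by (auto simp: bounded_pos dest!: compact_imp_bounded)
  then have "cmod (f x) \<le> B" for x
    by (cases "norm x \<le> R") (auto simp: R)
  then show ?thesis using B that by blast
qed

lemma test_functions_measurable: "f \<in> test_functions \<Longrightarrow> f \<in> borel_measurable borel"
  by (intro borel_measurable_continuous_onI test_functions_continuous)

lemma integrable_bounded_support:
  fixes f :: "'a::euclidean_space \<Rightarrow> 'b::{banach, second_countable_topology}"
  assumes "f \<in> borel_measurable borel" and B: "\<And>x. norm (f x) \<le> B" and R: "\<And>x. R < norm x \<Longrightarrow> f x = 0"
  shows "integrable lborel f"
proof -
  have "integrable lborel (indicator (cball (0::'a) R) :: 'a \<Rightarrow> real)"
    by (intro integrable_real_indicator) (simp_all add: emeasure_lborel_cball_finite[simplified])
  then have "integrable lborel (\<lambda>x. B * indicator (cball (0::'a) R) x)" by simp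
  then show ?thesis
  proof (rule Bochner_Integration.integrable_bound)
    show "AE x in lborel. norm (f x) \<le> norm (B * indicator (cball 0 R) x)"
    proof (rule AE_I2)
      fix x
      show "norm (f x) \<le> norm (B * indicator (cball 0 R) x)"
        using B[of x] R[of x] by (cases "norm x \<le> R") (auto simp: indicator_def)
    qed
  qed (use assms in simp)
qed

lemma test_functions_kernels:
  assumes "f \<in> test_functions" shows "f \<in> kernels"
proof -
  obtain R where R: "0 < R" "\<And>x. R < norm x \<Longrightarrow> f x = 0"
    using test_functions_supportE[OF assms] by metis
  obtain B where B: "0 < B" "\<And>x. cmod (f x) \<le> B"
    using test_functions_boundE[OF assms] by metis
  note [measurable] = test_functions_measurable[OF assms]
  have "integrable lborel f"
    by (rule integrable_bounded_support[of _ B R]) (use R B in auto)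
  moreover have "integrable lborel (\<lambda>x. (cmod (f x))\<^sup>2)"
    by (rule integrable_bounded_support[of _ "B\<^sup>2" R]) (use R B in \<open>auto intro!: power_mono\<close>)
  ultimately show ?thesis by (simp add: kernels_def L2_space_def)
qed

section \<open>Derivatives of translates and integration by parts\<close>

lemma test_functions_line_deriv:
  assumes "f \<in> test_functions"
  shows "((\<lambda>s. f (x + s *\<^sub>R axis i 1)) has_vector_derivative partial_deriv i f (x + s *\<^sub>R axis i 1)) (at s within S)"
proof -
  let ?D = "frechet_derivative f (at (x + s *\<^sub>R axis i 1))"
  have sm: "smooth f" using assms by (rule test_functions_smooth)
  have lin: "linear ?D"
    using smooth_has_derivative[OF sm] has_derivative_linear by blast
  have "((\<lambda>s. f (x + s *\<^sub>R axis i 1)) has_derivative (\<lambda>h. ?D (h *\<^sub>R axis i 1))) (at s within S)"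
    by (rule has_derivative_compose[where g = f and f = "\<lambda>s. x + s *\<^sub>R axis i 1", OF _ smooth_has_derivative[OF sm]])
       (auto intro!: derivative_eq_intros)
  then show ?thesis
    by (simp add: has_vector_derivative_def linear_cmul[OF lin] partial_deriv_def)
qed

text \<open>A second order Taylor remainder, measured in L1 because this is the norm of a kernel
  that bounds \<open>Conv\<close>. Pointwise it is at most \<open>B * h^2\<close>, and it lives in a
  fixed ball.\<close>

lemma test_functions_shift_estimate:
  assumes f: "f \<in> test_functions"
  shows "\<exists>K\<ge>0. \<forall>h. \<bar>h\<bar> \<le> 1 \<longrightarrow>
    (LINT x|lborel. cmod (f (x - h *\<^sub>R axis i 1) - f x + h *\<^sub>R partial_deriv i f x)) \<le> K * h\<^sup>2"
proof -
  let ?f1 = "partial_deriv i f" and ?f2 = "partial_deriv i (partial_deriv i f)"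
  have f1: "?f1 \<in> test_functions" and f2: "?f2 \<in> test_functions"
    by (auto intro!: test_functions_partial_deriv f)
  note [measurable] = test_functions_measurable[OF f] test_functions_measurable[OF f1]
  obtain B where B: "0 < B" "\<And>x. cmod (?f2 x) \<le> B"
    using test_functions_boundE[OF f2] by metis
  obtain R where R: "0 < R" "\<And>x. R < norm x \<Longrightarrow> f x = 0"
    using test_functions_supportE[OF f] by metis
  obtain R' where R': "0 < R'" "\<And>x. R' < norm x \<Longrightarrow> ?f1 x = 0"
    using test_functions_supportE[OF f1] by metis
  \<comment> \<open>\<open>R\<close> and \<open>R'\<close> cover the supports of \<open>f\<close>
    and of its derivative; the extra 1 allows for the shift by |h| \<le> 1.\<close>
  define K where "K = B * measure lborel (cball (0::real^'a) (R + R' + 1))"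
  have *: "(LINT x|lborel. cmod (f (x - h *\<^sub>R axis i 1) - f x + h *\<^sub>R ?f1 x)) \<le> K * h\<^sup>2"
    if h: "\<bar>h\<bar> \<le> 1" for h
  proof -
    have pt: "cmod (f (x - h *\<^sub>R axis i 1) - f x + h *\<^sub>R ?f1 x)
        \<le> B * h\<^sup>2 * indicator (cball 0 (R + R' + 1)) x" for x
    proof (cases "norm x \<le> R + R' + 1")
      case True
      let ?g = "\<lambda>s. f (x + s *\<^sub>R axis i 1)" and ?g' = "\<lambda>s. ?f1 (x + s *\<^sub>R axis i 1)"
      have seg: "\<bar>s\<bar> \<le> \<bar>h\<bar>" if "s \<in> closed_segment 0 (- h)" for s
        using that by (auto simp: closed_segment_eq_real_ivl split: if_splits)
      have Lip: "norm (?g' s - ?g' 0) \<le> B * norm (s - 0)" for s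
      proof (rule differentiable_bound[of UNIV ?g' "\<lambda>s h. h *\<^sub>R ?f2 (x + s *\<^sub>R axis i 1)"])
        show "(?g' has_derivative (\<lambda>h. h *\<^sub>R ?f2 (x + s *\<^sub>R axis i 1))) (at s)" for s
          using test_functions_line_deriv[OF f1, of x i s UNIV] by (simp add: has_vector_derivative_def)
        show "onorm (\<lambda>h. h *\<^sub>R ?f2 (x + s *\<^sub>R axis i 1)) \<le> B" for s
          by (rule onorm_le) (simp, subst mult.commute, intro mult_right_mono B(2) abs_ge_zero)
      qed auto
      have "norm (?g (- h) - ?g 0 - (- h - 0) *\<^sub>R ?g' 0) \<le> norm (- h - 0) * (B * \<bar>h\<bar>)"
      proof (rule vector_differentiable_bound_linearization[where S = "closed_segment 0 (- h)" and f' = ?g'])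
        show "norm (?g' s - ?g' 0) \<le> B * \<bar>h\<bar>" if "s \<in> closed_segment 0 (- h)" for s
        proof -
          have "B * \<bar>s\<bar> \<le> B * \<bar>h\<bar>"
            by (intro mult_left_mono seg that less_imp_le[OF B(1)])
          moreover have "norm (?g' s - ?g' 0) \<le> B * \<bar>s\<bar>" using Lip[of s] by simp
          ultimately show ?thesis by (rule order.trans[rotated])
        qed
      qed (auto intro: test_functions_line_deriv f)
      then have "cmod (f (x - h *\<^sub>R axis i 1) - f x + h *\<^sub>R ?f1 x) \<le> B * (\<bar>h\<bar> * \<bar>h\<bar>)"
        by (simp add: mult.left_commute)
      then show ?thesis using True by (simp add: power2_eq_square mult.assoc)
    next
      case False
      have "norm (x - h *\<^sub>R axis i 1 :: real^'a) \<ge> norm x - norm (h *\<^sub>R axis i 1 :: real^'a)"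
        by (rule norm_triangle_ineq2)
      then have "R < norm (x - h *\<^sub>R axis i 1)" "R < norm x" "R' < norm x"
        using False h R(1) R'(1) by (auto simp: norm_axis_1)
      then show ?thesis using R R' B(1) by simp
    qed
    have int: "integrable lborel (\<lambda>x. B * h\<^sup>2 * indicator (cball (0::real^'a) (R + R' + 1)) x)"
      by (intro integrable_mult_right integrable_real_indicator) (simp_all add: emeasure_lborel_cball_finite[simplified])
    have "(LINT x|lborel. cmod (f (x - h *\<^sub>R axis i 1) - f x + h *\<^sub>R ?f1 x))
      \<le> (LINT x|lborel. B * h\<^sup>2 * indicator (cball (0::real^'a) (R + R' + 1)) x)"
      by (intro integral_mono' int pt) (use B in \<open>auto\<close>)
    also have "\<dots> = K * h\<^sup>2"
      by (simp add: K_def)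
    finally show ?thesis .
  qed
  have "0 \<le> K" using B by (simp add: K_def)
  then show ?thesis using * by blast
qed

text \<open>The difference quotient is moved onto the kernel, where the Taylor estimate applies;
  hence it converges for every \<open>F\<close> in \<open>l2\<close>, smooth or not.\<close>

lemma translate_Conv_deriv:
  assumes z: "z \<in> test_functions"
  shows "((\<lambda>s. translate (s *\<^sub>R axis i 1) (Conv z F)) has_vector_derivative
    - translate (s *\<^sub>R axis i 1) (Conv (partial_deriv i z) F)) (at s within S)"
proof -
  let ?e = "axis i 1 :: real ^ 'a" and ?z1 = "partial_deriv i z"
  obtain K where K: "0 \<le> K" "\<And>h. \<bar>h\<bar> \<le> 1 \<Longrightarrow>
    (LINT x|lborel. cmod (z (x - h *\<^sub>R ?e) - z x + h *\<^sub>R ?z1 x)) \<le> K * h\<^sup>2"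
    using test_functions_shift_estimate[OF z, of i] by blast
  have z1: "?z1 \<in> test_functions" by (rule test_functions_partial_deriv[OF z])
  have est: "norm (translate (h *\<^sub>R ?e) (Conv z F) - Conv z F + h *\<^sub>R Conv ?z1 F) \<le> K * h\<^sup>2 * norm F"
    if "\<bar>h\<bar> \<le> 1" for h
  proof -
    let ?k = "\<lambda>x. z (x - h *\<^sub>R ?e) + (-1) *\<^sub>R z x + h *\<^sub>R ?z1 x"
    have tf: "?k \<in> test_functions"
      by (rule test_functions_add[OF test_functions_add[OF test_functions_shift[OF z] test_functions_scaleR[OF z]]
            test_functions_scaleR[OF z1]])
    have k: "z \<in> kernels" "?z1 \<in> kernels"
      by (simp_all add: test_functions_kernels z z1)
    have "Conv ?k F = translate (h *\<^sub>R ?e) (Conv z F) + (-1) *\<^sub>R Conv z F + h *\<^sub>R Conv ?z1 F"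
      by (simp only: Conv_kernel_add[OF kernels_add[OF kernels_shift[OF k(1)] kernels_scaleR[OF k(1)]] kernels_scaleR[OF k(2)]]
          Conv_kernel_add[OF kernels_shift[OF k(1)] kernels_scaleR[OF k(1)]]
          Conv_kernel_scaleR[OF k(1)] Conv_kernel_scaleR[OF k(2)] Conv_kernel_shift[OF k(1)])
    then have "Conv ?k F = translate (h *\<^sub>R ?e) (Conv z F) - Conv z F + h *\<^sub>R Conv ?z1 F"
      by simp
    then have "norm (translate (h *\<^sub>R ?e) (Conv z F) - Conv z F + h *\<^sub>R Conv ?z1 F)
      \<le> (LINT x|lborel. cmod (?k x)) * norm F"
      using norm_Conv_le[OF test_functions_kernels[OF tf], of F] by simp
    also have "\<dots> \<le> K * h\<^sup>2 * norm F"
      using K(2)[OF that] by (intro mult_right_mono) auto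
    finally show ?thesis .
  qed
  show ?thesis unfolding has_vector_derivative_def
  proof (rule has_derivativeI_sandwich[of 1 _ _ _ _ "\<lambda>y. K * \<bar>y - s\<bar> * norm F"])
    show "bounded_linear (\<lambda>h. h *\<^sub>R - translate (s *\<^sub>R ?e) (Conv ?z1 F))"
      by (rule bounded_linear_scaleR_left)
    show "((\<lambda>y. K * \<bar>y - s\<bar> * norm F) \<longlongrightarrow> 0) (at s within S)"
      by (auto intro!: tendsto_eq_intros)
    fix y assume y: "y \<noteq> s" "dist y s < 1"
    define h where "h = y - s"
    have h: "h \<noteq> 0" "\<bar>h\<bar> \<le> 1" using y by (auto simp: h_def dist_real_def)
    \<comment> \<open>By the group law, the increment at \<open>s\<close> is the isometric image of
      the increment at 0.\<close>
    have "translate (y *\<^sub>R ?e) (Conv z F) - translate (s *\<^sub>R ?e) (Conv z F)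
        - (y - s) *\<^sub>R - translate (s *\<^sub>R ?e) (Conv ?z1 F)
      = translate (s *\<^sub>R ?e) (translate (h *\<^sub>R ?e) (Conv z F) - Conv z F + h *\<^sub>R Conv ?z1 F)"
    proof -
      have "translate (y *\<^sub>R ?e) (Conv z F) = translate (s *\<^sub>R ?e) (translate (h *\<^sub>R ?e) (Conv z F))"
        by (simp add: translate_translate h_def scaleR_diff_left)
      then show ?thesis
        using linear_diff[OF bounded_linear.linear[OF bounded_linear_translate], of "s *\<^sub>R ?e"]
        by (simp add: translate_add translate_scaleR h_def)
    qed
    then have main: "norm (translate (y *\<^sub>R ?e) (Conv z F) - translate (s *\<^sub>R ?e) (Conv z F)
        - (y - s) *\<^sub>R - translate (s *\<^sub>R ?e) (Conv ?z1 F)) \<le> K * h\<^sup>2 * norm F"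
      using est[OF h(2)] by simp
    then show "norm (translate (y *\<^sub>R ?e) (Conv z F) - translate (s *\<^sub>R ?e) (Conv z F)
        - (y - s) *\<^sub>R - translate (s *\<^sub>R ?e) (Conv ?z1 F)) / norm (y - s) \<le> K * \<bar>y - s\<bar> * norm F"
    proof -
      have "K * h\<^sup>2 * norm F = K * \<bar>y - s\<bar> * norm F * norm (y - s)"
        by (simp add: h_def power2_eq_square)
      with main show ?thesis
        using y(1) by (subst pos_divide_le_eq) simp_all
    qed
  qed auto
qed

text \<open>The isometry \<open>translate\<close> can be placed on either factor, with opposite
  shifts; the two resulting derivatives of the same inner product at 0 must agree.\<close>

lemma inner_Conv_partial_deriv:
  assumes z: "z \<in> test_functions" and w: "w \<in> test_functions"
  shows "inner (Conv (partial_deriv i z) F) (Conv w G) = - inner (Conv z F) (Conv (partial_deriv i w) G)"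
proof -
  let ?e = "axis i 1 :: real ^ 'a"
  have 1: "((\<lambda>s. inner (translate (s *\<^sub>R ?e) (Conv z F)) (Conv w G)) has_vector_derivative
      inner (- Conv (partial_deriv i z) F) (Conv w G)) (at 0)"
    using bounded_linear.has_vector_derivative[OF bounded_linear_inner_left translate_Conv_deriv[OF z, of i F 0]]
    by simp
  have neg: "((\<lambda>s::real. - s) has_vector_derivative -1) (at 0)"
    by (auto intro!: derivative_eq_intros)
  have "((\<lambda>s. translate (s *\<^sub>R ?e) (Conv w G)) \<circ> (\<lambda>s. - s) has_vector_derivative
      (-1) *\<^sub>R (- Conv (partial_deriv i w) G)) (at 0)"
    using translate_Conv_deriv[OF w, of i G 0]
    by (intro vector_diff_chain_at neg) auto
  then have "((\<lambda>s. inner (Conv z F) (translate ((- s) *\<^sub>R ?e) (Conv w G))) has_vector_derivative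
      inner (Conv z F) (Conv (partial_deriv i w) G)) (at 0)"
    by (intro bounded_linear.has_vector_derivative[OF bounded_linear_inner_right]) (simp add: o_def)
  then have 2: "((\<lambda>s. inner (translate (s *\<^sub>R ?e) (Conv z F)) (Conv w G)) has_vector_derivative
      inner (Conv z F) (Conv (partial_deriv i w) G)) (at 0)"
    by (simp add: inner_translate_left)
  from vector_derivative_unique_at[OF 1 2] show ?thesis by simp
qed

lemma Conv_kernel_diff:
  assumes "z \<in> kernels" and "w \<in> kernels"
  shows "Conv (\<lambda>x. z x - w x) F = Conv z F - Conv w F"
  using Conv_kernel_add[OF assms(1) kernels_scaleR[OF assms(2), of "-1"]] Conv_kernel_scaleR[OF assms(2), of "-1"]
  by simp

lemma Conv_kernel_sum:
  assumes "\<And>k. k \<in> A \<Longrightarrow> z k \<in> test_functions"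
  shows "Conv (\<lambda>x. \<Sum>k\<in>A. z k x) F = (\<Sum>k\<in>A. Conv (z k) F)"
proof (cases "finite A")
  case True
  then show ?thesis using assms
    by (induction A) (auto simp: Conv_kernel_zero Conv_kernel_add test_functions_kernels test_functions_sum)
qed (auto simp: Conv_kernel_zero)

lemma Conv_laplacian:
  assumes "z \<in> test_functions"
  shows "Conv (laplacian z) F = (\<Sum>i\<in>UNIV. Conv (partial_deriv i (partial_deriv i z)) F)"
  unfolding laplacian_def[abs_def]
  by (intro Conv_kernel_sum test_functions_partial_deriv assms)

lemma inner_Conv_laplacian:
  assumes z: "z \<in> test_functions" and w: "w \<in> test_functions"
  shows "inner (Conv (laplacian z) F) (Conv w G) = inner (Conv z F) (Conv (laplacian w) G)"
  and "inner (Conv z F) (Conv (laplacian w) G)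
    = - (\<Sum>i\<in>UNIV. inner (Conv (partial_deriv i z) F) (Conv (partial_deriv i w) G))"
  by (simp_all add: Conv_laplacian assms inner_sum_left inner_sum_right sum_negf
      inner_Conv_partial_deriv test_functions_partial_deriv)

section \<open>Energy decay of regularized solutions\<close>

text \<open>The mean value inequality along the translation group, where the velocity has constant
  norm.\<close>

lemma norm_Conv_minus_translate_le:
  assumes z: "z \<in> test_functions"
  shows "norm (Conv z F - translate (s *\<^sub>R axis i 1) (Conv z F)) \<le> \<bar>s\<bar> * norm (Conv (partial_deriv i z) F)"
proof -
  let ?T = "\<lambda>s. translate (s *\<^sub>R axis i 1) (Conv z F)"
  have "norm (?T 0 - ?T s) \<le> norm (Conv (partial_deriv i z) F) * norm (0 - s)"
  proof (rule differentiable_bound[of UNIV ?T "\<lambda>s h. h *\<^sub>R - translate (s *\<^sub>R axis i 1) (Conv (partial_deriv i z) F)"])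
    show "(?T has_derivative (\<lambda>h. h *\<^sub>R - translate (s *\<^sub>R axis i 1) (Conv (partial_deriv i z) F))) (at s)" for s
      using translate_Conv_deriv[OF z, of i F s UNIV] by (simp add: has_vector_derivative_def)
    show "onorm (\<lambda>h. h *\<^sub>R - translate (s *\<^sub>R axis i 1) (Conv (partial_deriv i z) F)) \<le> norm (Conv (partial_deriv i z) F)" for s
      by (rule onorm_le) simp
  qed auto
  then show ?thesis by (simp add: mult.commute)
qed

text \<open>Derivatives are taken within the half line, so that the initial time is
  included.\<close>

lemma deriv_le_imp_diff_le:
  fixes f :: "real \<Rightarrow> real"
  assumes "0 \<le> s" and "s \<le> t"
    and der: "\<And>r. 0 \<le> r \<Longrightarrow> (f has_vector_derivative f' r) (at r within {0..})"
    and le: "\<And>r. s \<le> r \<Longrightarrow> r \<le> t \<Longrightarrow> f' r \<le> c"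
  shows "f t - f s \<le> c * (t - s)"
proof -
  have "\<exists>x\<in>{s..t}. f t - f s = (\<lambda>h. h *\<^sub>R f' x) (t - s)"
  proof (rule mvt_very_simple)
    fix x assume "s \<le> x" "x \<le> t"
    then show "(f has_derivative (\<lambda>h. h *\<^sub>R f' x)) (at x within {s..t})"
      using der[of x] assms(1) unfolding has_vector_derivative_def
      by (auto intro: has_derivative_subset[of f _ x "{0..}" "{s..t}"])
  qed (use assms(2) in simp)
  then obtain x where x: "x \<in> {s..t}" "f t - f s = (t - s) * f' x" by auto
  then have "(t - s) * f' x \<le> (t - s) * c"
    using le[of x] assms(2) by (intro mult_left_mono) auto
  then show ?thesis using x by (simp add: mult.commute)
qed

text \<open>What the decay argument uses of a mild solution. The equation is required only after
  convolution with a test function, since the second time derivative and the fourth order term need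
  not be square integrable. \<open>G i\<close> stands for the weak derivative in direction
  i.\<close>

locale damped_flow =
  fixes U V :: "real \<Rightarrow> 'n::finite l2" and G :: "'n \<Rightarrow> real \<Rightarrow> 'n l2"
  assumes U_deriv: "0 \<le> t \<Longrightarrow> (U has_vector_derivative V t) (at t within {0..})"
    and V_deriv: "z \<in> test_functions \<Longrightarrow> 0 \<le> t \<Longrightarrow> ((\<lambda>t. Conv z (V t)) has_vector_derivative
      Conv (laplacian z) (U t) - Conv (laplacian (laplacian z)) (V t)) (at t within {0..})"
    and G_eq: "z \<in> test_functions \<Longrightarrow> 0 \<le> t \<Longrightarrow> Conv z (G i t) = Conv (partial_deriv i z) (U t)"
begin

text \<open>\<open>None\<close> stands for \<open>u\<^sub>t\<close> and \<open>Some i\<close> for \<open>\<partial>\<^sub>i u\<close>, so that the energy is a single sum over components.\<close>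

definition component :: "'n option \<Rightarrow> real \<Rightarrow> 'n l2" where
  "component a t = (case a of None \<Rightarrow> V t | Some i \<Rightarrow> G i t)"

text \<open>The gradient enters through \<open>G\<close> and not through derivatives of the kernel,
  so that \<open>En\<close> keeps a limit when the kernel concentrates at a point.
  \<open>En_eq\<close> gives the form suited to differentiation in time.\<close>

definition En :: "(real ^ 'n \<Rightarrow> complex) \<Rightarrow> real \<Rightarrow> real" where
  "En z t = (\<Sum>a\<in>UNIV. (norm (Conv z (component a t)))\<^sup>2)"

lemma En_nonneg: "0 \<le> En z t"
  by (simp add: En_def sum_nonneg)

lemma norm_Conv_component_le: "(norm (Conv z (component a t)))\<^sup>2 \<le> En z t"
  unfolding En_def by (rule member_le_sum) auto

lemma En_eq:
  assumes "z \<in> test_functions" and "0 \<le> t"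
  shows "En z t = (norm (Conv z (V t)))\<^sup>2 + (\<Sum>i\<in>UNIV. (norm (Conv (partial_deriv i z) (U t)))\<^sup>2)"
  using assms by (simp add: En_def component_def UNIV_option_conv sum.reindex G_eq)

lemma Conv_U_deriv:
  assumes "z \<in> test_functions" and "0 \<le> t"
  shows "((\<lambda>t. Conv z (U t)) has_vector_derivative Conv z (V t)) (at t within {0..})"
  by (rule bounded_linear.has_vector_derivative[OF bounded_linear_Conv[OF test_functions_kernels] U_deriv])
    (use assms in auto)

lemma inner_deriv:
  fixes f g :: "real \<Rightarrow> 'n l2"
  assumes "(f has_vector_derivative f') (at t within S)" and "(g has_vector_derivative g') (at t within S)"
  shows "((\<lambda>t. inner (f t) (g t)) has_vector_derivative inner (f t) g' + inner f' (g t)) (at t within S)"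
  by (rule bounded_bilinear.has_vector_derivative[OF bounded_bilinear_inner assms])

text \<open>After integration by parts the wave terms of the kinetic and the gradient part cancel,
  and the bilaplacian is shared equally between the two factors, which leaves a square.\<close>

lemma En_deriv:
  assumes z: "z \<in> test_functions" and t: "0 \<le> t"
  shows "(En z has_vector_derivative - 2 * (norm (Conv (laplacian z) (V t)))\<^sup>2) (at t within {0..})"
proof -
  let ?E = "\<lambda>t. inner (Conv z (V t)) (Conv z (V t))
    + (\<Sum>i\<in>UNIV. inner (Conv (partial_deriv i z) (U t)) (Conv (partial_deriv i z) (U t)))"
  let ?V' = "Conv (laplacian z) (U t) - Conv (laplacian (laplacian z)) (V t)"
  have lap: "laplacian z \<in> test_functions" by (rule test_functions_laplacian[OF z])
  have "(?E has_vector_derivative (inner (Conv z (V t)) ?V' + inner ?V' (Conv z (V t)))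
    + (\<Sum>i\<in>UNIV. inner (Conv (partial_deriv i z) (U t)) (Conv (partial_deriv i z) (V t))
        + inner (Conv (partial_deriv i z) (V t)) (Conv (partial_deriv i z) (U t)))) (at t within {0..})"
    by (intro has_vector_derivative_add has_vector_derivative_sum inner_deriv V_deriv Conv_U_deriv
        test_functions_partial_deriv z t)
  moreover have "(inner (Conv z (V t)) ?V' + inner ?V' (Conv z (V t)))
    + (\<Sum>i\<in>UNIV. inner (Conv (partial_deriv i z) (U t)) (Conv (partial_deriv i z) (V t))
        + inner (Conv (partial_deriv i z) (V t)) (Conv (partial_deriv i z) (U t)))
    = - 2 * (norm (Conv (laplacian z) (V t)))\<^sup>2"
  proof -
    have "inner (Conv z (V t)) ?V' = inner (Conv z (V t)) (Conv (laplacian z) (U t)) - (norm (Conv (laplacian z) (V t)))\<^sup>2"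
      unfolding power2_norm_eq_inner by (simp only: inner_diff_right inner_Conv_laplacian(1)[OF z lap])
    moreover have "inner (Conv z (V t)) (Conv (laplacian z) (U t))
      = - (\<Sum>i\<in>UNIV. inner (Conv (partial_deriv i z) (V t)) (Conv (partial_deriv i z) (U t)))"
      by (rule inner_Conv_laplacian(2)[OF z z])
    moreover have "inner ?V' (Conv z (V t)) = inner (Conv z (V t)) ?V'"
      by (rule inner_commute)
    moreover have "(\<Sum>i\<in>UNIV. inner (Conv (partial_deriv i z) (U t)) (Conv (partial_deriv i z) (V t)))
      = (\<Sum>i\<in>UNIV. inner (Conv (partial_deriv i z) (V t)) (Conv (partial_deriv i z) (U t)))"
      by (intro sum.cong refl inner_commute)
    ultimately show ?thesis by (simp only: sum.distrib)
  qed
  ultimately have "(?E has_vector_derivative - 2 * (norm (Conv (laplacian z) (V t)))\<^sup>2) (at t within {0..})"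
    by (simp only:)
  then show ?thesis
    by (rule has_vector_derivative_transform[rotated 2]) (use t in \<open>simp_all add: En_eq[OF z] power2_norm_eq_inner\<close>)
qed

lemma En_antimono:
  assumes "z \<in> test_functions" and "0 \<le> s" and "s \<le> t"
  shows "En z t \<le> En z s"
  using deriv_le_imp_diff_le[OF assms(2,3) En_deriv[OF assms(1)], of 0] by simp

text \<open>The first summand comes from pairing the equation with the solution itself; the second
  is a correction whose derivative cancels the contribution of the damping.\<close>

definition Pf :: "(real ^ 'n \<Rightarrow> complex) \<Rightarrow> real \<Rightarrow> real" where
  "Pf w t = inner (Conv w (U t)) (Conv w (V t)) + inner (Conv (laplacian w) (U t)) (Conv (laplacian w) (U t)) / 2"

text \<open>The derivative is the kinetic part minus the gradient part, written with
  \<open>En\<close> so that it can be added to \<open>En_deriv\<close>.\<close>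

lemma Pf_deriv:
  assumes w: "w \<in> test_functions" and t: "0 \<le> t"
  shows "(Pf w has_vector_derivative 2 * (norm (Conv w (V t)))\<^sup>2 - En w t) (at t within {0..})"
proof -
  have lap: "laplacian w \<in> test_functions" by (rule test_functions_laplacian[OF w])
  let ?V' = "Conv (laplacian w) (U t) - Conv (laplacian (laplacian w)) (V t)"
  have "(Pf w has_vector_derivative (inner (Conv w (U t)) ?V' + inner (Conv w (V t)) (Conv w (V t)))
     + (inner (Conv (laplacian w) (U t)) (Conv (laplacian w) (V t))
        + inner (Conv (laplacian w) (V t)) (Conv (laplacian w) (U t))) / 2) (at t within {0..})"
    unfolding Pf_def[abs_def]
    by (intro has_vector_derivative_add has_vector_derivative_divide inner_deriv V_deriv Conv_U_deriv w lap t)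
  moreover have "(inner (Conv w (U t)) ?V' + inner (Conv w (V t)) (Conv w (V t)))
     + (inner (Conv (laplacian w) (U t)) (Conv (laplacian w) (V t))
        + inner (Conv (laplacian w) (V t)) (Conv (laplacian w) (U t))) / 2
    = 2 * (norm (Conv w (V t)))\<^sup>2 - En w t"
  proof -
    have "inner (Conv w (U t)) ?V' = inner (Conv w (U t)) (Conv (laplacian w) (U t))
        - inner (Conv (laplacian w) (U t)) (Conv (laplacian w) (V t))"
      by (simp only: inner_diff_right inner_Conv_laplacian(1)[OF w lap])
    moreover have "inner (Conv w (U t)) (Conv (laplacian w) (U t))
      = - (\<Sum>i\<in>UNIV. (norm (Conv (partial_deriv i w) (U t)))\<^sup>2)"
      unfolding power2_norm_eq_inner by (rule inner_Conv_laplacian(2)[OF w w])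
    moreover have "inner (Conv (laplacian w) (V t)) (Conv (laplacian w) (U t))
      = inner (Conv (laplacian w) (U t)) (Conv (laplacian w) (V t))"
      by (rule inner_commute)
    moreover have "inner (Conv w (V t)) (Conv w (V t)) = (norm (Conv w (V t)))\<^sup>2"
      by (rule power2_norm_eq_inner[symmetric])
    ultimately show ?thesis unfolding En_eq[OF w t] by simp
  qed
  ultimately show ?thesis by (simp only:)
qed

text \<open>Of the two derivatives in each term of the Laplacian, one passes to the solution through
  \<open>G_eq\<close> and the other stays on the kernel, so each term is a component of the energy
  for \<open>partial_deriv i z\<close>.\<close>

lemma Conv_laplacian_U_bound:
  assumes z: "z \<in> test_functions" and t: "0 \<le> t"
  shows "norm (Conv (laplacian z) (U t)) \<le> (\<Sum>i\<in>UNIV. sqrt (En (partial_deriv i z) 0))"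
proof -
  have "norm (Conv (partial_deriv i (partial_deriv i z)) (U t)) \<le> sqrt (En (partial_deriv i z) 0)" for i
  proof (rule real_le_rsqrt)
    have d: "partial_deriv i z \<in> test_functions" by (rule test_functions_partial_deriv[OF z])
    have "(norm (Conv (partial_deriv i z) (component (Some i) t)))\<^sup>2 \<le> En (partial_deriv i z) t"
      by (rule norm_Conv_component_le)
    also have "\<dots> \<le> En (partial_deriv i z) 0"
      by (rule En_antimono[OF d]) (use t in auto)
    finally show "(norm (Conv (partial_deriv i (partial_deriv i z)) (U t)))\<^sup>2 \<le> En (partial_deriv i z) 0"
      by (simp add: component_def G_eq d t)
  qed
  then show ?thesis
    unfolding Conv_laplacian[OF z] by (intro sum_norm_le) auto
qed

text \<open>Since \<open>En (laplacian z)\<close> is nonincreasing, the function \<open>F\<close>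
  below falls on [0, t] at least with slope \<open>En (laplacian z) t\<close>. A lower bound for
  \<open>F\<close> that is uniform in time then limits this slope times t.\<close>

lemma En_laplacian_bound:
  assumes z: "z \<in> test_functions"
  shows "\<exists>C. \<forall>t\<ge>0. t * En (laplacian z) t \<le> C"
proof -
  let ?w = "laplacian z"
  have w: "?w \<in> test_functions" by (rule test_functions_laplacian[OF z])
  define F where "F t = En z t + Pf ?w t" for t
  \<comment> \<open>The kinetic term of \<open>Pf_deriv\<close> for \<open>?w\<close> and the
    dissipation of \<open>En z\<close> are the same square with opposite signs.\<close>
  have F_deriv: "(F has_vector_derivative - En ?w t) (at t within {0..})" if "0 \<le> t" for t
    using has_vector_derivative_add[OF En_deriv[OF z that] Pf_deriv[OF w that]] by (simp add: F_def[abs_def])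
  define S where "S = (\<Sum>i\<in>UNIV. sqrt (En (partial_deriv i z) 0))"
  have "t * En ?w t \<le> F 0 + (S\<^sup>2 + En ?w 0) / 2" if t: "0 \<le> t" for t
  proof -
    have "F t - F 0 \<le> - En ?w t * (t - 0)"
      by (rule deriv_le_imp_diff_le[OF _ t F_deriv]) (auto intro: En_antimono w)
    moreover have "- F t \<le> (S\<^sup>2 + En ?w 0) / 2"
    proof -
      let ?a = "Conv ?w (U t)" and ?b = "Conv ?w (V t)"
      have "norm ?a \<le> S" unfolding S_def by (rule Conv_laplacian_U_bound[OF z t])
      then have "(norm ?a)\<^sup>2 \<le> S\<^sup>2" by (intro power_mono) auto
      moreover have "(norm ?b)\<^sup>2 \<le> En ?w 0"
        using norm_Conv_component_le[of ?w None t] En_antimono[OF w _ t] by (simp add: component_def)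
      moreover have "- inner ?a ?b \<le> norm ?a * norm ?b"
        using norm_cauchy_schwarz[of "- ?a" ?b] by simp
      moreover have "2 * (norm ?a * norm ?b) \<le> (norm ?a)\<^sup>2 + (norm ?b)\<^sup>2"
        using sum_squares_bound[of "norm ?a" "norm ?b"] by (simp add: mult.assoc)
      moreover have "0 \<le> En z t" by (rule En_nonneg)
      moreover have "0 \<le> inner (Conv (laplacian ?w) (U t)) (Conv (laplacian ?w) (U t))" by simp
      \<comment> \<open>The arithmetic of the bound: the nonnegative \<open>e\<close> and
        \<open>q\<close> are discarded, and the inner product \<open>i\<close> is estimated by
        Cauchy-Schwarz and 2ab \<le> a^2 + b^2.\<close>
      moreover have "- (e + (i + q / 2)) \<le> (s + r) / 2"
        if "x \<le> s" "y \<le> r" "- i \<le> p" "2 * p \<le> x + y" "0 \<le> e" "0 \<le> q" for e i q s r x y p :: real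
        using that by (simp add: field_simps)
      ultimately show ?thesis
        unfolding F_def Pf_def by blast
    qed
    moreover have "t * p \<le> b + q" if "a - b \<le> - p * (t - 0)" "- a \<le> q" for a b p q :: real
      using that by (simp add: algebra_simps)
    ultimately show ?thesis by blast
  qed
  then show ?thesis by blast
qed

lemma En_laplacian_tendsto:
  assumes z: "z \<in> test_functions"
  shows "(En (laplacian z) \<longlongrightarrow> 0) at_top"
proof -
  obtain C where C: "\<And>t. 0 \<le> t \<Longrightarrow> t * En (laplacian z) t \<le> C"
    using En_laplacian_bound[OF z] by blast
  show ?thesis
  proof (rule tendsto_sandwich[of "\<lambda>_. 0" _ _ "\<lambda>t. C * inverse t"])
    show "\<forall>\<^sub>F t in at_top. En (laplacian z) t \<le> C * inverse t"
      using eventually_gt_at_top[of 0]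
      by eventually_elim (use C in \<open>simp add: field_simps\<close>)
    show "((\<lambda>t. C * inverse t) \<longlongrightarrow> 0) at_top"
      by (intro tendsto_mult_right_zero tendsto_inverse_0_at_top filterlim_ident)
  qed (auto simp: En_nonneg)
qed

text \<open>One integration by parts bounds a squared gradient by the function times its Laplacian,
  in each component separately. The first factor never exceeds its initial bound, so smallness of
  the second suffices.\<close>

lemma En_partial_deriv_le:
  assumes z: "z \<in> test_functions" and t: "0 \<le> t"
  shows "En (partial_deriv i z) t \<le> real CARD('n option) * (sqrt (En z 0) * sqrt (En (laplacian z) t))"
proof -
  have "(norm (Conv (partial_deriv i z) (component a t)))\<^sup>2 \<le> sqrt (En z 0) * sqrt (En (laplacian z) t)" for a
  proof -
    let ?X = "component a t"
    have "(norm (Conv (partial_deriv i z) ?X))\<^sup>2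
      \<le> (\<Sum>i\<in>UNIV. inner (Conv (partial_deriv i z) ?X) (Conv (partial_deriv i z) ?X))"
      unfolding power2_norm_eq_inner by (rule member_le_sum) auto
    also have "\<dots> = inner (- Conv z ?X) (Conv (laplacian z) ?X)"
      using inner_Conv_laplacian(2)[OF z z, of ?X ?X] by simp
    also have "\<dots> \<le> norm (Conv z ?X) * norm (Conv (laplacian z) ?X)"
      using norm_cauchy_schwarz[of "- Conv z ?X"] by simp
    also have "\<dots> \<le> sqrt (En z 0) * sqrt (En (laplacian z) t)"
    proof (rule mult_mono)
      show "norm (Conv z ?X) \<le> sqrt (En z 0)"
        using norm_Conv_component_le[of z a t] En_antimono[OF z _ t] by (intro real_le_rsqrt) auto
      show "norm (Conv (laplacian z) ?X) \<le> sqrt (En (laplacian z) t)"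
        by (intro real_le_rsqrt norm_Conv_component_le)
    qed (auto simp: En_nonneg)
    finally show ?thesis .
  qed
  then have "En (partial_deriv i z) t \<le> (\<Sum>a\<in>(UNIV :: 'n option set). sqrt (En z 0) * sqrt (En (laplacian z) t))"
    unfolding En_def[of "partial_deriv i z"] by (intro sum_mono)
  then show ?thesis by simp
qed

lemma En_partial_deriv_tendsto:
  assumes z: "z \<in> test_functions"
  shows "(En (partial_deriv i z) \<longlongrightarrow> 0) at_top"
proof (rule tendsto_sandwich[of "\<lambda>_. 0"])
  show "\<forall>\<^sub>F t in at_top. En (partial_deriv i z) t \<le> real CARD('n option) * (sqrt (En z 0) * sqrt (En (laplacian z) t))"
    using eventually_ge_at_top[of 0] by eventually_elim (rule En_partial_deriv_le[OF z])
  show "((\<lambda>t. real CARD('n option) * (sqrt (En z 0) * sqrt (En (laplacian z) t))) \<longlongrightarrow> 0) at_top"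
    using tendsto_real_sqrt[OF En_laplacian_tendsto[OF z]]
    by (auto intro!: tendsto_mult_right_zero)
qed (auto simp: En_nonneg)

end

section \<open>Means of translates\<close>

text \<open>The Cesaro mean of the unit translation in one coordinate direction; for
  \<open>N = 0\<close> it is 0.\<close>

definition translation_mean :: "'n \<Rightarrow> nat \<Rightarrow> 'n::finite l2 \<Rightarrow> 'n l2" where
  "translation_mean i N F = (1 / real N) *\<^sub>R (\<Sum>k<N. translate (real k *\<^sub>R axis i 1) F)"

lemma translation_mean_add:
  "translation_mean i N (F + G) = translation_mean i N F + translation_mean i N G"
  by (simp add: translation_mean_def translate_add sum.distrib scaleR_add_right)

lemma norm_translation_mean_le: "norm (translation_mean i N F) \<le> norm F"
proof (cases "N = 0")
  case False
  have "norm (\<Sum>k<N. translate (real k *\<^sub>R axis i 1) F) \<le> (\<Sum>k<N. norm F)"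
    by (rule sum_norm_le) simp
  then show ?thesis using False by (simp add: translation_mean_def field_simps)
qed (simp add: translation_mean_def)

text \<open>Reduces the mean ergodic argument to bounded supports; the radius is a natural number so
  that overlapping translates can be counted.\<close>

lemma l2_truncation:
  fixes F :: "'n::finite l2"
  assumes "0 < e"
  shows "\<exists>f R. f \<in> L2_space \<and> (\<forall>x. real R < norm x \<longrightarrow> f x = 0) \<and> norm (F - abs_l2 f) < e"
proof -
  obtain f where f: "f \<in> L2_space" "F = abs_l2 f" by (rule l2_cases)
  have [measurable]: "f \<in> borel_measurable borel" using f(1) by (rule L2_space_measurable)
  define g where "g n x = indicator (cball 0 (real n)) x *\<^sub>R f x" for n :: nat and x
  have [measurable]: "g n \<in> borel_measurable borel" for n
    unfolding g_def[abs_def] by (intro borel_measurable_scaleR borel_measurable_indicator) auto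
  have g: "g n \<in> L2_space" for n
  proof -
    have "integrable lborel (\<lambda>x. (cmod (f x))\<^sup>2)" using f(1) by (simp add: L2_space_def)
    then have "integrable lborel (\<lambda>x. (cmod (g n x))\<^sup>2)"
      by (rule Bochner_Integration.integrable_bound) (auto simp: g_def indicator_def)
    then show ?thesis by (simp add: L2_space_def)
  qed
  have "(\<lambda>n. LINT x|lborel. (cmod (f x - g n x))\<^sup>2) \<longlonglongrightarrow> (LINT x|(lborel :: (real ^ 'n) measure). 0)"
  proof (rule integral_dominated_convergence[where w = "\<lambda>x. (cmod (f x))\<^sup>2"])
    show "integrable lborel (\<lambda>x. (cmod (f x))\<^sup>2)" using f(1) by (simp add: L2_space_def)
    show "AE x in lborel. (\<lambda>n. (cmod (f x - g n x))\<^sup>2) \<longlonglongrightarrow> 0"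
    proof (rule AE_I2)
      fix x :: "real ^ 'n"
      obtain m where m: "norm x \<le> real m" using real_arch_simple by blast
      have "\<forall>\<^sub>F n in sequentially. (cmod (f x - g n x))\<^sup>2 = 0"
        using eventually_ge_at_top[of m] by eventually_elim (use m in \<open>simp add: g_def\<close>)
      then show "(\<lambda>n. (cmod (f x - g n x))\<^sup>2) \<longlonglongrightarrow> 0" by (rule tendsto_eventually)
    qed
    show "AE x in lborel. norm ((cmod (f x - g n x))\<^sup>2) \<le> (cmod (f x))\<^sup>2" for n
      by (auto simp: g_def indicator_def)
  qed auto
  then have "(\<lambda>n. sqrt (LINT x|lborel. (cmod (f x - g n x))\<^sup>2)) \<longlonglongrightarrow> sqrt 0"
    by (intro tendsto_real_sqrt) simp
  moreover have "norm (F - abs_l2 (g n)) = sqrt (LINT x|lborel. (cmod (f x - g n x))\<^sup>2)" for n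
    by (simp add: f g abs_l2_diff norm_abs_l2 L2_space_diff L2_norm_def)
  ultimately have "(\<lambda>n. norm (F - abs_l2 (g n))) \<longlonglongrightarrow> 0" by simp
  then obtain n where "norm (F - abs_l2 (g n)) < e"
    using order_tendstoD(2)[OF _ assms] eventually_happens'[OF sequentially_bot] by blast
  moreover have "\<forall>x. real n < norm x \<longrightarrow> g n x = 0" by (simp add: g_def)
  ultimately show ?thesis using g[of n] by blast
qed

lemma inner_translate_disjoint:
  fixes f :: "real ^ 'n::finite \<Rightarrow> complex"
  assumes f: "f \<in> L2_space" and R: "\<And>x. R < norm x \<Longrightarrow> f x = 0" and "2 * R < norm (a - b)"
  shows "inner (translate a (abs_l2 f)) (translate b (abs_l2 f)) = 0"
proof -
  have "f (x - a) * cnj (f (x - b)) = 0" for x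
  proof (cases "norm (x - a) \<le> R")
    case True
    have "norm (a - b) \<le> norm (x - a) + norm (x - b)"
      using norm_triangle_ineq4[of "x - b" "x - a"] by simp
    then have "R < norm (x - b)" using True assms(3) by linarith
    then show ?thesis using R by simp
  qed (use R in simp)
  then have "(LINT x|lborel. f (x - a) * cnj (f (x - b))) = 0"
    by (simp only: Bochner_Integration.integral_zero)
  then show ?thesis
    by (simp add: f translate_abs inner_abs_l2 L2_space_shift)
qed

text \<open>Distant translates are orthogonal, so each row of the double sum for the squared norm
  has a bounded number of nonzero entries. The squared norm of the sum is O(N), that of the mean
  O(1/N).\<close>

lemma translation_mean_bounded_support:
  fixes f :: "real ^ 'n::finite \<Rightarrow> complex"
  assumes f: "f \<in> L2_space" and R: "\<And>x. real R < norm x \<Longrightarrow> f x = 0"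
  shows "(\<lambda>N. translation_mean i N (abs_l2 f)) \<longlonglongrightarrow> 0"
proof -
  \<comment> \<open>Strictly above \<open>2 * R\<close>, so that shifts differing by at least
    \<open>M\<close> have disjoint supports.\<close>
  define M where "M = 2 * R + 1"
  let ?F = "abs_l2 f" and ?T = "\<lambda>k::nat. translate (real k *\<^sub>R axis i 1) (abs_l2 f)"
  have le: "norm (translation_mean i N ?F) \<le> sqrt (2 * real M * (norm ?F)\<^sup>2 / real N)" for N
  proof (cases "N = 0")
    case False
    have row: "(\<Sum>k<N. inner (?T j) (?T k)) \<le> 2 * real M * (norm ?F)\<^sup>2" for j
    proof -
      \<comment> \<open>Truncated subtraction cuts the window at 0, which only shortens it: it has
        at most \<open>2 * M\<close> elements.\<close>
      have "inner (?T j) (?T k) \<le> (if k \<in> {j - M..<j + M} then (norm ?F)\<^sup>2 else 0)" for k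
      proof (cases "k \<in> {j - M..<j + M}")
        case True
        then show ?thesis
          using norm_cauchy_schwarz[of "?T j" "?T k"] by (simp add: power2_eq_square)
      next
        case False
        then have "real M \<le> \<bar>real j - real k\<bar>" by auto
        moreover have "norm (real j *\<^sub>R axis i 1 - real k *\<^sub>R axis i 1 :: real ^ 'n) = \<bar>real j - real k\<bar>"
          by (simp add: norm_axis_1 flip: scaleR_diff_left)
        ultimately have "inner (?T j) (?T k) = 0"
          by (intro inner_translate_disjoint[OF f R]) (auto simp: M_def)
        then show ?thesis using False by simp
      qed
      then have "(\<Sum>k<N. inner (?T j) (?T k)) \<le> (\<Sum>k<N. if k \<in> {j - M..<j + M} then (norm ?F)\<^sup>2 else 0)"
        by (intro sum_mono)
      also have "\<dots> = real (card ({..<N} \<inter> {j - M..<j + M})) * (norm ?F)\<^sup>2"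
        by (subst sum.inter_restrict[symmetric]) auto
      also have "\<dots> \<le> real (2 * M) * (norm ?F)\<^sup>2"
      proof (intro mult_right_mono of_nat_mono)
        have "card ({..<N} \<inter> {j - M..<j + M}) \<le> card {j - M..<j + M}"
          by (intro card_mono) auto
        then show "card ({..<N} \<inter> {j - M..<j + M}) \<le> 2 * M" by simp
      qed auto
      finally show ?thesis by simp
    qed
    have "(norm (\<Sum>k<N. ?T k))\<^sup>2 = (\<Sum>j<N. \<Sum>k<N. inner (?T j) (?T k))"
      unfolding power2_norm_eq_inner inner_sum_left inner_sum_right by (rule sum.swap)
    also have "\<dots> \<le> (\<Sum>j<N. 2 * real M * (norm ?F)\<^sup>2)"
      by (intro sum_mono row)
    finally have "(norm (\<Sum>k<N. ?T k))\<^sup>2 \<le> real N * (2 * real M * (norm ?F)\<^sup>2)" by simp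
    then have "(norm (translation_mean i N ?F))\<^sup>2 \<le> 2 * real M * (norm ?F)\<^sup>2 / real N"
      using False by (simp add: translation_mean_def power_divide divide_simps power2_eq_square[of "real N"] mult.commute)
    then show ?thesis by (rule real_le_rsqrt)
  qed (simp add: translation_mean_def)
  have "(\<lambda>N. sqrt (2 * real M * (norm ?F)\<^sup>2 / real N)) \<longlonglongrightarrow> sqrt 0"
    by (intro tendsto_real_sqrt real_tendsto_divide_at_top[OF tendsto_const] filterlim_real_sequentially)
  then have "(\<lambda>N. sqrt (2 * real M * (norm ?F)\<^sup>2 / real N)) \<longlonglongrightarrow> 0" by simp
  then show ?thesis
    by (rule Lim_null_comparison[rotated]) (use le in auto)
qed

text \<open>The means are contractions, so convergence extends from the dense set of functions with
  bounded support.\<close>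

lemma translation_mean_tendsto_0: "(\<lambda>N. translation_mean i N F) \<longlonglongrightarrow> 0"
proof (rule LIMSEQ_I)
  fix e :: real assume "0 < e"
  then obtain f R where f: "f \<in> L2_space" "\<And>x. real R < norm x \<Longrightarrow> f x = 0" "norm (F - abs_l2 f) < e / 2"
    using l2_truncation[of "e / 2" F] half_gt_zero by blast
  have "\<forall>\<^sub>F N in sequentially. norm (translation_mean i N (abs_l2 f)) < e / 2"
    using tendsto_norm_zero[OF translation_mean_bounded_support[OF f(1,2), where i = i]] \<open>0 < e\<close>
    by (intro order_tendstoD(2)) auto
  then obtain N0 where N0: "\<And>N. N0 \<le> N \<Longrightarrow> norm (translation_mean i N (abs_l2 f)) < e / 2"
    by (auto simp: eventually_sequentially)
  have "norm (translation_mean i N F - 0) < e" if "N0 \<le> N" for N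
  proof -
    have "translation_mean i N F = translation_mean i N (abs_l2 f) + translation_mean i N (F - abs_l2 f)"
      by (simp flip: translation_mean_add)
    then have "norm (translation_mean i N F)
        \<le> norm (translation_mean i N (abs_l2 f)) + norm (translation_mean i N (F - abs_l2 f))"
      by (simp only: norm_triangle_ineq)
    then show ?thesis
      using N0[OF that] f(3) norm_translation_mean_le[of i N "F - abs_l2 f"] by simp
  qed
  then show "\<exists>N0. \<forall>N\<ge>N0. norm (translation_mean i N F - 0) < e" by blast
qed

text \<open>The mean is carried by the kernel, which remains a test function, so that the
  monotonicity of \<open>En\<close> covers the averaged solution as well.\<close>

definition mean_kernel :: "'n \<Rightarrow> nat \<Rightarrow> (real ^ 'n::finite \<Rightarrow> complex) \<Rightarrow> real ^ 'n \<Rightarrow> complex" where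
  "mean_kernel i N z x = (\<Sum>k<N. (1 / real N) *\<^sub>R z (x - real k *\<^sub>R axis i 1))"

lemma test_functions_mean_kernel: "z \<in> test_functions \<Longrightarrow> mean_kernel i N z \<in> test_functions"
  unfolding mean_kernel_def[abs_def]
  by (intro test_functions_sum test_functions_scaleR[OF test_functions_shift])

lemma Conv_mean_kernel:
  assumes z: "z \<in> test_functions"
  shows "Conv (mean_kernel i N z) F = translation_mean i N (Conv z F)"
proof -
  have k: "z \<in> kernels" using z by (rule test_functions_kernels)
  have "Conv (mean_kernel i N z) F = (\<Sum>k<N. Conv (\<lambda>x. (1 / real N) *\<^sub>R z (x - real k *\<^sub>R axis i 1)) F)"
    unfolding mean_kernel_def[abs_def] by (intro Conv_kernel_sum test_functions_scaleR[OF test_functions_shift] z)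
  also have "\<dots> = (\<Sum>k<N. (1 / real N) *\<^sub>R translate (real k *\<^sub>R axis i 1) (Conv z F))"
    by (simp only: Conv_kernel_scaleR[OF kernels_shift[OF k]] Conv_kernel_shift[OF k])
  finally show ?thesis by (simp add: translation_mean_def scaleR_sum_right)
qed

text \<open>The left side is a mean of differences, each over a shift of length less than
  \<open>N\<close>.\<close>

lemma norm_Conv_minus_mean_kernel_le:
  assumes z: "z \<in> test_functions" and "0 < N"
  shows "norm (Conv z F - Conv (mean_kernel i N z) F) \<le> real N * norm (Conv (partial_deriv i z) F)"
proof -
  let ?A = "Conv z F" and ?b = "norm (Conv (partial_deriv i z) F)"
  have "?A - Conv (mean_kernel i N z) F = (1 / real N) *\<^sub>R (\<Sum>k<N. ?A - translate (real k *\<^sub>R axis i 1) ?A)"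
    using assms by (simp add: Conv_mean_kernel translation_mean_def sum_subtractf scaleR_diff_right sum_constant_scaleR)
  moreover have "norm (\<Sum>k<N. ?A - translate (real k *\<^sub>R axis i 1) ?A) \<le> (\<Sum>k<N. real N * ?b)"
  proof (rule sum_norm_le)
    fix k assume "k \<in> {..<N}"
    then have "\<bar>real k\<bar> * ?b \<le> real N * ?b" by (intro mult_right_mono) auto
    then show "norm (?A - translate (real k *\<^sub>R axis i 1) ?A) \<le> real N * ?b"
      using norm_Conv_minus_translate_le[OF z, of F "real k" i] by (rule order.trans[rotated])
  qed
  ultimately have "norm (?A - Conv (mean_kernel i N z) F) \<le> (1 / real N) * (\<Sum>k<N. real N * ?b)"
    by (simp del: sum_constant add: divide_right_mono)
  then show ?thesis using assms(2) by simp
qed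

context damped_flow
begin

text \<open>The number \<open>N\<close> of translates is fixed at time 0, where it makes the energy
  of the mean small. Only then does t tend to infinity, which removes the remainder in spite of its
  factor \<open>N^2\<close>.\<close>

lemma En_tendsto:
  assumes z: "z \<in> test_functions"
  shows "(En z \<longlongrightarrow> 0) at_top"
proof (rule tendstoI)
  fix e :: real assume e: "0 < e"
  \<comment> \<open>Averaging in a single coordinate direction suffices, whichever it is.\<close>
  fix i :: 'n
  define w where "w N = mean_kernel i N z" for N
  have w: "w N \<in> test_functions" for N unfolding w_def by (rule test_functions_mean_kernel[OF z])
  have "(\<lambda>N. norm (Conv (w N) (component a 0))) \<longlonglongrightarrow> 0" for a
    unfolding w_def Conv_mean_kernel[OF z] by (intro tendsto_norm_zero translation_mean_tendsto_0)
  then have "(\<lambda>N. En (w N) 0) \<longlonglongrightarrow> (\<Sum>a\<in>(UNIV :: 'n option set). 0\<^sup>2)"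
    unfolding En_def by (intro tendsto_sum tendsto_power)
  then have "\<forall>\<^sub>F N in sequentially. En (w N) 0 < e / 4"
    by (rule order_tendstoD(2)) (use e in simp)
  then obtain N0 where N0: "\<And>N. N0 \<le> N \<Longrightarrow> En (w N) 0 < e / 4"
    by (auto simp: eventually_sequentially)
  \<comment> \<open>The successor keeps \<open>N\<close> positive, as the mean over no translates
    would not approximate the solution.\<close>
  define N where "N = Suc N0"
  have N: "0 < N" "En (w N) 0 < e / 4" using N0[of N] by (auto simp: N_def)
  have le: "En z t \<le> 2 * (real N)\<^sup>2 * En (partial_deriv i z) t + 2 * En (w N) 0" if t: "0 \<le> t" for t
  proof -
    have "(norm (Conv z X))\<^sup>2 \<le> 2 * (real N)\<^sup>2 * (norm (Conv (partial_deriv i z) X))\<^sup>2 + 2 * (norm (Conv (w N) X))\<^sup>2" for X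
    proof -
      let ?p = "real N * norm (Conv (partial_deriv i z) X)" and ?q = "norm (Conv (w N) X)"
      have "norm (Conv z X) \<le> norm (Conv z X - Conv (w N) X) + ?q"
        using norm_triangle_ineq[of "Conv z X - Conv (w N) X" "Conv (w N) X"] by simp
      then have "norm (Conv z X) \<le> ?p + ?q"
        using norm_Conv_minus_mean_kernel_le[OF z N(1), of X i] unfolding w_def by linarith
      then have "(norm (Conv z X))\<^sup>2 \<le> (?p + ?q)\<^sup>2" by (intro power_mono) auto
      also have "\<dots> \<le> 2 * ?p\<^sup>2 + 2 * ?q\<^sup>2"
        using sum_squares_bound[of ?p ?q] unfolding power2_sum by linarith
      finally show ?thesis by (simp add: power_mult_distrib mult.assoc)
    qed
    then have "En z t \<le> (\<Sum>a\<in>UNIV. 2 * (real N)\<^sup>2 * (norm (Conv (partial_deriv i z) (component a t)))\<^sup>2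
        + 2 * (norm (Conv (w N) (component a t)))\<^sup>2)"
      unfolding En_def by (intro sum_mono)
    also have "\<dots> = 2 * (real N)\<^sup>2 * En (partial_deriv i z) t + 2 * En (w N) t"
      by (simp add: En_def sum.distrib sum_distrib_left)
    finally show ?thesis using En_antimono[OF w _ t, of N] by linarith
  qed
  have "((\<lambda>t. 2 * (real N)\<^sup>2 * En (partial_deriv i z) t) \<longlongrightarrow> 0) at_top"
    by (intro tendsto_mult_right_zero En_partial_deriv_tendsto z)
  then have "\<forall>\<^sub>F t in at_top. 2 * (real N)\<^sup>2 * En (partial_deriv i z) t < e / 2"
    by (rule order_tendstoD(2)) (use e in simp)
  then show "\<forall>\<^sub>F t in at_top. dist (En z t) 0 < e"
    using eventually_ge_at_top[of 0]
  proof eventually_elim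
    case (elim t)
    then show ?case using le[of t] N(2) En_nonneg[of z t] by (simp add: dist_real_def)
  qed
qed

end

section \<open>Continuity of translations\<close>

text \<open>Mollification uses continuity at the identity only. A predicate on single elements
  allows the property to be extended by sums and by approximation, starting from indicators of open
  sets.\<close>

definition translation_continuous :: "'n::finite l2 \<Rightarrow> bool" where
  "translation_continuous F \<longleftrightarrow> continuous (at 0) (\<lambda>y. translate y F)"

lemma translation_continuous_add:
  "translation_continuous F \<Longrightarrow> translation_continuous G \<Longrightarrow> translation_continuous (F + G)"
  unfolding translation_continuous_def translate_add by (rule continuous_add)

text \<open>An e/3 argument, uniform in the shift because translations are isometries.\<close>

lemma translation_continuous_closed:
  assumes "\<And>e. 0 < e \<Longrightarrow> \<exists>G. translation_continuous G \<and> norm (F - G) < e"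
  shows "translation_continuous F"
  unfolding translation_continuous_def
proof (rule continuous_at_sequentiallyI)
  fix y :: "nat \<Rightarrow> real ^ 'a" assume y: "y \<longlonglongrightarrow> 0"
  show "(\<lambda>n. translate (y n) F) \<longlonglongrightarrow> translate 0 F"
  proof (rule tendstoI)
    fix e :: real assume "0 < e"
    then obtain G where G: "translation_continuous G" "norm (F - G) < e / 3"
      using assms[of "e / 3"] by auto
    have "(\<lambda>n. translate (y n) G) \<longlonglongrightarrow> translate 0 G"
      using G(1) y unfolding translation_continuous_def by (rule isCont_tendsto_compose)
    then have "\<forall>\<^sub>F n in sequentially. dist (translate (y n) G) (translate 0 G) < e / 3"
      using \<open>0 < e\<close> by (intro tendstoD) auto
    then show "\<forall>\<^sub>F n in sequentially. dist (translate (y n) F) (translate 0 F) < e"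
    proof eventually_elim
      case (elim n)
      have "translate (y n) F = translate (y n) G + translate (y n) (F - G)"
        by (simp flip: translate_add)
      then have "translate (y n) F - F = (translate (y n) G - G) + translate (y n) (F - G) - (F - G)"
        by simp
      then have "norm (translate (y n) F - F) \<le> norm (translate (y n) G - G) + norm (F - G) + norm (F - G)"
        using norm_triangle_ineq[of "translate (y n) G - G" "translate (y n) (F - G)"]
          norm_triangle_ineq4[of "(translate (y n) G - G) + translate (y n) (F - G)" "F - G"] by simp
      then show ?case using elim G(2) by (simp add: dist_norm)
    qed
  qed
qed

lemma indicator_L2:
  fixes A :: "(real ^ 'n) set"
  assumes [measurable]: "A \<in> sets borel" and "emeasure lborel A < \<infinity>"
  shows "(\<lambda>x. indicator A x *\<^sub>R c) \<in> L2_space"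
proof (rule L2_spaceI_nn)
  have "(\<integral>\<^sup>+x. ennreal ((cmod (indicator A x *\<^sub>R c))\<^sup>2) \<partial>lborel) = (\<integral>\<^sup>+x. ennreal ((cmod c)\<^sup>2) * indicator A x \<partial>lborel)"
    by (intro nn_integral_cong) (simp add: indicator_def)
  also have "\<dots> < \<infinity>"
    using assms by (simp add: nn_integral_cmult_indicator ennreal_mult_less_top)
  finally show "(\<integral>\<^sup>+x. ennreal ((cmod (indicator A x *\<^sub>R c))\<^sup>2) \<partial>lborel) < \<infinity>" .
qed simp

text \<open>For isometries it is enough that the inner product with the function itself converges.
  Only points of \<open>T\<close> contribute to that integral, and \<open>T\<close> is a
  neighbourhood of each of them, so the boundary of \<open>T\<close> never enters.\<close>

lemma translation_continuous_open:
  fixes T :: "(real ^ 'n::finite) set"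
  assumes T: "open T" and fin: "emeasure lborel T < \<infinity>"
  shows "translation_continuous (abs_l2 (\<lambda>x. indicator T x *\<^sub>R c))"
  unfolding translation_continuous_def
proof (rule continuous_at_sequentiallyI)
  let ?f = "\<lambda>x. indicator T x *\<^sub>R c" and ?F = "abs_l2 (\<lambda>x. indicator T x *\<^sub>R c)"
  have [measurable]: "T \<in> sets borel" using T by simp
  have f: "?f \<in> L2_space" by (rule indicator_L2) (use fin in auto)
  fix y :: "nat \<Rightarrow> real ^ 'n" assume y: "y \<longlonglongrightarrow> 0"
  have "(\<lambda>n. LINT x|lborel. ?f (x - y n) * cnj (?f x)) \<longlonglongrightarrow> (LINT x|lborel. ?f x * cnj (?f x))"
  proof (rule integral_dominated_convergence[where w = "\<lambda>x. (cmod (?f x))\<^sup>2 * 1"])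
    show "integrable lborel (\<lambda>x. (cmod (?f x))\<^sup>2 * 1)" using f by (simp add: L2_space_def)
    show "AE x in lborel. (\<lambda>n. ?f (x - y n) * cnj (?f x)) \<longlonglongrightarrow> ?f x * cnj (?f x)"
    proof (rule AE_I2)
      fix x :: "real ^ 'n"
      show "(\<lambda>n. ?f (x - y n) * cnj (?f x)) \<longlonglongrightarrow> ?f x * cnj (?f x)"
      proof (cases "x \<in> T")
        case True
        have "(\<lambda>n. x - y n) \<longlonglongrightarrow> x - 0" by (intro tendsto_diff tendsto_const y)
        then have "\<forall>\<^sub>F n in sequentially. x - y n \<in> T"
          using topological_tendstoD[OF _ T, of "\<lambda>n. x - y n" "x - 0"] True by simp
        then have "\<forall>\<^sub>F n in sequentially. ?f (x - y n) * cnj (?f x) = ?f x * cnj (?f x)"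
          by eventually_elim (use True in simp)
        then show ?thesis by (rule tendsto_eventually)
      qed simp
    qed
    show "AE x in lborel. norm (?f (x - y n) * cnj (?f x)) \<le> (cmod (?f x))\<^sup>2 * 1" for n
      by (rule AE_I2) (simp add: indicator_def norm_mult power2_eq_square)
  qed simp_all
  then have "(\<lambda>n. inner (translate (y n) ?F) ?F) \<longlonglongrightarrow> inner ?F ?F"
    unfolding translate_abs[OF f] inner_abs_l2[OF L2_space_shift[OF f] f] inner_abs_l2[OF f f]
    by (rule tendsto_Re)
  then have "(\<lambda>n. sqrt (2 * inner ?F ?F - 2 * inner (translate (y n) ?F) ?F)) \<longlonglongrightarrow> sqrt (2 * inner ?F ?F - 2 * inner ?F ?F)"
    by (intro tendsto_real_sqrt tendsto_diff tendsto_mult tendsto_const)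
  moreover have "norm (translate (y n) ?F - translate 0 ?F) = sqrt (2 * inner ?F ?F - 2 * inner (translate (y n) ?F) ?F)" for n
    by (simp add: norm_eq_sqrt_inner inner_diff_left inner_diff_right inner_translate inner_commute[of ?F "translate (y n) ?F"])
  ultimately have "(\<lambda>n. norm (translate (y n) ?F - translate 0 ?F)) \<longlonglongrightarrow> 0"
    by (simp only: diff_self real_sqrt_zero)
  then show "(\<lambda>n. translate (y n) ?F) \<longlonglongrightarrow> translate 0 ?F"
    by (rule LIM_zero_cancel[OF tendsto_norm_zero_cancel])
qed

lemma translation_continuous_finite_measure:
  fixes A :: "(real ^ 'n::finite) set"
  assumes A: "A \<in> sets borel" and fin: "emeasure lborel A < \<infinity>"
  shows "translation_continuous (abs_l2 (\<lambda>x. indicator A x *\<^sub>R c))"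
proof (rule translation_continuous_closed)
  fix e :: real assume e: "0 < e"
  \<comment> \<open>Chosen to make \<open>cmod c * sqrt d\<close> less than \<open>e\<close>; the
    added 1 covers \<open>c = 0\<close>.\<close>
  define d where "d = (e / (cmod c + 1))\<^sup>2"
  have c: "0 < cmod c + 1" by (simp add: add_nonneg_pos)
  have d: "0 < d" using e c by (simp add: d_def)
  have "A \<in> sets lebesgue" using A by simp
  then obtain T where T: "open T" "A \<subseteq> T" "emeasure lebesgue (T - A) < ennreal d"
    by (rule sets_lebesgue_outer_open[OF _ d])
  have TA: "T - A \<in> sets borel" using T(1) A by auto
  then have small: "emeasure lborel (T - A) < ennreal d" using T(3) by simp
  have fin': "emeasure lborel (T - A) < \<infinity>" using small by (rule less_trans) simp
  have Tfin: "emeasure lborel T < \<infinity>"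
  proof -
    have "emeasure lborel T \<le> emeasure lborel A + emeasure lborel (T - A)"
      using emeasure_subadditive[of A lborel "T - A"] A TA T(2) by (simp add: Un_absorb1)
    also have "\<dots> < \<infinity>" using fin fin' by simp
    finally show ?thesis .
  qed
  have L2: "(\<lambda>x. indicator T x *\<^sub>R c) \<in> L2_space" "(\<lambda>x. indicator A x *\<^sub>R c) \<in> L2_space"
    "(\<lambda>x. indicator (T - A) x *\<^sub>R c) \<in> L2_space"
    using indicator_L2[OF _ Tfin] indicator_L2[OF A fin] indicator_L2[OF TA fin'] T(1) by auto
  have "(\<lambda>x. indicator T x *\<^sub>R c - indicator A x *\<^sub>R c) = (\<lambda>x. indicator (T - A) x *\<^sub>R c)"
  proof
    fix x show "indicator T x *\<^sub>R c - indicator A x *\<^sub>R c = indicator (T - A) x *\<^sub>R c"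
      using T(2) by (cases "x \<in> T"; cases "x \<in> A") auto
  qed
  then have "norm (abs_l2 (\<lambda>x. indicator A x *\<^sub>R c) - abs_l2 (\<lambda>x. indicator T x *\<^sub>R c))
      = norm (abs_l2 (\<lambda>x. indicator (T - A) x *\<^sub>R c))"
    by (subst norm_minus_commute) (simp add: abs_l2_diff L2)
  also have "\<dots> \<le> cmod c * sqrt d"
  proof (rule norm_abs_l2_le[OF L2(3)])
    have "(\<integral>\<^sup>+x. ennreal ((cmod (indicator (T - A) x *\<^sub>R c))\<^sup>2) \<partial>lborel) = (\<integral>\<^sup>+x. ennreal ((cmod c)\<^sup>2) * indicator (T - A) x \<partial>lborel)"
      by (intro nn_integral_cong) (simp add: indicator_def)
    also have "\<dots> = ennreal ((cmod c)\<^sup>2) * emeasure lborel (T - A)"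
      using TA by (simp add: nn_integral_cmult_indicator)
    also have "\<dots> \<le> ennreal ((cmod c)\<^sup>2) * ennreal d"
      using small by (intro mult_left_mono) auto
    also have "\<dots> = ennreal ((cmod c * sqrt d)\<^sup>2)"
      using d by (subst ennreal_mult[symmetric]) (simp_all add: power_mult_distrib)
    finally show "(\<integral>\<^sup>+x. ennreal ((cmod (indicator (T - A) x *\<^sub>R c))\<^sup>2) \<partial>lborel) \<le> ennreal ((cmod c * sqrt d)\<^sup>2)" .
  qed (use d in simp)
  also have "\<dots> < e"
  proof -
    have "sqrt d = e / (cmod c + 1)" using e c by (simp add: d_def)
    moreover have "cmod c * e < e * (cmod c + 1)" using e by (simp add: algebra_simps)
    ultimately show ?thesis using c by (simp add: divide_less_eq)
  qed
  finally show "\<exists>G. translation_continuous G \<and> norm (abs_l2 (\<lambda>x. indicator A x *\<^sub>R c) - G) < e"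
    using translation_continuous_open[OF T(1) Tfin] by blast
qed

lemma translation_continuous_simple:
  fixes s :: "real ^ 'n::finite \<Rightarrow> complex"
  assumes s: "simple_function lborel s" "s \<in> L2_space"
  shows "translation_continuous (abs_l2 s)"
proof -
  have [measurable]: "s \<in> borel_measurable borel" using s(2) by (rule L2_space_measurable)
  have meas: "s -` {c} \<in> sets borel" for c
    using measurable_sets_borel[of s borel "{c}"] by simp
  \<comment> \<open>Square integrability forces finite measure on the level set of a nonzero value;
    the value 0 is left out of the decomposition below.\<close>
  have fin: "emeasure lborel (s -` {c}) < \<infinity>" if "c \<noteq> 0" for c
  proof -
    have "ennreal ((cmod c)\<^sup>2) * emeasure lborel (s -` {c}) = (\<integral>\<^sup>+x. ennreal ((cmod c)\<^sup>2) * indicator (s -` {c}) x \<partial>lborel)"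
      using meas by (simp add: nn_integral_cmult_indicator)
    also have "\<dots> \<le> (\<integral>\<^sup>+x. ennreal ((cmod (s x))\<^sup>2) \<partial>lborel)"
      by (intro nn_integral_mono) (auto simp: indicator_def)
    also have "\<dots> < \<infinity>" by (simp add: s(2) flip: ennreal_norm_abs_l2_sq)
    finally show ?thesis using that by (auto simp: ennreal_mult_less_top)
  qed
  have "translation_continuous (abs_l2 (\<lambda>x. \<Sum>c\<in>C. indicator (s -` {c}) x *\<^sub>R c))
      \<and> (\<lambda>x. \<Sum>c\<in>C. indicator (s -` {c}) x *\<^sub>R c) \<in> L2_space" if "finite C" "0 \<notin> C" for C
    using that
  proof (induction C)
    case empty
    show ?case by (simp add: translation_continuous_def translate_abs)
  next
    case (insert c C)
    then have c: "c \<noteq> 0" and IH: "translation_continuous (abs_l2 (\<lambda>x. \<Sum>c\<in>C. indicator (s -` {c}) x *\<^sub>R c))"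
        "(\<lambda>x. \<Sum>c\<in>C. indicator (s -` {c}) x *\<^sub>R c) \<in> L2_space" by auto
    have 1: "(\<lambda>x. indicator (s -` {c}) x *\<^sub>R c) \<in> L2_space" by (rule indicator_L2[OF meas fin[OF c]])
    have 2: "translation_continuous (abs_l2 (\<lambda>x. indicator (s -` {c}) x *\<^sub>R c))"
      by (rule translation_continuous_finite_measure[OF meas fin[OF c]])
    show ?case
      using translation_continuous_add[OF 2 IH(1)] L2_space_add[OF 1 IH(2)]
      by (simp only: abs_l2_add[OF 1 IH(2)] sum.insert[OF insert.hyps])
  qed
  moreover have "finite (range s - {0})" using s(1) by (simp add: simple_function_def)
  ultimately have "translation_continuous (abs_l2 (\<lambda>x. \<Sum>c\<in>range s - {0}. indicator (s -` {c}) x *\<^sub>R c))" by blast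
  moreover have "(\<Sum>c\<in>range s - {0}. indicator (s -` {c}) x *\<^sub>R c) = s x" for x
  proof -
    have "(\<Sum>c\<in>range s - {0}. indicator (s -` {c}) x *\<^sub>R c) = (\<Sum>c\<in>range s - {0}. if c = s x then s x else 0)"
      by (intro sum.cong) (auto simp: indicator_def)
    also have "\<dots> = s x" using \<open>finite (range s - {0})\<close> by (simp add: sum.delta)
    finally show ?thesis .
  qed
  ultimately show ?thesis by simp
qed

lemma translation_continuous: "translation_continuous F"
proof (rule translation_continuous_closed)
  fix e :: real assume e: "0 < e"
  obtain f where f: "f \<in> L2_space" "F = abs_l2 f" by (rule l2_cases)
  have [measurable]: "f \<in> borel_measurable borel" using f(1) by (rule L2_space_measurable)
  have "\<exists>s. (\<forall>i. simple_function lborel (s i)) \<and> (\<forall>x\<in>space lborel. (\<lambda>i. s i x) \<longlonglongrightarrow> f x)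
      \<and> (\<forall>i. \<forall>x\<in>space lborel. dist (s i x) 0 \<le> 2 * dist (f x) 0)"
    by (rule borel_measurable_implies_sequence_metric) simp
  then obtain s where s: "\<And>i. simple_function lborel (s i)" "\<And>x. (\<lambda>i. s i x) \<longlonglongrightarrow> f x"
      "\<And>i x. cmod (s i x) \<le> 2 * cmod (f x)" by auto
  have [measurable]: "s i \<in> borel_measurable borel" for i
    using borel_measurable_simple_function[OF s(1)[of i]] by simp
  have int: "integrable lborel (\<lambda>x. (cmod (f x))\<^sup>2)" using f(1) by (simp add: L2_space_def)
  have sL2: "s i \<in> L2_space" for i
  proof -
    have "integrable lborel (\<lambda>x. (cmod (s i x))\<^sup>2)"
    proof (rule Bochner_Integration.integrable_bound)
      show "integrable lborel (\<lambda>x. 4 * (cmod (f x))\<^sup>2)" using int by simp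
      show "AE x in lborel. norm ((cmod (s i x))\<^sup>2) \<le> norm (4 * (cmod (f x))\<^sup>2)"
      proof (rule AE_I2)
        fix x
        show "norm ((cmod (s i x))\<^sup>2) \<le> norm (4 * (cmod (f x))\<^sup>2)"
          using power_mono[OF s(3)[of i x], of 2] by (simp add: power_mult_distrib)
      qed
    qed simp
    then show ?thesis by (simp add: L2_space_def)
  qed
  have "(\<lambda>i. LINT x|lborel. (cmod (f x - s i x))\<^sup>2) \<longlonglongrightarrow> (LINT x|(lborel :: (real ^ 'a) measure). 0)"
  \<comment> \<open>The approximations satisfy |s| \<le> 2 |f|, so |f - s| \<le> 3 |f|, whence the
    factor 9.\<close>
  proof (rule integral_dominated_convergence[where w = "\<lambda>x. 9 * (cmod (f x))\<^sup>2"])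
    show "integrable lborel (\<lambda>x. 9 * (cmod (f x))\<^sup>2)" using int by simp
    show "AE x in lborel. (\<lambda>i. (cmod (f x - s i x))\<^sup>2) \<longlonglongrightarrow> 0"
    proof (rule AE_I2)
      fix x
      have "(\<lambda>i. (cmod (f x - s i x))\<^sup>2) \<longlonglongrightarrow> (cmod (f x - f x))\<^sup>2"
        by (intro tendsto_intros s(2))
      then show "(\<lambda>i. (cmod (f x - s i x))\<^sup>2) \<longlonglongrightarrow> 0" by simp
    qed
    show "AE x in lborel. norm ((cmod (f x - s i x))\<^sup>2) \<le> 9 * (cmod (f x))\<^sup>2" for i
    proof (rule AE_I2)
      fix x
      have "cmod (f x - s i x) \<le> 3 * cmod (f x)"
        using norm_triangle_ineq4[of "f x" "s i x"] s(3)[of i x] by simp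
      then show "norm ((cmod (f x - s i x))\<^sup>2) \<le> 9 * (cmod (f x))\<^sup>2"
        using power_mono[of "cmod (f x - s i x)" "3 * cmod (f x)" 2] by (simp add: power_mult_distrib)
    qed
  qed auto
  then have "(\<lambda>i. sqrt (LINT x|lborel. (cmod (f x - s i x))\<^sup>2)) \<longlonglongrightarrow> sqrt 0"
    by (intro tendsto_real_sqrt) simp
  moreover have "norm (F - abs_l2 (s i)) = sqrt (LINT x|lborel. (cmod (f x - s i x))\<^sup>2)" for i
    by (simp add: f sL2 abs_l2_diff norm_abs_l2 L2_space_diff L2_norm_def)
  ultimately have "(\<lambda>i. norm (F - abs_l2 (s i))) \<longlonglongrightarrow> 0" by simp
  then obtain i where "norm (F - abs_l2 (s i)) < e"
    using order_tendstoD(2)[OF _ e] eventually_happens'[OF sequentially_bot] by blast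
  then show "\<exists>G. translation_continuous G \<and> norm (F - G) < e"
    using translation_continuous_simple[OF s(1) sL2] by blast
qed

lemma translate_near_0:
  assumes "0 < e"
  shows "\<exists>d>0. \<forall>y. norm y < d \<longrightarrow> norm (translate y F - F) < e"
  using translation_continuous[of F] assms
  unfolding translation_continuous_def continuous_at_eps_delta by (force simp: dist_norm)

section \<open>Mollifiers\<close>

text \<open>The powers of 1/s are included because differentiating exp (-1/s) produces them: the
  span of the family is closed under differentiation.\<close>

definition flat_exp :: "nat \<Rightarrow> real \<Rightarrow> real" where
  "flat_exp k s = (if 0 < s then inverse s ^ k * exp (- inverse s) else 0)"

text \<open>With y = 1/h the difference quotient from the right becomes
  \<open>y ^ Suc k / exp y\<close>, which tends to 0; from the left it is identically 0.\<close>

lemma flat_exp_deriv_0: "(flat_exp k has_real_derivative 0) (at 0)"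
proof -
  have "((\<lambda>y::real. y ^ Suc k / exp y) \<longlongrightarrow> 0) at_top"
    by (rule tendsto_power_div_exp_0)
  then have "((\<lambda>h::real. inverse h ^ Suc k / exp (inverse h)) \<longlongrightarrow> 0) (at_right 0)"
    by (rule filterlim_compose[OF _ filterlim_inverse_at_top_right])
  moreover have "\<forall>\<^sub>F h in at_right 0. inverse h ^ Suc k / exp (inverse h) = (flat_exp k h - flat_exp k 0) / (h - 0)"
    unfolding eventually_at_right_field
    by (intro exI[of _ 1]) (auto simp: flat_exp_def exp_minus field_simps)
  ultimately have r: "((\<lambda>h. (flat_exp k h - flat_exp k 0) / (h - 0)) \<longlongrightarrow> 0) (at_right 0)"
    by (rule Lim_transform_eventually)
  have "\<forall>\<^sub>F h in at_left 0. 0 = (flat_exp k h - flat_exp k 0) / (h - 0)"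
    unfolding eventually_at_left_field
    by (intro exI[of _ "-1"]) (auto simp: flat_exp_def)
  then have l: "((\<lambda>h. (flat_exp k h - flat_exp k 0) / (h - 0)) \<longlongrightarrow> 0) (at_left 0)"
    by (rule Lim_transform_eventually[OF tendsto_const])
  show ?thesis
    unfolding has_field_derivative_iff using filterlim_split_at[OF l r] by simp
qed

lemma flat_exp_deriv:
  "(flat_exp k has_real_derivative flat_exp (k + 2) s - real k * flat_exp (k + 1) s) (at s)"
proof (cases s "0::real" rule: linorder_cases)
  case less
  have "(flat_exp k has_real_derivative 0) (at s)"
    by (rule has_field_derivative_transform_within_open[where f = "\<lambda>_. 0" and S = "{..<0}"])
      (use less in \<open>auto simp: flat_exp_def\<close>)
  then show ?thesis using less by (simp add: flat_exp_def)
next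
  case equal
  then show ?thesis using flat_exp_deriv_0 by (simp add: flat_exp_def[of _ 0])
next
  case greater
  have "((\<lambda>s. inverse s ^ k * exp (- inverse s)) has_real_derivative
      inverse s ^ (k + 2) * exp (- inverse s) - real k * (inverse s ^ (k + 1) * exp (- inverse s))) (at s)"
  proof -
    have "((\<lambda>s. inverse s ^ k) has_real_derivative - real k * inverse s ^ (k + 1)) (at s)"
      by (rule DERIV_cong[OF DERIV_power[OF DERIV_inverse]])
        (use greater in \<open>cases k; simp add: power2_eq_square algebra_simps\<close>)+
    moreover have "((\<lambda>s. exp (- inverse s)) has_real_derivative inverse s ^ 2 * exp (- inverse s)) (at s)"
      using greater by (auto intro!: derivative_eq_intros simp: power2_eq_square)
    ultimately show ?thesis
      by (rule DERIV_mult'[THEN DERIV_cong]) (simp add: algebra_simps power_add power2_eq_square)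
  qed
  then have "(flat_exp k has_real_derivative
      inverse s ^ (k + 2) * exp (- inverse s) - real k * (inverse s ^ (k + 1) * exp (- inverse s))) (at s)"
    by (rule has_field_derivative_transform_within_open[where S = "{0<..}"])
      (use greater in \<open>auto simp: flat_exp_def\<close>)
  then show ?thesis using greater by (simp add: flat_exp_def)
qed

text \<open>The algebra generated by \<open>flat_exp\<close> along the coordinates is closed under partial
  derivatives, hence consists of smooth functions.\<close>

inductive_set flat_algebra :: "(real ^ 'n::finite \<Rightarrow> complex) set" where
  const: "(\<lambda>x. c) \<in> flat_algebra"
| gen: "(\<lambda>x. of_real (flat_exp k (a * x $ i + b))) \<in> flat_algebra"
| add: "f \<in> flat_algebra \<Longrightarrow> g \<in> flat_algebra \<Longrightarrow> (\<lambda>x. f x + g x) \<in> flat_algebra"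
| mult: "f \<in> flat_algebra \<Longrightarrow> g \<in> flat_algebra \<Longrightarrow> (\<lambda>x. f x * g x) \<in> flat_algebra"

lemma flat_algebra_deriv:
  assumes "f \<in> flat_algebra"
  shows "\<exists>f'. (\<forall>x. (f has_derivative f' x) (at x)) \<and> (\<forall>j. (\<lambda>x. f' x (axis j 1)) \<in> flat_algebra)"
  using assms
proof induction
  case (const c)
  show ?case by (intro exI[of _ "\<lambda>x h. 0"]) (auto intro: flat_algebra.const)
next
  case (gen k a i b)
  let ?d = "\<lambda>x::real^'a. flat_exp (k + 2) (a * x $ i + b) - real k * flat_exp (k + 1) (a * x $ i + b)"
  have der: "((\<lambda>x. complex_of_real (flat_exp k (a * x $ i + b))) has_derivative (\<lambda>h. of_real (a * h $ i * ?d x))) (at x)" for x :: "real ^ 'a"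
  proof -
    have "((\<lambda>x. a * x $ i + b) has_derivative (\<lambda>h. a * h $ i)) (at x)"
      by (auto intro!: derivative_eq_intros bounded_linear.has_derivative[OF bounded_linear_vec_nth])
    moreover have "(flat_exp k has_derivative (\<lambda>h. h * ?d x)) (at (a * x $ i + b))"
      using flat_exp_deriv[of k "a * x $ i + b"] unfolding has_field_derivative_def mult_commute_abs .
    ultimately have "((\<lambda>x. flat_exp k (a * x $ i + b)) has_derivative (\<lambda>h. a * h $ i * ?d x)) (at x)"
      by (rule has_derivative_compose)
    then show ?thesis by (rule has_derivative_of_real)
  qed
  have "(\<lambda>x. complex_of_real (a * axis j 1 $ i * ?d x)) \<in> flat_algebra" for j
  proof -
    let ?c = "a * axis j 1 $ i"
    have "(\<lambda>x. complex_of_real ?c * complex_of_real (flat_exp (k + 2) (a * x $ i + b))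
        + complex_of_real (- ?c * real k) * complex_of_real (flat_exp (k + 1) (a * x $ i + b))) \<in> flat_algebra"
      by (intro flat_algebra.intros)
    then show ?thesis by (simp add: algebra_simps)
  qed
  then show ?case using der by (intro exI[of _ "\<lambda>x h. of_real (a * h $ i * ?d x)"]) blast
next
  case (add f g)
  then obtain f' g' where
    "\<And>x. (f has_derivative f' x) (at x)" "\<And>j. (\<lambda>x. f' x (axis j 1)) \<in> flat_algebra"
    "\<And>x. (g has_derivative g' x) (at x)" "\<And>j. (\<lambda>x. g' x (axis j 1)) \<in> flat_algebra" by blast
  then show ?case
    by (intro exI[of _ "\<lambda>x h. f' x h + g' x h"]) (auto intro: has_derivative_add flat_algebra.add)
next
  case (mult f g)
  then obtain f' g' where
    "\<And>x. (f has_derivative f' x) (at x)" "\<And>j. (\<lambda>x. f' x (axis j 1)) \<in> flat_algebra"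
    "\<And>x. (g has_derivative g' x) (at x)" "\<And>j. (\<lambda>x. g' x (axis j 1)) \<in> flat_algebra" by blast
  then show ?case
    using mult.hyps
    by (intro exI[of _ "\<lambda>x h. f x * g' x h + f' x h * g x"])
      (auto intro!: has_derivative_mult flat_algebra.add flat_algebra.mult)
qed

lemma flat_algebra_smooth:
  assumes "f \<in> flat_algebra" shows "smooth f"
proof (rule smooth_coinduct[of f flat_algebra])
  fix f :: "real ^ 'a \<Rightarrow> complex" assume "f \<in> flat_algebra"
  then obtain f' where f': "\<And>x. (f has_derivative f' x) (at x)" "\<And>j. (\<lambda>x. f' x (axis j 1)) \<in> flat_algebra"
    using flat_algebra_deriv by blast
  show "f differentiable at x" for x using f'(1) by (rule differentiableI)
  show "partial_deriv i f \<in> flat_algebra" for i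
  proof -
    have "partial_deriv i f = (\<lambda>x. f' x (axis i 1))" using partial_derivI[OF f'(1)] by blast
    then show ?thesis using f'(2) by simp
  qed
qed (rule assms)

lemma flat_algebra_prod: "finite A \<Longrightarrow> (\<And>k. k \<in> A \<Longrightarrow> f k \<in> flat_algebra) \<Longrightarrow> (\<lambda>x. \<Prod>k\<in>A. f k x) \<in> flat_algebra"
  by (induction A rule: finite_induct) (auto intro: flat_algebra.intros)

lemma bump_exists:
  assumes "0 < d"
  shows "\<exists>b. (\<lambda>x::real^'n::finite. complex_of_real (b x)) \<in> test_functions \<and> (\<forall>x. 0 \<le> b x)
    \<and> (\<forall>x. d \<le> norm x \<longrightarrow> b x = 0) \<and> 0 < b 0"
proof -
  \<comment> \<open>If all coordinates are below \<open>r\<close> in absolute value, the sum of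
    these values, and hence the Euclidean norm, is below \<open>d\<close>.\<close>
  define r where "r = d / real CARD('n)"
  have r: "0 < r" using assms by (simp add: r_def)
  \<comment> \<open>In each coordinate the first factor vanishes below -r and the second above
    r.\<close>
  define b where "b x = (\<Prod>i\<in>UNIV. flat_exp 0 (1 * x $ i + r) * flat_exp 0 (-1 * x $ i + r))" for x :: "real ^ 'n"
  have nonneg: "0 \<le> b x" for x unfolding b_def by (intro prod_nonneg) (simp add: flat_exp_def)
  have zero: "b x = 0" if "d \<le> norm x" for x
  proof -
    have "\<exists>i. r \<le> \<bar>x $ i\<bar>"
    proof (rule ccontr)
      assume "\<not> ?thesis"
      then have "(\<Sum>i\<in>UNIV. \<bar>x $ i\<bar>) < (\<Sum>i\<in>(UNIV :: 'n set). r)"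
        by (intro sum_strict_mono) (auto simp: not_le)
      then show False using that norm_le_l1_cart[of x] by (simp add: r_def)
    qed
    then obtain i where "r \<le> \<bar>x $ i\<bar>" by blast
    then have "flat_exp 0 (1 * x $ i + r) * flat_exp 0 (-1 * x $ i + r) = 0" by (auto simp: flat_exp_def)
    then show ?thesis unfolding b_def by (intro prod_zero) auto
  qed
  have "(\<lambda>x. \<Prod>i\<in>UNIV. complex_of_real (flat_exp 0 (1 * x $ i + r)) * complex_of_real (flat_exp 0 (-1 * x $ i + r))) \<in> flat_algebra"
    by (intro flat_algebra_prod flat_algebra.mult flat_algebra.gen) auto
  then have "smooth (\<lambda>x. complex_of_real (b x))"
    unfolding b_def of_real_prod of_real_mult by (rule flat_algebra_smooth)
  moreover have "bounded {x. complex_of_real (b x) \<noteq> 0}"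
    by (rule boundedI[of _ d]) (use zero in force)
  moreover have "0 < b 0" unfolding b_def using r by (intro prod_pos) (simp add: flat_exp_def)
  ultimately show ?thesis using nonneg zero by (intro exI[of _ b]) (auto simp: test_functions_iff)
qed

lemma mollifier_exists:
  assumes "0 < d"
  shows "\<exists>z::real^'n::finite \<Rightarrow> complex. z \<in> test_functions \<and> (LINT x|lborel. z x) = 1
    \<and> (LINT x|lborel. cmod (z x)) = 1 \<and> (\<forall>x. d \<le> norm x \<longrightarrow> z x = 0)"
proof -
  obtain b :: "real ^ 'n \<Rightarrow> real" where b: "(\<lambda>x. complex_of_real (b x)) \<in> test_functions" "\<And>x. 0 \<le> b x"
    "\<And>x. d \<le> norm x \<Longrightarrow> b x = 0" "0 < b 0" using bump_exists[OF assms, where 'n = 'n] by blast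
  define I where "I = (LINT x|lborel. b x)"
  have "integrable lborel (\<lambda>x. complex_of_real (b x))"
    using test_functions_kernels[OF b(1)] by (simp add: kernels_def)
  then have int: "integrable lborel b" by (simp add: complex_of_real_integrable_eq)
  have cont: "continuous_on UNIV b"
    using continuous_on_Re[OF test_functions_continuous[OF b(1)]] by simp
  \<comment> \<open>Were the integral 0, the open set where \<open>b\<close> is nonzero would be a
    null set, although it contains 0.\<close>
  have I: "0 < I"
  proof -
    have "I \<noteq> 0"
    proof
      assume "I = 0"
      then have "AE x in lborel. b x = 0"
        using integral_nonneg_eq_0_iff_AE[OF int] b(2) by (simp add: I_def)
      moreover have op: "open {x. b x \<noteq> 0}"
        using open_Collect_neq[OF cont continuous_on_const] .
      ultimately have "{x. b x \<noteq> 0} \<in> null_sets lborel"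
        by (subst AE_iff_null_sets) auto
      then have "negligible {x. b x \<noteq> 0}"
        unfolding negligible_iff_null_sets by (rule null_sets_completionI)
      moreover have "0 \<in> {x. b x \<noteq> 0}" using b(4) by simp
      ultimately show False using open_not_negligible[OF op] by blast
    qed
    moreover have "0 \<le> I" using b(2) by (simp add: I_def)
    ultimately show ?thesis by simp
  qed
  let ?z = "\<lambda>x. (1 / I) *\<^sub>R complex_of_real (b x)"
  have z: "?z \<in> test_functions" by (rule test_functions_scaleR[OF b(1)])
  have "(LINT x|lborel. ?z x) = 1" using I by (simp add: I_def scaleR_conv_of_real)
  moreover have "(LINT x|lborel. cmod (?z x)) = 1" using I b(2) by (simp add: I_def)
  ultimately show ?thesis using z b(3) by (intro exI[of _ ?z]) auto
qed

text \<open>As \<open>z\<close> has integral 1, \<open>Conv z F - F\<close> is the superposition of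
  the differences \<open>translate y F - F\<close> with weights \<open>z y\<close>, and Minkowski's
  inequality applies.\<close>

lemma norm_Conv_mollifier_le:
  assumes z: "z \<in> test_functions" "(LINT x|lborel. z x) = 1" "(LINT x|lborel. cmod (z x)) = 1"
    and e: "0 \<le> e" "\<And>y. z y \<noteq> 0 \<Longrightarrow> norm (translate y F - F) \<le> e"
  shows "norm (Conv z F - F) \<le> e"
proof -
  obtain f where f: "f \<in> L2_space" "F = abs_l2 f" by (rule l2_cases)
  note k = test_functions_kernels[OF z(1)]
  have [measurable]: "f \<in> borel_measurable borel" "z \<in> borel_measurable borel"
    using f(1) by (auto intro: L2_space_measurable test_functions_measurable z)
  have zint: "integrable lborel z" using k by (simp add: kernels_def)
  have eq: "(LINT y|lborel. z y * (\<lambda>(x, y). f (x - y) - f x) (x, y)) = conv f z x - f x" for x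
  proof -
    have "integrable lborel (\<lambda>y. z y * f (x - y))"
      using k f(1) by (intro integrable_prod_L2 L2_space_reflect) (auto simp: kernels_def)
    then have "(LINT y|lborel. z y * (f (x - y) - f x)) = (LINT y|lborel. z y * f (x - y)) - (LINT y|lborel. z y * f x)"
      using zint by (simp add: right_diff_distrib)
    also have "(LINT y|lborel. z y * f x) = f x" using z(2) by simp
    finally show ?thesis by (simp add: conv_commute)
  qed
  have "(\<integral>\<^sup>+x. ennreal ((cmod (LINT y|lborel. z y * (\<lambda>(x, y). f (x - y) - f x) (x, y)))\<^sup>2) \<partial>lborel) \<le> ennreal ((1 * e)\<^sup>2)"
  proof (rule minkowski_integral_inequality)
    show "(\<integral>\<^sup>+y. ennreal (cmod (z y)) \<partial>lborel) \<le> ennreal 1"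
      using zint z(3) by (subst nn_integral_eq_integral) auto
    fix y assume "z y \<noteq> 0"
    have L: "(\<lambda>x. f (x - y) - f x) \<in> L2_space" by (intro L2_space_diff L2_space_shift f)
    have "norm (abs_l2 (\<lambda>x. f (x - y) - f x)) \<le> e"
      using e(2)[OF \<open>z y \<noteq> 0\<close>] by (simp add: f translate_abs abs_l2_diff L2_space_shift)
    then show "(\<integral>\<^sup>+x. ennreal ((cmod ((\<lambda>(x, y). f (x - y) - f x) (x, y)))\<^sup>2) \<partial>lborel) \<le> ennreal (e\<^sup>2)"
      using e(1) ennreal_norm_abs_l2_sq[OF L, symmetric] by (simp add: ennreal_leI power_mono)
  qed (auto intro: sigma_finite_lborel)
  then show ?thesis
    unfolding eq using f k e(1)
    by (simp add: Conv_abs abs_l2_diff conv_L2 norm_abs_l2_le L2_space_diff)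
qed

definition mollifier :: "nat \<Rightarrow> real ^ 'n::finite \<Rightarrow> complex" where
  "mollifier m = (SOME z. z \<in> test_functions \<and> (LINT x|lborel. z x) = 1
    \<and> (LINT x|lborel. cmod (z x)) = 1 \<and> (\<forall>x. inverse (real (Suc m)) \<le> norm x \<longrightarrow> z x = 0))"

lemma mollifier:
  "mollifier m \<in> test_functions" "(LINT x|lborel. mollifier m x) = 1" "(LINT x|lborel. cmod (mollifier m x)) = 1"
  "inverse (real (Suc m)) \<le> norm x \<Longrightarrow> mollifier m x = 0"
proof -
  have "0 < inverse (real (Suc m))" by simp
  from someI_ex[OF mollifier_exists[OF this]]
  show "mollifier m \<in> test_functions" "(LINT x|lborel. mollifier m x) = 1" "(LINT x|lborel. cmod (mollifier m x)) = 1"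
    "inverse (real (Suc m)) \<le> norm x \<Longrightarrow> mollifier m x = 0"
    unfolding mollifier_def by blast+
qed

lemma Conv_mollifier_tendsto:
  fixes F :: "'n::finite l2"
  shows "(\<lambda>m. Conv (mollifier m) F) \<longlonglongrightarrow> F"
proof (rule LIMSEQ_I)
  fix e :: real assume e: "0 < e"
  obtain d where d: "0 < d" "\<And>y. norm y < d \<Longrightarrow> norm (translate y F - F) < e / 2"
    using translate_near_0[of "e / 2" F] e by auto
  obtain M where M: "inverse (real (Suc M)) < d" using reals_Archimedean[OF d(1)] by blast
  have "norm (Conv (mollifier m) F - F) < e" if "M \<le> m" for m
  proof -
    have "inverse (real (Suc m)) \<le> inverse (real (Suc M))" using that by (intro le_imp_inverse_le) auto
    then have small: "inverse (real (Suc m)) < d" using M by (rule le_less_trans)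
    have "norm (Conv (mollifier m) F - F) \<le> e / 2"
    proof (rule norm_Conv_mollifier_le[OF mollifier(1-3)])
      fix y :: "real ^ 'n" assume "mollifier m y \<noteq> 0"
      then have "norm y < inverse (real (Suc m))" using mollifier(4)[of m y] by (meson not_le)
      then show "norm (translate y F - F) \<le> e / 2" using d(2)[of y] small by simp
    qed (use e in simp)
    then show ?thesis using e by simp
  qed
  then show "\<exists>M. \<forall>m\<ge>M. norm (Conv (mollifier m) F - F) < e" by blast
qed

section \<open>Regularized mild solutions\<close>

lemma norm_abs_l2_reflect:
  assumes "g \<in> L2_space"
  shows "norm (abs_l2 (\<lambda>y. g (x - y))) = norm (abs_l2 g)"
proof -
  have [measurable]: "g \<in> borel_measurable borel" using assms by (rule L2_space_measurable)
  show ?thesis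
    using integral_lborel_reflect[of "\<lambda>y. (cmod (g y))\<^sup>2" x] assms
    by (simp add: norm_abs_l2 L2_space_reflect L2_norm_def)
qed

text \<open>The function and the point are changed one after the other; since reflection is an
  isometry, moving the point amounts to translating the kernel.\<close>

lemma conv_diff_le:
  assumes f: "f \<in> L2_space" and g: "g \<in> L2_space" and z: "z \<in> kernels"
  shows "cmod (conv f z x - conv g z x') \<le> norm (abs_l2 f - abs_l2 g) * norm (abs_l2 z)
    + norm (abs_l2 g) * norm (abs_l2 z - translate (x - x') (abs_l2 z))"
proof -
  have z2: "z \<in> L2_space" using z by (simp add: kernels_def)
  let ?w = "\<lambda>y. z y - z (y - (x - x'))"
  have w: "?w \<in> L2_space" by (intro L2_space_diff L2_space_shift z2)
  have "conv f z x - conv g z x' = (LINT y|lborel. (f y - g y) * z (x - y)) + (LINT y|lborel. g y * ?w (x - y))"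
    using integrable_conv[OF f z, of x] integrable_conv[OF g z, of x] integrable_conv[OF g z, of x']
    by (simp add: conv_def left_diff_distrib right_diff_distrib)
  moreover have "cmod (LINT y|lborel. (f y - g y) * z (x - y)) \<le> norm (abs_l2 f - abs_l2 g) * norm (abs_l2 z)"
    using cmod_integral_prod_le[OF L2_space_diff[OF f g] L2_space_reflect[OF z2, of x]]
    by (simp add: norm_abs_l2_reflect z2 abs_l2_diff f g)
  moreover have "cmod (LINT y|lborel. g y * ?w (x - y)) \<le> norm (abs_l2 g) * norm (abs_l2 z - translate (x - x') (abs_l2 z))"
    using cmod_integral_prod_le[OF g L2_space_reflect[OF w, of x]] norm_abs_l2_reflect[OF w, of x]
    by (simp add: translate_abs abs_l2_diff z2 L2_space_shift)
  ultimately show ?thesis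
    by (simp only: norm_triangle_mono)
qed

text \<open>Joint continuity in space and time gives the measurability on the product that
  Minkowski's inequality asks for.\<close>

lemma continuous_on_conv:
  fixes p :: "real \<Rightarrow> real ^ 'n::finite \<Rightarrow> complex"
  assumes p: "\<And>t. t \<in> T \<Longrightarrow> p t \<in> L2_space" and cont: "continuous_on T (\<lambda>t. abs_l2 (p t))"
    and z: "z \<in> kernels"
  shows "continuous_on (UNIV \<times> T) (\<lambda>q. conv (p (snd q)) z (fst q))"
  unfolding continuous_on_def
proof
  fix q0 :: "(real ^ 'n) \<times> real" assume q0: "q0 \<in> UNIV \<times> T"
  let ?F = "at q0 within UNIV \<times> T" and ?P = "\<lambda>q. abs_l2 (p (snd q))" and ?Z = "abs_l2 z"
  have "continuous_on (UNIV \<times> T) ?P"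
    by (rule continuous_on_compose2[OF cont continuous_on_snd[OF continuous_on_id]]) auto
  then have P: "(?P \<longlongrightarrow> ?P q0) ?F" unfolding continuous_on_def by (rule bspec[OF _ q0])
  have "isCont (\<lambda>y. translate y ?Z) 0"
    using translation_continuous[of ?Z] by (simp add: translation_continuous_def)
  moreover have "((\<lambda>q. fst q - fst q0) \<longlongrightarrow> 0) ?F"
    using tendsto_diff[OF tendsto_fst[OF tendsto_ident_at] tendsto_const[of "fst q0"], of q0 "UNIV \<times> T"] by simp
  ultimately have Z: "((\<lambda>q. translate (fst q - fst q0) ?Z) \<longlongrightarrow> translate 0 ?Z) ?F"
    by (rule isCont_tendsto_compose)
  have "((\<lambda>q. norm (?P q - ?P q0) * norm ?Z + norm (?P q0) * norm (?Z - translate (fst q - fst q0) ?Z))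
      \<longlongrightarrow> norm (?P q0 - ?P q0) * norm ?Z + norm (?P q0) * norm (?Z - translate 0 ?Z)) ?F"
    by (intro tendsto_add tendsto_mult tendsto_norm tendsto_diff tendsto_const P Z)
  then have lim: "((\<lambda>q. norm (?P q - ?P q0) * norm ?Z + norm (?P q0) * norm (?Z - translate (fst q - fst q0) ?Z)) \<longlongrightarrow> 0) ?F"
    by simp
  have "\<forall>\<^sub>F q in ?F. norm (conv (p (snd q)) z (fst q) - conv (p (snd q0)) z (fst q0))
      \<le> norm (?P q - ?P q0) * norm ?Z + norm (?P q0) * norm (?Z - translate (fst q - fst q0) ?Z)"
    unfolding eventually_at_filter
    by (rule always_eventually) (use q0 in \<open>auto intro!: conv_diff_le p z\<close>)
  from Lim_null_comparison[OF this lim]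
  show "((\<lambda>q. conv (p (snd q)) z (fst q)) \<longlongrightarrow> conv (p (snd q0)) z (fst q0)) ?F"
    by (rule LIM_zero_cancel)
qed

section \<open>Mild solutions as differentiable curves in L2\<close>

lemma continuous_into_L2_imp:
  assumes "continuous_into_L2 p"
  shows "0 \<le> t \<Longrightarrow> p t \<in> L2_space" and "continuous_on {0..} (\<lambda>t. abs_l2 (p t))"
proof -
  show L2: "p t \<in> L2_space" if "0 \<le> t" for t using assms that by (simp add: continuous_into_L2_def)
  show "continuous_on {0..} (\<lambda>t. abs_l2 (p t))"
    unfolding continuous_on_def
  proof
    fix t :: real assume t: "t \<in> {0..}"
    then have "((\<lambda>s. L2_norm (\<lambda>x. p s x - p t x)) \<longlongrightarrow> 0) (at t within {0..})"
      using assms by (simp add: continuous_into_L2_def)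
    moreover have "\<forall>\<^sub>F s in at t within {0..}. L2_norm (\<lambda>x. p s x - p t x) = norm (abs_l2 (p s) - abs_l2 (p t))"
      unfolding eventually_at_filter
      by (rule always_eventually) (use t in \<open>auto simp: abs_l2_diff norm_abs_l2 L2 L2_space_diff\<close>)
    ultimately have "((\<lambda>s. norm (abs_l2 (p s) - abs_l2 (p t))) \<longlongrightarrow> 0) (at t within {0..})"
      by (rule Lim_transform_eventually)
    then show "((\<lambda>s. abs_l2 (p s)) \<longlongrightarrow> abs_l2 (p t)) (at t within {0..})"
      by (rule LIM_zero_cancel[OF tendsto_norm_zero_cancel])
  qed
qed

lemma has_L2_time_deriv_imp:
  assumes p: "\<And>t. 0 \<le> t \<Longrightarrow> p t \<in> L2_space" and d: "has_L2_time_deriv p v t" and t: "0 \<le> t"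
  shows "((\<lambda>t. abs_l2 (p t)) has_vector_derivative abs_l2 v) (at t within {0..})"
  unfolding has_vector_derivative_def has_derivative_iff_norm
proof
  have v: "v \<in> L2_space" using d by (simp add: has_L2_time_deriv_def)
  have "((\<lambda>s. L2_norm (\<lambda>x. (p s x - p t x) / of_real (s - t) - v x)) \<longlongrightarrow> 0) (at t within {0..})"
    using d by (simp add: has_L2_time_deriv_def)
  moreover have "\<forall>\<^sub>F s in at t within {0..}. L2_norm (\<lambda>x. (p s x - p t x) / of_real (s - t) - v x)
     = norm (abs_l2 (p s) - abs_l2 (p t) - (s - t) *\<^sub>R abs_l2 v) / norm (s - t)"
    unfolding eventually_at_filter
  proof (rule always_eventually, intro allI impI)
    fix s :: real assume s: "s \<noteq> t" "s \<in> {0..}"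
    have ps: "p s \<in> L2_space" "p t \<in> L2_space" using p s t by auto
    have "L2_norm (\<lambda>x. (p s x - p t x) / of_real (s - t) - v x)
        = norm (abs_l2 (\<lambda>x. (1 / (s - t)) *\<^sub>R (p s x - p t x) - v x))"
    proof (subst norm_abs_l2)
      show "(\<lambda>x. (1 / (s - t)) *\<^sub>R (p s x - p t x) - v x) \<in> L2_space"
        by (intro L2_space_diff L2_space_scaleR ps v)
    qed (simp add: scaleR_conv_of_real divide_inverse mult.commute)
    also have "abs_l2 (\<lambda>x. (1 / (s - t)) *\<^sub>R (p s x - p t x) - v x)
        = (1 / (s - t)) *\<^sub>R (abs_l2 (p s) - abs_l2 (p t)) - abs_l2 v"
      by (simp add: abs_l2_diff abs_l2_scaleR L2_space_diff L2_space_scaleR ps v)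
    also have "\<dots> = (1 / (s - t)) *\<^sub>R (abs_l2 (p s) - abs_l2 (p t) - (s - t) *\<^sub>R abs_l2 v)"
      using s(1) by (simp add: scaleR_diff_right)
    finally show "L2_norm (\<lambda>x. (p s x - p t x) / of_real (s - t) - v x)
     = norm (abs_l2 (p s) - abs_l2 (p t) - (s - t) *\<^sub>R abs_l2 v) / norm (s - t)" by simp
  qed
  ultimately show "((\<lambda>s. norm (abs_l2 (p s) - abs_l2 (p t) - (s - t) *\<^sub>R abs_l2 v) / norm (s - t)) \<longlongrightarrow> 0) (at t within {0..})"
    by (rule Lim_transform_eventually)
qed (rule bounded_linear_scaleR_left)

text \<open>The defining identity is tested with \<open>z (x - y)\<close> in y; the sign from the
  reflection cancels the sign of the weak derivative.\<close>

lemma has_weak_partial_conv: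
  assumes "has_weak_partial f i g" and z: "z \<in> test_functions"
  shows "conv g z = conv f (partial_deriv i z)"
proof
  fix x
  have "(LINT y|lborel. f y * partial_deriv i (\<lambda>y. z (x - y)) y) = - (LINT y|lborel. g y * z (x - y))"
    using assms(1) test_functions_reflect[OF z, of x] by (simp add: has_weak_partial_def)
  then show "conv g z x = conv f (partial_deriv i z) x"
    by (simp add: conv_def partial_deriv_reflect[OF test_functions_smooth[OF z]])
qed

lemma weak_partial:
  assumes "f \<in> H1_space"
  shows "weak_partial i f \<in> L2_space" and "has_weak_partial f i (weak_partial i f)"
proof -
  have "\<exists>g. g \<in> L2_space \<and> has_weak_partial f i g" using assms by (auto simp: H1_space_def)
  from someI_ex[OF this] show "weak_partial i f \<in> L2_space" "has_weak_partial f i (weak_partial i f)"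
    unfolding weak_partial_def by auto
qed

text \<open>The norm inequality for the integral of a curve, without an \<open>l2\<close>-valued
  integral: integration is pointwise in x, and Minkowski's inequality with the indicator of the
  interval as weight supplies the bound.\<close>

lemma L2_integral_mean_le:
  fixes h :: "real \<Rightarrow> real ^ 'n::finite \<Rightarrow> complex"
  assumes "a \<le> b" and cont: "continuous_on (UNIV \<times> {a..b}) (\<lambda>q. h (snd q) (fst q))"
    and L2: "\<And>r. r \<in> {a..b} \<Longrightarrow> h r \<in> L2_space"
    and B: "0 \<le> B" "\<And>r. r \<in> {a..b} \<Longrightarrow> norm (abs_l2 (h r)) \<le> B"
    and g: "g \<in> L2_space" "\<And>x. g x = integral {a..b} (\<lambda>r. h r x)"
  shows "norm (abs_l2 g) \<le> (b - a) * B"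
proof (rule norm_abs_l2_le[OF g(1)])
  \<comment> \<open>Extension by 0 outside the time interval makes the integrand Borel measurable on
    the whole product.\<close>
  let ?F = "\<lambda>q. indicator (UNIV \<times> {a..b}) q *\<^sub>R h (snd q) (fst q)"
  let ?w = "\<lambda>r::real. complex_of_real (indicator {a..b} r)"
  have eq: "(LINT r|lborel. ?w r * ?F (x, r)) = g x" for x
  proof -
    have "continuous_on {a..b} ((\<lambda>q. h (snd q) (fst q)) \<circ> (\<lambda>r. (x, r)))"
      by (rule continuous_on_compose) (auto intro!: continuous_intros continuous_on_subset[OF cont])
    then have "continuous_on {a..b} (\<lambda>r. h r x)" by (simp add: o_def)
    then have "set_integrable lborel {a..b} (\<lambda>r. h r x)" by (rule borel_integrable_atLeastAtMost')
    then have "(LINT r:{a..b}|lborel. h r x) = g x"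
      unfolding g(2) by (rule set_borel_integral_eq_integral(2))
    moreover have "(LINT r|lborel. ?w r * ?F (x, r)) = (LINT r:{a..b}|lborel. h r x)"
      unfolding set_lebesgue_integral_def by (rule Bochner_Integration.integral_cong) (auto simp: indicator_def)
    ultimately show ?thesis by simp
  qed
  have "(\<integral>\<^sup>+x. ennreal ((cmod (LINT r|lborel. ?w r * ?F (x, r)))\<^sup>2) \<partial>lborel) \<le> ennreal (((b - a) * B)\<^sup>2)"
  proof (rule minkowski_integral_inequality)
    have "?F \<in> borel_measurable borel"
      by (rule borel_measurable_continuous_on_indicator[OF _ cont]) (auto intro!: borel_closed closed_Times)
    then show "?F \<in> borel_measurable (lborel \<Otimes>\<^sub>M lborel)" by (simp add: lborel_prod)
    have "(\<integral>\<^sup>+r. ennreal (cmod (?w r)) \<partial>lborel) = (\<integral>\<^sup>+r. indicator {a..b} r \<partial>lborel)"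
      by (intro nn_integral_cong) (auto simp: indicator_def)
    then show "(\<integral>\<^sup>+r. ennreal (cmod (?w r)) \<partial>lborel) \<le> ennreal (b - a)"
      using \<open>a \<le> b\<close> by simp
    fix r assume "?w r \<noteq> 0"
    then have r: "r \<in> {a..b}" by (auto simp: indicator_def split: if_splits)
    then have "?F (x, r) = h r x" for x by simp
    then have "(\<integral>\<^sup>+x. ennreal ((cmod (?F (x, r)))\<^sup>2) \<partial>lborel) = ennreal ((norm (abs_l2 (h r)))\<^sup>2)"
      by (simp add: ennreal_norm_abs_l2_sq L2[OF r])
    also have "\<dots> \<le> ennreal (B\<^sup>2)"
      by (intro ennreal_leI power_mono B(2) r) simp
    finally show "(\<integral>\<^sup>+x. ennreal ((cmod (?F (x, r)))\<^sup>2) \<partial>lborel) \<le> ennreal (B\<^sup>2)" .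
  qed (auto intro: sigma_finite_lborel)
  then show "(\<integral>\<^sup>+x. ennreal ((cmod (g x))\<^sup>2) \<partial>lborel) \<le> ennreal (((b - a) * B)\<^sup>2)"
    by (simp only: eq)
qed (use assms in simp)

text \<open>Testing with reflected shifts of \<open>z\<close> turns the integrated equation into a
  fundamental theorem of calculus at each point x. \<open>L2_integral_mean_le\<close> carries the
  linearization error over to L2, where the continuity of \<open>h\<close> makes it small.\<close>

lemma Conv_has_vector_derivative:
  fixes p q :: "real \<Rightarrow> real ^ 'n::finite \<Rightarrow> complex"
  assumes p: "\<And>t. 0 \<le> t \<Longrightarrow> p t \<in> L2_space" "continuous_on {0..} (\<lambda>t. abs_l2 (p t))"
    and q: "\<And>t. 0 \<le> t \<Longrightarrow> q t \<in> L2_space" "continuous_on {0..} (\<lambda>t. abs_l2 (q t))"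
    and w: "w \<in> L2_space" and z: "z \<in> test_functions" and t: "0 \<le> t"
    and eq: "\<And>\<phi> t. \<phi> \<in> test_functions \<Longrightarrow> 0 \<le> t \<Longrightarrow> (LINT x|lborel. (q t x - w x) * \<phi> x) =
        integral {0..t} (\<lambda>s. (LINT x|lborel. p s x * laplacian \<phi> x) - (LINT x|lborel. q s x * laplacian (laplacian \<phi>) x))"
  shows "((\<lambda>t. Conv z (abs_l2 (q t))) has_vector_derivative
    Conv (laplacian z) (abs_l2 (p t)) - Conv (laplacian (laplacian z)) (abs_l2 (q t))) (at t within {0..})"
proof -
  have lap: "laplacian z \<in> test_functions" and lap2: "laplacian (laplacian z) \<in> test_functions"
    by (auto intro: test_functions_laplacian z)
  note k = test_functions_kernels[OF z] test_functions_kernels[OF lap] test_functions_kernels[OF lap2]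
  define H where "H r x = conv (p r) (laplacian z) x - conv (q r) (laplacian (laplacian z)) x" for r x
  define h where "h r = Conv (laplacian z) (abs_l2 (p r)) - Conv (laplacian (laplacian z)) (abs_l2 (q r))" for r
  have HL2: "H r \<in> L2_space" if "0 \<le> r" for r
    unfolding H_def[abs_def] by (intro L2_space_diff conv_L2 p(1) q(1) k that)
  have h_eq: "h r = abs_l2 (H r)" if "0 \<le> r" for r
    using p(1)[OF that] q(1)[OF that] k by (simp add: h_def H_def[abs_def] Conv_abs abs_l2_diff conv_L2)
  have h_cont: "continuous_on {0..} h"
    unfolding h_def
    by (intro continuous_on_diff bounded_linear.continuous_on[OF bounded_linear_Conv] k p(2) q(2))
  have H_cont: "continuous_on (UNIV \<times> {0..}) (\<lambda>q. H (snd q) (fst q))"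
    unfolding H_def by (intro continuous_on_diff continuous_on_conv) (use p q k in auto)
  have Hx_cont: "continuous_on {0..} (\<lambda>r. H r x)" for x
  proof -
    have "continuous_on {0..} ((\<lambda>q. H (snd q) (fst q)) \<circ> (\<lambda>r. (x, r)))"
      by (rule continuous_on_compose) (auto intro!: continuous_intros continuous_on_subset[OF H_cont])
    then show ?thesis by (simp add: o_def)
  qed
  have Hx_int: "(\<lambda>r. H r x) integrable_on {a..b}" if "0 \<le> a" for a b x
    by (intro integrable_continuous_real continuous_on_subset[OF Hx_cont]) (use that in auto)
  have from_0: "conv (q t) z x - conv w z x = integral {0..t} (\<lambda>s. H s x)" if "0 \<le> t" for t x
  proof -
    have "(LINT y|lborel. (q t y - w y) * z (x - y)) = integral {0..t} (\<lambda>s. H s x)"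
      using eq[OF test_functions_reflect[OF z, of x] that]
      by (simp add: H_def conv_def laplacian_reflect test_functions_smooth z lap)
    moreover have "(LINT y|lborel. (q t y - w y) * z (x - y)) = conv (q t) z x - conv w z x"
      using integrable_conv[OF q(1)[OF that] k(1), of x] integrable_conv[OF w k(1), of x]
      by (simp add: conv_def left_diff_distrib)
    ultimately show ?thesis by simp
  qed
  have incr: "conv (q b) z x - conv (q a) z x = integral {a..b} (\<lambda>s. H s x)" if "0 \<le> a" "a \<le> b" for a b x
  proof -
    have "integral {0..a} (\<lambda>s. H s x) + integral {a..b} (\<lambda>s. H s x) = integral {0..b} (\<lambda>s. H s x)"
      using that by (intro Henstock_Kurzweil_Integration.integral_combine Hx_int) auto
    then show ?thesis using from_0[of a x] from_0[of b x] that by (simp add: algebra_simps)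
  qed
  \<comment> \<open>The base point \<open>c\<close> is independent of the interval, so the estimate
    serves increments on both sides of it.\<close>
  have est: "norm (Conv z (abs_l2 (q b)) - Conv z (abs_l2 (q a)) - (b - a) *\<^sub>R h c) \<le> (b - a) * B"
    if ab: "0 \<le> a" "a \<le> b" "0 \<le> c" and B: "0 \<le> B" "\<And>r. r \<in> {a..b} \<Longrightarrow> norm (h r - h c) \<le> B" for a b c B
  proof -
    have b: "0 \<le> b" using ab by simp
    let ?g = "\<lambda>x. conv (q b) z x - conv (q a) z x - (b - a) *\<^sub>R H c x"
    have L: "conv (q a) z \<in> L2_space" "conv (q b) z \<in> L2_space"
      by (intro conv_L2 q(1) k ab b)+
    have "norm (abs_l2 ?g) \<le> (b - a) * B"
    proof (rule L2_integral_mean_le[where h = "\<lambda>r x. H r x - H c x", OF ab(2) _ _ B(1)])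
      have "continuous_on (UNIV \<times> {a..b}) (\<lambda>q. H (snd q) (fst q))"
        by (rule continuous_on_subset[OF H_cont]) (use ab in auto)
      moreover have "continuous_on (UNIV \<times> {a..b}) (\<lambda>q. H c (fst q))"
      proof -
        have "continuous_on (UNIV \<times> {a..b}) ((\<lambda>q. H (snd q) (fst q)) \<circ> (\<lambda>q. (fst q, c)))"
          by (rule continuous_on_compose)
            (use ab in \<open>auto intro!: continuous_intros continuous_on_subset[OF H_cont]\<close>)
        then show ?thesis by (simp add: o_def)
      qed
      ultimately show "continuous_on (UNIV \<times> {a..b}) (\<lambda>q. H (snd q) (fst q) - H c (fst q))"
        by (rule continuous_on_diff)
      show "?g \<in> L2_space" by (intro L2_space_diff L2_space_scaleR L HL2 ab)
      show "?g x = integral {a..b} (\<lambda>r. H r x - H c x)" for x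
        using ab by (subst Henstock_Kurzweil_Integration.integral_diff[OF Hx_int])
          (auto simp: incr integrable_const_ivl)
      fix r assume r: "r \<in> {a..b}"
      then have r0: "0 \<le> r" using ab by auto
      show "(\<lambda>x. H r x - H c x) \<in> L2_space" by (intro L2_space_diff HL2 r0 ab)
      show "norm (abs_l2 (\<lambda>x. H r x - H c x)) \<le> B"
        using B(2)[OF r] by (simp add: h_eq r0 ab abs_l2_diff HL2)
    qed
    moreover have "abs_l2 ?g = Conv z (abs_l2 (q b)) - Conv z (abs_l2 (q a)) - (b - a) *\<^sub>R h c"
      using ab b by (simp add: Conv_abs q(1) k h_eq abs_l2_diff abs_l2_scaleR L2_space_diff L2_space_scaleR L HL2)
    ultimately show ?thesis by simp
  qed
  show ?thesis
    unfolding has_vector_derivative_def has_derivative_within_alt h_def[symmetric]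
  proof (intro conjI allI impI)
    fix e :: real assume e: "0 < e"
    obtain d where d: "0 < d" "\<And>r. 0 \<le> r \<Longrightarrow> dist r t < d \<Longrightarrow> dist (h r) (h t) < e"
      using h_cont t e unfolding continuous_on_iff by (metis atLeast_iff)
    have "norm (Conv z (abs_l2 (q y)) - Conv z (abs_l2 (q t)) - (y - t) *\<^sub>R h t) \<le> e * norm (y - t)"
      if y: "0 \<le> y" "norm (y - t) < d" for y
    proof -
      have near: "norm (h r - h t) \<le> e" if "0 \<le> r" "\<bar>r - t\<bar> \<le> \<bar>y - t\<bar>" for r
        using d(2)[of r] that y(2) by (simp add: dist_norm)
      show ?thesis
      proof (cases "t \<le> y")
        case True
        then show ?thesis
          using est[of t y t e] t e near by (simp add: mult.commute)
      next
        case False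
        \<comment> \<open>To the left of \<open>t\<close> the interval runs from \<open>y\<close> to
          \<open>t\<close>, so the estimate is applied to the opposite increment.\<close>
        have "norm (Conv z (abs_l2 (q t)) - Conv z (abs_l2 (q y)) - (t - y) *\<^sub>R h t) \<le> (t - y) * e"
          using False y t e by (intro est) (auto intro!: near)
        moreover have "Conv z (abs_l2 (q y)) - Conv z (abs_l2 (q t)) - (y - t) *\<^sub>R h t
          = - (Conv z (abs_l2 (q t)) - Conv z (abs_l2 (q y)) - (t - y) *\<^sub>R h t)"
          by (simp add: algebra_simps)
        ultimately show ?thesis
          using False by (simp only: norm_minus_cancel) (simp add: mult.commute)
      qed
    qed
    then show "\<exists>d>0. \<forall>y\<in>{0..}. norm (y - t) < d \<longrightarrow>
        norm (Conv z (abs_l2 (q y)) - Conv z (abs_l2 (q t)) - (y - t) *\<^sub>R h t) \<le> e * norm (y - t)"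
      using d(1) by auto
  qed (rule bounded_linear_scaleR_left)
qed

context damped_flow
begin

text \<open>The error belongs to the kernel \<delta> - \<open>mollifier m\<close>, which is not a
  function. It is the limit of \<open>En\<close> for \<open>mollifier k - mollifier m\<close> as k
  tends to infinity, and monotonicity in time survives the limit.\<close>

lemma mollification_error_le:
  assumes "0 \<le> t"
  shows "(\<Sum>a\<in>UNIV. (norm (component a t - Conv (mollifier m) (component a t)))\<^sup>2)
    \<le> (\<Sum>a\<in>UNIV. (norm (component a 0 - Conv (mollifier m) (component a 0)))\<^sup>2)"
proof -
  let ?z = "\<lambda>k x. mollifier k x - mollifier m x"
  have z: "?z k \<in> test_functions" for k by (intro test_functions_diff mollifier(1))
  have "(\<lambda>k. En (?z k) s) \<longlonglongrightarrow> (\<Sum>a\<in>UNIV. (norm (component a s - Conv (mollifier m) (component a s)))\<^sup>2)" for s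
    unfolding En_def Conv_kernel_diff[OF test_functions_kernels[OF mollifier(1)] test_functions_kernels[OF mollifier(1)]]
    by (intro tendsto_sum tendsto_power tendsto_norm tendsto_diff tendsto_const Conv_mollifier_tendsto)
  from this[of t] this[of 0] show ?thesis
    by (rule LIMSEQ_le) (use En_antimono[OF z _ assms] in auto)
qed

lemma total_energy_tendsto:
  "((\<lambda>t. \<Sum>a\<in>UNIV. (norm (component a t))\<^sup>2) \<longlongrightarrow> 0) at_top"
proof (rule tendstoI)
  fix e :: real assume e: "0 < e"
  have "(\<lambda>m. \<Sum>a\<in>UNIV. (norm (component a 0 - Conv (mollifier m) (component a 0)))\<^sup>2)
      \<longlonglongrightarrow> (\<Sum>a\<in>(UNIV :: 'n option set). (norm (component a 0 - component a 0))\<^sup>2)"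
    by (intro tendsto_sum tendsto_power tendsto_norm tendsto_diff tendsto_const Conv_mollifier_tendsto)
  then have "\<forall>\<^sub>F m in sequentially. (\<Sum>a\<in>UNIV. (norm (component a 0 - Conv (mollifier m) (component a 0)))\<^sup>2) < e / 4"
    by (rule order_tendstoD(2)) (use e in simp)
  then obtain m where m: "(\<Sum>a\<in>UNIV. (norm (component a 0 - Conv (mollifier m) (component a 0)))\<^sup>2) < e / 4"
    using eventually_happens'[OF sequentially_bot] by blast
  \<comment> \<open>Splitting the square costs a factor 2 on each part, so e / 4 for both adds up to
    e.\<close>
  have le: "(\<Sum>a\<in>UNIV. (norm (component a t))\<^sup>2) \<le> 2 * En (mollifier m) t + e / 2" if t: "0 \<le> t" for t
  proof -
    have "(norm X)\<^sup>2 \<le> 2 * (norm (Conv (mollifier m) X))\<^sup>2 + 2 * (norm (X - Conv (mollifier m) X))\<^sup>2" for X :: "'n l2"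
    proof -
      let ?p = "norm (Conv (mollifier m) X)" and ?q = "norm (X - Conv (mollifier m) X)"
      have "norm X \<le> ?p + ?q"
        using norm_triangle_ineq[of "Conv (mollifier m) X" "X - Conv (mollifier m) X"] by simp
      then have "(norm X)\<^sup>2 \<le> (?p + ?q)\<^sup>2" by (intro power_mono) auto
      also have "\<dots> \<le> 2 * ?p\<^sup>2 + 2 * ?q\<^sup>2"
        using sum_squares_bound[of ?p ?q] unfolding power2_sum by linarith
      finally show ?thesis .
    qed
    then have "(\<Sum>a\<in>UNIV. (norm (component a t))\<^sup>2) \<le> (\<Sum>a\<in>UNIV. 2 * (norm (Conv (mollifier m) (component a t)))\<^sup>2
        + 2 * (norm (component a t - Conv (mollifier m) (component a t)))\<^sup>2)"
      by (intro sum_mono)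
    also have "\<dots> = 2 * En (mollifier m) t + 2 * (\<Sum>a\<in>UNIV. (norm (component a t - Conv (mollifier m) (component a t)))\<^sup>2)"
      by (simp add: En_def sum.distrib sum_distrib_left)
    finally show ?thesis using mollification_error_le[OF t, of m] m by linarith
  qed
  have "\<forall>\<^sub>F t in at_top. En (mollifier m) t < e / 4"
    using En_tendsto[OF mollifier(1)] by (rule order_tendstoD(2)) (use e in simp)
  then show "\<forall>\<^sub>F t in at_top. dist (\<Sum>a\<in>UNIV. (norm (component a t))\<^sup>2) 0 < e"
    using eventually_ge_at_top[of 0]
  proof eventually_elim
    case (elim t)
    have "0 \<le> (\<Sum>a\<in>UNIV. (norm (component a t))\<^sup>2)" by (intro sum_nonneg) auto
    then show ?case using le[of t] elim by (simp add: dist_real_def)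
  qed
qed

end

theorem theorem1p1:
  fixes u0 u1 :: "real ^ 'n \<Rightarrow> complex"
    and u :: "real \<Rightarrow> real ^ 'n \<Rightarrow> complex"
  assumes "u0 \<in> H1_space" and "integrable lborel u0"
    and "u1 \<in> L2_space" and "integrable lborel u1"
    and "mild_solution u0 u1 u"
  shows "(energy u \<longlongrightarrow> 0) at_top"
proof -
  let ?v = "time_deriv u"
  have H1: "u t \<in> H1_space" if "0 \<le> t" for t
    using assms(5) that by (simp add: mild_solution_def continuous_into_H1_def)
  have C1: "continuous_into_L2 u" "continuous_into_L2 ?v"
    using assms(5) by (simp_all add: mild_solution_def C1_into_L2_def)
  note uc = continuous_into_L2_imp[OF C1(1)] and vc = continuous_into_L2_imp[OF C1(2)]
  \<comment> \<open>The choice in \<open>time_deriv\<close> yields a derivative as soon as one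
    exists.\<close>
  have td: "has_L2_time_deriv u (?v t) t" if "0 \<le> t" for t
  proof -
    have "\<exists>v. has_L2_time_deriv u v t"
      using assms(5) that by (simp add: mild_solution_def C1_into_L2_def)
    then show ?thesis unfolding time_deriv_def by (rule someI_ex)
  qed
  interpret damped_flow "\<lambda>t. abs_l2 (u t)" "\<lambda>t. abs_l2 (?v t)" "\<lambda>i t. abs_l2 (weak_partial i (u t))"
  proof
    fix t :: real assume t: "0 \<le> t"
    show "((\<lambda>t. abs_l2 (u t)) has_vector_derivative abs_l2 (?v t)) (at t within {0..})"
      by (rule has_L2_time_deriv_imp[OF uc(1) td[OF t] t])
    fix z :: "real ^ 'n \<Rightarrow> complex" assume z: "z \<in> test_functions"
    show "((\<lambda>t. Conv z (abs_l2 (?v t))) has_vector_derivative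
        Conv (laplacian z) (abs_l2 (u t)) - Conv (laplacian (laplacian z)) (abs_l2 (?v t))) (at t within {0..})"
    proof (rule Conv_has_vector_derivative[OF uc vc assms(3) z t])
      fix \<phi> :: "real ^ 'n \<Rightarrow> complex" and s :: real
      assume "\<phi> \<in> test_functions" "0 \<le> s"
      with assms(5)[unfolded mild_solution_def, THEN conjunct2, THEN conjunct2, THEN conjunct2, THEN conjunct2]
      show "(LINT x|lborel. (?v s x - u1 x) * \<phi> x) = integral {0..s} (\<lambda>s. (LINT x|lborel. u s x * laplacian \<phi> x)
          - (LINT x|lborel. ?v s x * laplacian (laplacian \<phi>) x))"
        by - (drule(1) bspec, drule spec[of _ s], drule(1) mp, assumption)
    qed
    show "Conv z (abs_l2 (weak_partial i (u t))) = Conv (partial_deriv i z) (abs_l2 (u t))" for i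
      using has_weak_partial_conv[OF weak_partial(2)[OF H1[OF t], of i] z]
      by (simp add: Conv_abs weak_partial(1)[OF H1[OF t]] uc(1)[OF t] test_functions_kernels
          test_functions_partial_deriv z)
  qed
  have "energy u t = (\<Sum>a\<in>UNIV. (norm (component a t))\<^sup>2)" if t: "0 \<le> t" for t
  proof -
    have L: "weak_partial i (u t) \<in> L2_space" for i by (rule weak_partial(1)[OF H1[OF t]])
    have "(grad_L2_norm (u t))\<^sup>2 = (LINT x|lborel. (\<Sum>i\<in>UNIV. (cmod (weak_partial i (u t) x))\<^sup>2))"
      unfolding grad_L2_norm_def by (simp add: sum_nonneg)
    also have "\<dots> = (\<Sum>i\<in>UNIV. LINT x|lborel. (cmod (weak_partial i (u t) x))\<^sup>2)"
      using L by (intro Bochner_Integration.integral_sum) (simp add: L2_space_def)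
    also have "\<dots> = (\<Sum>i\<in>UNIV. (norm (abs_l2 (weak_partial i (u t))))\<^sup>2)"
      by (simp add: norm_abs_l2 L L2_norm_def)
    finally show ?thesis
      by (simp add: energy_def component_def UNIV_option_conv sum.reindex norm_abs_l2 vc(1) t)
  qed
  \<comment> \<open>The identity is known for t \<ge> 0, and eventual equality carries the limit
    over.\<close>
  then have "\<forall>\<^sub>F t in at_top. (\<Sum>a\<in>UNIV. (norm (component a t))\<^sup>2) = energy u t"
    by (intro eventually_mono[OF eventually_ge_at_top[of 0]]) simp
  with total_energy_tendsto show ?thesis by (rule Lim_transform_eventually)
qed

end
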